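(* Assume that the standing assumptions (A1)-(A12) listed in the context hold. Let $h_0\in(0,1)$ be such that for all $h\in(0,h_0)$ the discrete problem (P)$_n$ of the context has a unique solution $(\theta_{n+1},\varphi_{n+1})$ with $\theta_{n+1}\in D(A_1)$, $\varphi_{n+1}\in D(B_1)\cap D(A_2)$ for $n=0,\dots,N-1$. Let $(\theta,\varphi)$ be the unique solution of problem (P) of the context and $v=\frac{d\varphi}{dt}$. Then there exist constants $h_{00}\in(0,h_0)$ and $M=M(T)>0$ such that $$ \begin{aligned} &\|L^{1/2}(\widehat{v}_{h}-v)\|_{L^{\infty}(0,T;H)}+\|B_{1}^{1/2}(\overline{v}_{h}-v)\|_{L^2(0,T;H)}+\|\widehat{\varphi}_{h}-\varphi\|_{L^{\infty}(0,T;V)}\\ &+\|\widehat{\theta}_{h}-\theta\|_{L^{\infty}(0,T;H)}+\|\overline{\theta}_{h}-\theta\|_{L^2(0,T;V)}+\|B_{2}^{1/2}(\widehat{\theta}_{h}-\theta)\|_{L^{\infty}(0,T;H)}\\ &+\int_{0}^{T}\bigl(B_{2}(\overline{\theta}_{h}(t)-\theta(t)),A_{1}(\overline{\theta}_{h}(t)-\theta(t))\bigr)_{H}\,dt\le M h^{1/2} \end{aligned} $$ for all $h\in(0,h_{00})$.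
   Context: Setting. $T>0$ and $\eta>0$ are real constants; $h=T/N$ with $N\in\mathbb{N}$ is the time step. $(\cdot,\cdot)_H$ is the inner product of $H$, $\langle\cdot,\cdot\rangle_{V^*,V}$ the duality pairing, $I$ the identity; $S^{1/2}$ is the square root of a nonnegative selfadjoint operator $S$. Standing assumptions. (A1) $V$ and $H$ are real Hilbert spaces, $V\subset H$ with dense, continuous and compact embedding; $V\subset H\subset V^{*}$ by identifying $H$ with its dual, where $V^*$ is the dual of $V$. (A2) $L:H\to H$ is a bounded linear operator with $(Lw,z)_H=(w,Lz)_H$ for all $w,z\in H$ and $(Lw,w)_H\ge c_L\|w\|_H^2$ for all $w\in H$, where $c_L>0$ is a constant. (A3) $A_j:D(A_j)\subset H\to H$ ($j=1,2$) are linear maximal monotone selfadjoint operators, $D(A_j)$ being linear subspaces of $H$ with $D(A_j)\subset V$. There exist bounded linear monotone operators $A_j^*:V\to V^*$ ($j=1,2$) such that $\langle A_j^*w,z\rangle_{V^*,V}=\langle A_j^*z,w\rangle_{V^*,V}$ for all $w,z\in V$, and $A_j^*w=A_jw$ for all $w\in D(A_j)$. Moreover, for all $\alpha>0$ and $j=1,2$ there exists $\omega_{j,\alpha}>0$ such that $\langle A_j^*w,w\rangle_{V^*,V}+\alpha\|w\|_H^2\ge\omega_{j,\alpha}\|w\|_V^2$ for all $w\in V$. (A4) $B_j:D(B_j)\subset H\to H$ ($j=1,2$) are linear maximal monotone selfadjoint operators, $D(B_j)$ being linear subspaces of $H$, with $D(A_1)\subset D(B_2)$, $D(B_1)\cap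 D(A_2)\ne\emptyset$, $(B_1w,A_2w)_H\ge0$ for all $w\in D(B_1)\cap D(A_2)$, $(B_2w,A_1w)_H\ge0$ for all $w\in D(A_1)$, and $(B_1w,A_2z)_H=(B_1z,A_2w)_H$ for all $w,z\in D(B_1)\cap D(A_2)$. Moreover $D(A_2)\subset V$. (A5) There is a constant $C_{A_1,B_2}>0$ with $\|B_2\theta\|_H\le C_{A_1,B_2}(\|A_1\theta\|_H+\|\theta\|_H)$ for all $\theta\in D(A_1)$. (A6) $\Phi:D(\Phi)\subset H\to H$ is a (single-valued) maximal monotone operator with $\Phi(0)=0$ and $V\subset D(\Phi)$; there exist constants $p,q,C_\Phi>0$ with $\|\Phi w-\Phi z\|_H\le C_\Phi(1+\|w\|_V^p+\|z\|_V^q)\|w-z\|_V$ for all $w,z\in V$. (A7) There is a lower semicontinuous convex function $i:V\to\{x\in\mathbb{R}\mid x\ge0\}$ with $(\Phi w,w-z)_H\ge i(w)-i(z)$ for all $w,z\in V$. (A8) For $\lambda>0$ let $\Phi_\lambda:H\to H$ be the Yosida approximation of $\Phi$. Then $\Phi_\lambda(0)=0$, $(\Phi_\lambda w,B_1w)_H\ge0$ for all $w\in D(B_1)$, and $(\Phi_\lambda w,A_2w)_H\ge0$ for all $w\in D(A_2)$. (A9) $B_j^*:V\to V^*$ ($j=1,2$) are bounded linear monotone operators with $\langle B_j^*w,z\rangle_{V^*,V}=\langle B_j^*z,w\rangle_{V^*,V}$ for all $w,z\in V$ and $B_j^*w=B_jw$ for all $w\in D(B_j)\cap V$. (A10) For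 all $g\in H$, $a,b,c,d,d'>0$, $\lambda>0$, $h>0$: if $\varphi_\lambda\in V$ satisfies $L\varphi_\lambda+aB_1^*\varphi_\lambda+bA_2^*\varphi_\lambda+c\Phi_\lambda\varphi_\lambda+d\mathcal{L}\varphi_\lambda+d'B_2(I+hA_1)^{-1}\varphi_\lambda=g$ in $V^*$, then $\varphi_\lambda\in D(B_1)\cap D(A_2)$ and $L\varphi_\lambda+aB_1\varphi_\lambda+bA_2\varphi_\lambda+c\Phi_\lambda\varphi_\lambda+d\mathcal{L}\varphi_\lambda+d'B_2(I+hA_1)^{-1}\varphi_\lambda=g$ in $H$. (A11) $\mathcal{L}:H\to H$ is Lipschitz continuous with Lipschitz constant $C_{\mathcal{L}}>0$. (A12) $\theta_0\in D(A_1)$, $A_1\theta_0\in V$, $\varphi_0\in D(B_1)\cap D(A_2)$, $v_0\in D(B_1)\cap V$. Problem (P). A pair $(\theta,\varphi)$ with $\theta\in H^1(0,T;V)\cap L^\infty(0,T;V)\cap L^\infty(0,T;D(A_1))$, $\varphi\in W^{2,\infty}(0,T;H)\cap W^{1,\infty}(0,T;V)\cap L^2(0,T;D(A_2))$, $\frac{d\varphi}{dt}\in L^2(0,T;D(B_1))$, $\Phi\varphi\in L^\infty(0,T;H)$ is a solution of (P) if $\frac{d\theta}{dt}+\eta\frac{d\varphi}{dt}+A_1\theta=0$ and $L\frac{d^2\varphi}{dt^2}+B_1\frac{d\varphi}{dt}+A_2\varphi+\Phi\varphi+\mathcal{L}\varphi=B_2\theta$ in $H$ a.e. on $(0,T)$,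 and $\theta(0)=\theta_0$, $\varphi(0)=\varphi_0$, $\frac{d\varphi}{dt}(0)=v_0$ in $H$. Discrete problem (P)$_n$. With $\delta_hx_n:=\frac{x_{n+1}-x_n}{h}$ for $x=\theta,\varphi,v$, starting from the given $\theta_0,\varphi_0,v_0$: for $n=0,\dots,N-1$, $\delta_h\theta_n+\eta\delta_h\varphi_n+A_1\theta_{n+1}=0$; $Lz_{n+1}+B_1v_{n+1}+A_2\varphi_{n+1}+\Phi\varphi_{n+1}+\mathcal{L}\varphi_{n+1}=B_2\theta_{n+1}$; $z_0=z_1$, $z_{n+1}=\delta_hv_n$; $v_{n+1}=\delta_h\varphi_n$. Interpolants. $\widehat\theta_h(0):=\theta_0$, $\widehat\varphi_h(0):=\varphi_0$, $\widehat v_h(0):=v_0$, and for a.a. $t\in(nh,(n+1)h)$, $n=0,\dots,N-1$: $\frac{d\widehat\theta_h}{dt}(t):=\delta_h\theta_n$, $\frac{d\widehat\varphi_h}{dt}(t):=\delta_h\varphi_n$, $\frac{d\widehat v_h}{dt}(t):=\delta_hv_n$ (so the hatted functions are continuous and piecewise linear), $\overline\theta_h(t):=\theta_{n+1}$, $\overline z_h(t):=z_{n+1}$, $\overline\varphi_h(t):=\varphi_{n+1}$, $\overline v_h(t):=v_{n+1}$. The constant $M$ does not depend on $h$. *)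

theory Defs
  imports "HOL-Analysis.Analysis" "HOL-Probability.Essential_Supremum"
begin

section \<open>Unbounded operators\<close>

text \<open>
  An operator A : D(A) \<subseteq> H \<rightarrow> H is a pair of a set \<open>D\<close> and a total function \<open>A\<close>;
  the values of \<open>A\<close> outside \<open>D\<close> carry no meaning.
\<close>

definition linear_op :: "'h::real_vector set \<Rightarrow> ('h \<Rightarrow> 'h) \<Rightarrow> bool" where
  "linear_op D A \<longleftrightarrow> subspace D \<and>
     (\<forall>x\<in>D. \<forall>y\<in>D. A (x + y) = A x + A y) \<and> (\<forall>c. \<forall>x\<in>D. A (c *\<^sub>R x) = c *\<^sub>R A x)"

definition monotone_op :: "'h::real_inner set \<Rightarrow> ('h \<Rightarrow> 'h) \<Rightarrow> bool" where
  "monotone_op D A \<longleftrightarrow> (\<forall>x\<in>D. \<forall>y\<in>D. 0 \<le> (A x - A y) \<bullet> (x - y))"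

text \<open>Maximality of the graph among all (possibly multivalued) monotone graphs.\<close>

definition maximal_monotone_op :: "'h::real_inner set \<Rightarrow> ('h \<Rightarrow> 'h) \<Rightarrow> bool" where
  "maximal_monotone_op D A \<longleftrightarrow> monotone_op D A \<and>
     (\<forall>x y. (\<forall>w\<in>D. 0 \<le> (y - A w) \<bullet> (x - w)) \<longrightarrow> x \<in> D \<and> y = A x)"

text \<open>Densely defined, with the graph of the adjoint equal to the graph of the operator.\<close>

definition selfadjoint_op :: "'h::real_inner set \<Rightarrow> ('h \<Rightarrow> 'h) \<Rightarrow> bool" where
  "selfadjoint_op D A \<longleftrightarrow> linear_op D A \<and> closure D = UNIV \<and>
     (\<forall>y z. (\<forall>x\<in>D. A x \<bullet> y = x \<bullet> z) \<longleftrightarrow> y \<in> D \<and> z = A y)"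

text \<open>
  \<open>(DR, R)\<close> is the square root of the nonnegative selfadjoint operator \<open>(D, S)\<close>: the
  (unique) nonnegative selfadjoint operator with R R = S, including equality of domains.
\<close>

definition is_sqrt_op ::
  "'h::real_inner set \<Rightarrow> ('h \<Rightarrow> 'h) \<Rightarrow> 'h set \<Rightarrow> ('h \<Rightarrow> 'h) \<Rightarrow> bool" where
  "is_sqrt_op DR R D S \<longleftrightarrow> selfadjoint_op DR R \<and> (\<forall>x\<in>DR. 0 \<le> R x \<bullet> x) \<and>
     D = {x\<in>DR. R x \<in> DR} \<and> (\<forall>x\<in>D. S x = R (R x))"

text \<open>The resolvent \<open>(I + \<mu> A)\<^sup>-\<^sup>1\<close> and the Yosida approximation of a monotone operator.\<close>

definition resolvent :: "'h::real_vector set \<Rightarrow> ('h \<Rightarrow> 'h) \<Rightarrow> real \<Rightarrow> 'h \<Rightarrow> 'h" where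
  "resolvent D A \<mu> x = (THE y. y \<in> D \<and> y + \<mu> *\<^sub>R A y = x)"

definition yosida :: "'h::real_vector set \<Rightarrow> ('h \<Rightarrow> 'h) \<Rightarrow> real \<Rightarrow> 'h \<Rightarrow> 'h" where
  "yosida D A \<mu> x = (1 / \<mu>) *\<^sub>R (x - resolvent D A \<mu> x)"

section \<open>The Gelfand triple V, H, V*\<close>

text \<open>
  The inclusion of V in H is an injective bounded linear map \<open>\<iota>\<close> between two Hilbert
  space types, V* is the type \<open>'v \<Rightarrow>\<^sub>L real\<close>, and \<open>dual_embed \<iota>\<close> is the inclusion of H in V*
  given by the identification of H with its dual.
\<close>

definition dual_embed ::
  "('v::real_normed_vector \<Rightarrow>\<^sub>L 'h::real_inner) \<Rightarrow> 'h \<Rightarrow> 'v \<Rightarrow>\<^sub>L real" where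
  "dual_embed \<iota> w = blinfun_inner_left w o\<^sub>L \<iota>"

text \<open>
  \<open>As\<close> : V \<rightarrow> V* is bounded, linear, monotone and symmetric, and agrees with \<open>A\<close> on the elements
  of V lying in \<open>D\<close>.
\<close>

definition monotone_sym_extension ::
  "('v::real_normed_vector \<Rightarrow>\<^sub>L 'h::real_inner) \<Rightarrow> 'h set \<Rightarrow> ('h \<Rightarrow> 'h) \<Rightarrow>
   ('v \<Rightarrow>\<^sub>L 'v \<Rightarrow>\<^sub>L real) \<Rightarrow> bool" where
  "monotone_sym_extension \<iota> D A As \<longleftrightarrow>
     (\<forall>w. 0 \<le> As w w) \<and> (\<forall>w z. As w z = As z w) \<and>
     (\<forall>w. \<iota> w \<in> D \<longrightarrow> As w = dual_embed \<iota> (A (\<iota> w)))"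

definition coercive_up_to_H ::
  "('v::real_normed_vector \<Rightarrow>\<^sub>L 'h::real_inner) \<Rightarrow> ('v \<Rightarrow>\<^sub>L 'v \<Rightarrow>\<^sub>L real) \<Rightarrow> bool" where
  "coercive_up_to_H \<iota> As \<longleftrightarrow>
     (\<forall>\<alpha>>0. \<exists>\<omega>>0. \<forall>w. As w w + \<alpha> * (norm (\<iota> w))\<^sup>2 \<ge> \<omega> * (norm w)\<^sup>2)"

definition lower_semicontinuous :: "('a::topological_space \<Rightarrow> real) \<Rightarrow> bool" where
  "lower_semicontinuous f \<longleftrightarrow> (\<forall>x. \<forall>e>0. eventually (\<lambda>y. f x - e < f y) (nhds x))"

section \<open>Bochner spaces on (0,T)\<close>

text \<open>
  Functions are considered up to equality almost everywhere. As the spaces of values are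
  separable, Borel measurability and strong measurability agree.
\<close>

abbreviation time_measure :: "real \<Rightarrow> real measure" where
  "time_measure T \<equiv> lebesgue_on {0<..<T}"

definition L2_space :: "real \<Rightarrow> (real \<Rightarrow> 'a::{banach, second_countable_topology}) \<Rightarrow> bool" where
  "L2_space T u \<longleftrightarrow> u \<in> borel_measurable (time_measure T) \<and>
     integrable (time_measure T) (\<lambda>t. (norm (u t))\<^sup>2)"

definition L2_nrm :: "real \<Rightarrow> (real \<Rightarrow> 'a::{banach, second_countable_topology}) \<Rightarrow> real" where
  "L2_nrm T u = sqrt (LINT t|time_measure T. (norm (u t))\<^sup>2)"

definition Linf_space :: "real \<Rightarrow> (real \<Rightarrow> 'a::{banach, second_countable_topology}) \<Rightarrow> bool" where
  "Linf_space T u \<longleftrightarrow> u \<in> borel_measurable (time_measure T) \<and>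
     esssup (time_measure T) (\<lambda>t. ereal (norm (u t))) < \<infinity>"

definition Linf_nrm :: "real \<Rightarrow> (real \<Rightarrow> 'a::{banach, second_countable_topology}) \<Rightarrow> real" where
  "Linf_nrm T u = real_of_ereal (esssup (time_measure T) (\<lambda>t. ereal (norm (u t))))"

text \<open>The spaces \<open>L\<^sup>2(0,T;D(A))\<close> and \<open>L\<^sup>\<infinity>(0,T;D(A))\<close>, where D(A) carries the graph norm.\<close>

definition L2_dom :: "real \<Rightarrow> 'h::{banach, second_countable_topology} set \<Rightarrow> ('h \<Rightarrow> 'h) \<Rightarrow>
    (real \<Rightarrow> 'h) \<Rightarrow> bool" where
  "L2_dom T D A u \<longleftrightarrow> (AE t in time_measure T. u t \<in> D) \<and>
     L2_space T u \<and> L2_space T (\<lambda>t. A (u t))"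

definition Linf_dom :: "real \<Rightarrow> 'h::{banach, second_countable_topology} set \<Rightarrow> ('h \<Rightarrow> 'h) \<Rightarrow>
    (real \<Rightarrow> 'h) \<Rightarrow> bool" where
  "Linf_dom T D A u \<longleftrightarrow> (AE t in time_measure T. u t \<in> D) \<and>
     Linf_space T u \<and> Linf_space T (\<lambda>t. A (u t))"

text \<open>
  du/dt = g on (0,T) for an integrable g: u coincides almost everywhere with a primitive of g.
\<close>

definition has_time_deriv :: "real \<Rightarrow> (real \<Rightarrow> 'a::{banach, second_countable_topology}) \<Rightarrow>
    (real \<Rightarrow> 'a) \<Rightarrow> bool" where
  "has_time_deriv T u g \<longleftrightarrow> integrable (time_measure T) g \<and>
     (\<exists>c. AE t in time_measure T. u t = c + (LINT s|time_measure t. g s))"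

text \<open>The value at time 0 of the continuous representative.\<close>

definition has_initial_value :: "real \<Rightarrow> (real \<Rightarrow> 'a::{banach, second_countable_topology}) \<Rightarrow>
    'a \<Rightarrow> bool" where
  "has_initial_value T u c \<longleftrightarrow>
     (\<exists>w. continuous_on {0..T} w \<and> (AE t in time_measure T. u t = w t) \<and> w 0 = c)"

definition H1_space :: "real \<Rightarrow> (real \<Rightarrow> 'a::{banach, second_countable_topology}) \<Rightarrow> bool" where
  "H1_space T u \<longleftrightarrow> L2_space T u \<and> (\<exists>g. has_time_deriv T u g \<and> L2_space T g)"

definition W1inf_space :: "real \<Rightarrow> (real \<Rightarrow> 'a::{banach, second_countable_topology}) \<Rightarrow> bool" where
  "W1inf_space T u \<longleftrightarrow> Linf_space T u \<and> (\<exists>g. has_time_deriv T u g \<and> Linf_space T g)"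

definition W2inf_space :: "real \<Rightarrow> (real \<Rightarrow> 'a::{banach, second_countable_topology}) \<Rightarrow> bool" where
  "W2inf_space T u \<longleftrightarrow> Linf_space T u \<and> (\<exists>g. has_time_deriv T u g \<and> W1inf_space T g)"

section \<open>Standing assumptions\<close>

text \<open>
  The parameter \<open>Lip\<close> is the Lipschitz perturbation, as opposed to the linear operator \<open>L\<close>.
  The sort constraint of separability does not restrict the Hilbert spaces: an
  injective compact linear map \<open>\<iota>\<close> with dense range forces both H and V to be separable.
  The initial data all lie in V by the assumptions on the domains and are therefore
  given as elements of V.
\<close>

locale parabolic_hyperbolic_system =
  fixes T \<eta> :: real
    and \<iota> :: "'v::{real_inner, banach, second_countable_topology}
              \<Rightarrow>\<^sub>L 'h::{real_inner, banach, second_countable_topology}"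
    and L :: "'h \<Rightarrow> 'h"
    and DA1 :: "'h set" and A1 :: "'h \<Rightarrow> 'h" and A1s :: "'v \<Rightarrow>\<^sub>L 'v \<Rightarrow>\<^sub>L real"
    and DA2 :: "'h set" and A2 :: "'h \<Rightarrow> 'h" and A2s :: "'v \<Rightarrow>\<^sub>L 'v \<Rightarrow>\<^sub>L real"
    and DB1 :: "'h set" and B1 :: "'h \<Rightarrow> 'h" and B1s :: "'v \<Rightarrow>\<^sub>L 'v \<Rightarrow>\<^sub>L real"
    and DB2 :: "'h set" and B2 :: "'h \<Rightarrow> 'h" and B2s :: "'v \<Rightarrow>\<^sub>L 'v \<Rightarrow>\<^sub>L real"
    and D\<Phi> :: "'h set" and \<Phi> :: "'h \<Rightarrow> 'h"
    and Lip :: "'h \<Rightarrow> 'h"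
    and \<theta>0 \<phi>0 v0 :: 'v
  assumes T_pos: "0 < T" and \<eta>_pos: "0 < \<eta>"
    and embed_inj: "inj (blinfun_apply \<iota>)"
    and embed_dense: "closure (range (blinfun_apply \<iota>)) = UNIV"
    and embed_compact: "compact (closure (blinfun_apply \<iota> ` cball 0 1))"
    and L_bounded: "bounded_linear L"
    and L_sym: "\<And>w z. L w \<bullet> z = w \<bullet> L z"
    and L_coercive: "\<exists>c>0. \<forall>w. L w \<bullet> w \<ge> c * (norm w)\<^sup>2"
    and A1_op: "linear_op DA1 A1" "maximal_monotone_op DA1 A1" "selfadjoint_op DA1 A1"
    and A2_op: "linear_op DA2 A2" "maximal_monotone_op DA2 A2" "selfadjoint_op DA2 A2"
    and DA1_V: "DA1 \<subseteq> range (blinfun_apply \<iota>)"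
    and DA2_V: "DA2 \<subseteq> range (blinfun_apply \<iota>)"
    and A1s_ext: "monotone_sym_extension \<iota> DA1 A1 A1s"
    and A2s_ext: "monotone_sym_extension \<iota> DA2 A2 A2s"
    and A1s_coercive: "coercive_up_to_H \<iota> A1s"
    and A2s_coercive: "coercive_up_to_H \<iota> A2s"
    and B1_op: "linear_op DB1 B1" "maximal_monotone_op DB1 B1" "selfadjoint_op DB1 B1"
    and B2_op: "linear_op DB2 B2" "maximal_monotone_op DB2 B2" "selfadjoint_op DB2 B2"
    and DA1_DB2: "DA1 \<subseteq> DB2"
    and DB1_DA2: "DB1 \<inter> DA2 \<noteq> {}"
    and B1_A2_nonneg: "\<And>w. w \<in> DB1 \<inter> DA2 \<Longrightarrow> 0 \<le> B1 w \<bullet> A2 w"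
    and B2_A1_nonneg: "\<And>w. w \<in> DA1 \<Longrightarrow> 0 \<le> B2 w \<bullet> A1 w"
    and B1_A2_sym: "\<And>w z. w \<in> DB1 \<inter> DA2 \<Longrightarrow> z \<in> DB1 \<inter> DA2 \<Longrightarrow> B1 w \<bullet> A2 z = B1 z \<bullet> A2 w"
    and B2_bound: "\<exists>C>0. \<forall>w\<in>DA1. norm (B2 w) \<le> C * (norm (A1 w) + norm w)"
    and \<Phi>_maximal: "maximal_monotone_op D\<Phi> \<Phi>"
    and \<Phi>_zero: "\<Phi> 0 = 0"
    and V_D\<Phi>: "range (blinfun_apply \<iota>) \<subseteq> D\<Phi>"
    and \<Phi>_growth: "\<exists>p>0. \<exists>q>0. \<exists>C>0. \<forall>w z.
        norm (\<Phi> (\<iota> w) - \<Phi> (\<iota> z)) \<le> C * (1 + norm w powr p + norm z powr q) * norm (w - z)"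
    and \<Phi>_potential: "\<exists>i :: 'v \<Rightarrow> real. (\<forall>w. 0 \<le> i w) \<and> lower_semicontinuous i \<and>
        convex_on UNIV i \<and> (\<forall>w z. \<Phi> (\<iota> w) \<bullet> (\<iota> w - \<iota> z) \<ge> i w - i z)"
    and yosida_zero: "\<And>\<mu>. 0 < \<mu> \<Longrightarrow> yosida D\<Phi> \<Phi> \<mu> 0 = 0"
    and yosida_B1: "\<And>\<mu> w. 0 < \<mu> \<Longrightarrow> w \<in> DB1 \<Longrightarrow> 0 \<le> yosida D\<Phi> \<Phi> \<mu> w \<bullet> B1 w"
    and yosida_A2: "\<And>\<mu> w. 0 < \<mu> \<Longrightarrow> w \<in> DA2 \<Longrightarrow> 0 \<le> yosida D\<Phi> \<Phi> \<mu> w \<bullet> A2 w"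
    and B1s_ext: "monotone_sym_extension \<iota> DB1 B1 B1s"
    and B2s_ext: "monotone_sym_extension \<iota> DB2 B2 B2s"
    and elliptic_regularity: "\<And>g a b c d d' \<mu> h \<phi>.
        0 < a \<Longrightarrow> 0 < b \<Longrightarrow> 0 < c \<Longrightarrow> 0 < d \<Longrightarrow> 0 < d' \<Longrightarrow> 0 < \<mu> \<Longrightarrow> 0 < h \<Longrightarrow>
        dual_embed \<iota> (L (\<iota> \<phi>)) + a *\<^sub>R B1s \<phi> + b *\<^sub>R A2s \<phi>
          + c *\<^sub>R dual_embed \<iota> (yosida D\<Phi> \<Phi> \<mu> (\<iota> \<phi>)) + d *\<^sub>R dual_embed \<iota> (Lip (\<iota> \<phi>))
          + d' *\<^sub>R dual_embed \<iota> (B2 (resolvent DA1 A1 h (\<iota> \<phi>))) = dual_embed \<iota> g \<Longrightarrow>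
        \<iota> \<phi> \<in> DB1 \<inter> DA2 \<and>
        L (\<iota> \<phi>) + a *\<^sub>R B1 (\<iota> \<phi>) + b *\<^sub>R A2 (\<iota> \<phi>)
          + c *\<^sub>R yosida D\<Phi> \<Phi> \<mu> (\<iota> \<phi>) + d *\<^sub>R Lip (\<iota> \<phi>)
          + d' *\<^sub>R B2 (resolvent DA1 A1 h (\<iota> \<phi>)) = g"
    and Lip_lipschitz: "\<exists>C>0. C-lipschitz_on UNIV Lip"
    and \<theta>0_dom: "\<iota> \<theta>0 \<in> DA1" "A1 (\<iota> \<theta>0) \<in> range (blinfun_apply \<iota>)"
    and \<phi>0_dom: "\<iota> \<phi>0 \<in> DB1 \<inter> DA2"
    and v0_dom: "\<iota> v0 \<in> DB1"

section \<open>Problem (P)\<close>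

text \<open>
  As d\<phi>/dt lies in \<open>L\<^sup>\<infinity>(0,T;V)\<close>, it is a V-valued function \<open>\<phi>'\<close>; its initial value and its
  derivative \<open>\<phi>''\<close> are those of the H-valued function \<open>\<iota> \<circ> \<phi>'\<close>.
\<close>

definition solution_P ::
  "real \<Rightarrow> real \<Rightarrow>
   ('v::{real_inner, banach, second_countable_topology}
     \<Rightarrow>\<^sub>L 'h::{real_inner, banach, second_countable_topology}) \<Rightarrow>
   ('h \<Rightarrow> 'h) \<Rightarrow> 'h set \<Rightarrow> ('h \<Rightarrow> 'h) \<Rightarrow> 'h set \<Rightarrow> ('h \<Rightarrow> 'h) \<Rightarrow> 'h set \<Rightarrow> ('h \<Rightarrow> 'h) \<Rightarrow>
   ('h \<Rightarrow> 'h) \<Rightarrow> ('h \<Rightarrow> 'h) \<Rightarrow> ('h \<Rightarrow> 'h) \<Rightarrow> 'v \<Rightarrow> 'v \<Rightarrow> 'v \<Rightarrow>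
   (real \<Rightarrow> 'v) \<Rightarrow> (real \<Rightarrow> 'v) \<Rightarrow> bool" where
  "solution_P T \<eta> \<iota> L DA1 A1 DA2 A2 DB1 B1 B2 \<Phi> Lip \<theta>0 \<phi>0 v0 \<theta> \<phi> \<longleftrightarrow>
     H1_space T \<theta> \<and> Linf_space T \<theta> \<and> Linf_dom T DA1 A1 (\<lambda>t. \<iota> (\<theta> t)) \<and>
     W2inf_space T (\<lambda>t. \<iota> (\<phi> t)) \<and> W1inf_space T \<phi> \<and> L2_dom T DA2 A2 (\<lambda>t. \<iota> (\<phi> t)) \<and>
     Linf_space T (\<lambda>t. \<Phi> (\<iota> (\<phi> t))) \<and>
     (\<exists>\<theta>' \<phi>' \<phi>''. has_time_deriv T \<theta> \<theta>' \<and> has_time_deriv T \<phi> \<phi>' \<and>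
        has_time_deriv T (\<lambda>t. \<iota> (\<phi>' t)) \<phi>'' \<and>
        L2_dom T DB1 B1 (\<lambda>t. \<iota> (\<phi>' t)) \<and>
        (AE t in time_measure T. \<iota> (\<theta>' t) + \<eta> *\<^sub>R \<iota> (\<phi>' t) + A1 (\<iota> (\<theta> t)) = 0) \<and>
        (AE t in time_measure T.
           L (\<phi>'' t) + B1 (\<iota> (\<phi>' t)) + A2 (\<iota> (\<phi> t)) + \<Phi> (\<iota> (\<phi> t)) + Lip (\<iota> (\<phi> t))
             = B2 (\<iota> (\<theta> t))) \<and>
        has_initial_value T (\<lambda>t. \<iota> (\<theta> t)) (\<iota> \<theta>0) \<and>
        has_initial_value T (\<lambda>t. \<iota> (\<phi> t)) (\<iota> \<phi>0) \<and>
        has_initial_value T (\<lambda>t. \<iota> (\<phi>' t)) (\<iota> v0))"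

section \<open>The discrete problem and its interpolants\<close>

definition diff_quot :: "real \<Rightarrow> (nat \<Rightarrow> 'a::real_vector) \<Rightarrow> nat \<Rightarrow> 'a" where
  "diff_quot h x n = (1 / h) *\<^sub>R (x (Suc n) - x n)"

text \<open>
  The sequences take values in V, which contains D(A1) and D(A2); only their terms with index at
  most \<open>N\<close> are relevant.
\<close>

definition discrete_solution ::
  "real \<Rightarrow> ('v::real_inner \<Rightarrow>\<^sub>L 'h::real_inner) \<Rightarrow>
   ('h \<Rightarrow> 'h) \<Rightarrow> 'h set \<Rightarrow> ('h \<Rightarrow> 'h) \<Rightarrow> 'h set \<Rightarrow> ('h \<Rightarrow> 'h) \<Rightarrow> 'h set \<Rightarrow> ('h \<Rightarrow> 'h) \<Rightarrow>
   ('h \<Rightarrow> 'h) \<Rightarrow> ('h \<Rightarrow> 'h) \<Rightarrow> ('h \<Rightarrow> 'h) \<Rightarrow> 'v \<Rightarrow> 'v \<Rightarrow> 'v \<Rightarrow> real \<Rightarrow> nat \<Rightarrow>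
   (nat \<Rightarrow> 'v) \<Rightarrow> (nat \<Rightarrow> 'v) \<Rightarrow> (nat \<Rightarrow> 'v) \<Rightarrow> (nat \<Rightarrow> 'v) \<Rightarrow> bool" where
  "discrete_solution \<eta> \<iota> L DA1 A1 DA2 A2 DB1 B1 B2 \<Phi> Lip \<theta>0 \<phi>0 v0 h N \<theta> \<phi> v z \<longleftrightarrow>
     \<theta> 0 = \<theta>0 \<and> \<phi> 0 = \<phi>0 \<and> v 0 = v0 \<and> z 0 = z 1 \<and>
     (\<forall>n<N. \<iota> (\<theta> (Suc n)) \<in> DA1 \<and> \<iota> (\<phi> (Suc n)) \<in> DB1 \<inter> DA2 \<and>
        \<iota> (diff_quot h \<theta> n) + \<eta> *\<^sub>R \<iota> (diff_quot h \<phi> n) + A1 (\<iota> (\<theta> (Suc n))) = 0 \<and>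
        L (\<iota> (z (Suc n))) + B1 (\<iota> (v (Suc n))) + A2 (\<iota> (\<phi> (Suc n)))
          + \<Phi> (\<iota> (\<phi> (Suc n))) + Lip (\<iota> (\<phi> (Suc n))) = B2 (\<iota> (\<theta> (Suc n))) \<and>
        z (Suc n) = diff_quot h v n \<and> v (Suc n) = diff_quot h \<phi> n)"

text \<open>
  For t in (nh, (n+1)h) the index \<open>nat \<lfloor>t / h\<rfloor>\<close> is n. The hatted interpolant is continuous and
  piecewise linear with value \<open>x n\<close> at t = nh, the barred one is piecewise constant.
\<close>

definition hat_interp :: "real \<Rightarrow> (nat \<Rightarrow> 'a::real_vector) \<Rightarrow> real \<Rightarrow> 'a" where
  "hat_interp h x t = (let n = nat \<lfloor>t / h\<rfloor> in x n + (t - real n * h) *\<^sub>R diff_quot h x n)"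

definition bar_interp :: "real \<Rightarrow> (nat \<Rightarrow> 'a) \<Rightarrow> real \<Rightarrow> 'a" where
  "bar_interp h x t = x (Suc (nat \<lfloor>t / h\<rfloor>))"

end

(* The barred interpolants are the hatted ones plus tau times the piecewise constant derivative,
   where 0 <= tau <= h. Test the difference of the discrete and the continuous equations with the
   errors of the barred interpolants, and write the energy terms with the hatted ones. The defect is
   tau times terms (discrete derivative, discrete minus continuous derivative), which are at least
   m |discrete derivative|^2 - C |continuous derivative|^2 up to lower order terms. The positive part
   absorbs all contributions of order tau^2 |discrete derivative|^2 for small h, and the negative part
   costs O(h) by the regularity of the continuous solution alone. The squared energy norm of the
   error is therefore O(h) by Gronwall's lemma. The only a priori bound needed for the discrete
   solution is that of phi in V, which makes the nonlinearity Lipschitz; it comes from a discrete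
   energy inequality that uses the potential of Phi. *)

theory Submission
  imports Defs
begin

section \<open>Integrals over bounded time intervals\<close>

text \<open>The derivative of the hatted error of \<open>\<phi>\<close> is the barred velocity
  error. Testing the second equation with the latter therefore produces the exact time derivative of
  the \<open>A2s\<close> part of the energy. The first equation is tested twice: with the barred
  error of \<open>\<theta>\<close>, which gives its V norm, and with \<open>B2\<close> of that error
  divided by \<eta>. The second test cancels the coupling term of the second equation and leaves the
  product of \<open>B2\<close> and \<open>A1\<close>, the last integral of the estimate. As
  \<open>A1s\<close> and \<open>A2s\<close> are coercive only up to the H norm, squares of H norms
  join the energy. Time derivatives are merely integrable, and v has one only in H, so energies are
  not differentiated pointwise: they are bounded symmetric bilinear forms of primitives, and the
  product rule is used in integrated form. Hatted errors start at zero, so no initial term appears.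
  The defect contains squares of \<open>\<phi>''\<close> in H and of v and \<open>\<theta>'\<close>
  in V, all integrable for a solution of (P).\<close>

lemma time_sets [simp]: "{0<..<t} \<inter> space lebesgue \<in> sets (lebesgue :: real measure)"
  by simp

lemma finite_time_measure: "finite_measure (time_measure T)"
proof -
  have "{0<..<T} \<in> lmeasurable" by simp
  then show ?thesis by (rule finite_measure_lebesgue_on)
qed

lemma borel_imp_time_measurable:
  "f \<in> borel_measurable borel \<Longrightarrow> f \<in> borel_measurable (time_measure T)"
  by (intro measurable_restrict_space1 measurable_completion) simp

lemma time_measurable_id: "(\<lambda>t. t) \<in> borel_measurable (time_measure T)"
  by (rule borel_imp_time_measurable) simp

lemma AE_time_measure_iff: "(AE t in time_measure T. P t) \<longleftrightarrow> (AE t in lebesgue. t \<in> {0<..<T} \<longrightarrow> P t)"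
  by (subst AE_restrict_space_iff) auto

lemma AE_time_measure_in: "AE t in time_measure T. t \<in> {0<..<T}"
  by (simp add: AE_time_measure_iff)

section \<open>Restriction to shorter time intervals, and primitives\<close>

lemma AE_time_measure_mono:
  assumes "AE t in time_measure T. P t" "s \<le> T"
  shows "AE t in time_measure s. P t"
  using assms(1) unfolding AE_time_measure_iff
  by eventually_elim (use assms(2) in auto)

text \<open>Moves the upper limit of integration into the integrand. All primitives then live on one
  measure space, where dominated convergence and Fubini apply; the half-lines \<open>{..<t}\<close>
  also generate the Borel sets.\<close>

lemma
  fixes g :: "real \<Rightarrow> 'a::{banach, second_countable_topology}"
  assumes "t \<le> T"
  shows time_integral_indicator:
      "(LINT s|time_measure t. g s) = (LINT s|time_measure T. indicator {..<t} s *\<^sub>R g s)"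
    and time_integrable_indicator:
      "integrable (time_measure t) g \<longleftrightarrow> integrable (time_measure T) (\<lambda>s. indicator {..<t} s *\<^sub>R g s)"
proof -
  have *: "(\<lambda>s. indicator {0<..<t} s *\<^sub>R g s) = (\<lambda>s. indicator {0<..<T} s *\<^sub>R indicator {..<t} s *\<^sub>R g s)"
    using assms by (auto simp: fun_eq_iff indicator_def)
  show "(LINT s|time_measure t. g s) = (LINT s|time_measure T. indicator {..<t} s *\<^sub>R g s)"
    by (simp add: integral_restrict_space *)
  show "integrable (time_measure t) g \<longleftrightarrow> integrable (time_measure T) (\<lambda>s. indicator {..<t} s *\<^sub>R g s)"
    by (simp add: integrable_restrict_space *)
qed

lemma integrable_indicator_scaleR:
  fixes g :: "real \<Rightarrow> 'a::{banach, second_countable_topology}"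
  assumes "integrable (time_measure T) g" "A \<in> sets borel"
  shows "integrable (time_measure T) (\<lambda>s. indicator A s *\<^sub>R g s)"
proof -
  have "A \<inter> {0<..<T} \<in> sets (time_measure T)"
    using assms(2) by (auto simp: sets_restrict_space)
  then have "integrable (time_measure T) (\<lambda>s. indicator (A \<inter> {0<..<T}) s *\<^sub>R g s)"
    using assms(1) by (rule integrable_mult_indicator)
  then show ?thesis
    by (rule Bochner_Integration.integrable_cong[THEN iffD1, rotated 2]) (auto simp: indicator_def)
qed

lemma time_integrable_mono:
  fixes g :: "real \<Rightarrow> 'a::{banach, second_countable_topology}"
  assumes "integrable (time_measure T) g" "t \<le> T"
  shows "integrable (time_measure t) g"
  using assms by (simp add: time_integrable_indicator[of t T] integrable_indicator_scaleR)

lemma primitive_continuous: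
  fixes g :: "real \<Rightarrow> 'a::{banach, second_countable_topology}"
  assumes g: "integrable (time_measure T) g"
  shows "continuous_on {0..T} (\<lambda>t. LINT s|time_measure t. g s)"
proof (rule continuous_on_sequentiallyI)
  fix u :: "nat \<Rightarrow> real" and a
  assume u: "\<forall>n. u n \<in> {0..T}" and a: "a \<in> {0..T}" and lim: "u \<longlonglongrightarrow> a"
  \<comment> \<open>At \<open>s = a\<close> the indicators of \<open>{..<u n}\<close> need not
    converge, so this single point is removed.\<close>
  have ne: "AE s in time_measure T. s \<noteq> a"
  proof -
    have "AE s in lebesgue. s \<noteq> a"
      by (rule AE_completion) (rule AE_lborel_singleton)
    then show ?thesis unfolding AE_time_measure_iff by eventually_elim simp
  qed
  have "(\<lambda>n. LINT s|time_measure T. indicator {..<u n} s *\<^sub>R g s) \<longlonglongrightarrow>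
      (LINT s|time_measure T. indicator {..<a} s *\<^sub>R g s)"
  proof (rule integral_dominated_convergence[where w = "\<lambda>s. norm (g s)"])
    show "AE s in time_measure T. (\<lambda>n. indicator {..<u n} s *\<^sub>R g s) \<longlonglongrightarrow> indicator {..<a} s *\<^sub>R g s"
      using ne
    proof eventually_elim
      case (elim s)
      have "\<forall>\<^sub>F n in sequentially. indicator {..<u n} s *\<^sub>R g s = indicator {..<a} s *\<^sub>R g s"
      proof (cases "s < a")
        case True
        then have "\<forall>\<^sub>F n in sequentially. s < u n" using lim by (simp add: order_tendsto_iff)
        then show ?thesis by eventually_elim (use True in simp)
      next
        case False
        then have "a < s" using elim by simp
        then have "\<forall>\<^sub>F n in sequentially. u n < s" using lim by (simp add: order_tendsto_iff)
        then show ?thesis by eventually_elim (use \<open>a < s\<close> in simp)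
      qed
      then show ?case by (rule tendsto_eventually)
    qed
    show "AE s in time_measure T. norm (indicator {..<u n} s *\<^sub>R g s) \<le> norm (g s)" for n
      by (auto simp: indicator_def)
  qed (use g in \<open>auto intro!: borel_measurable_integrable integrable_indicator_scaleR simp del: indicator_simps\<close>)
  moreover have "(LINT s|time_measure (u n). g s) = (LINT s|time_measure T. indicator {..<u n} s *\<^sub>R g s)" for n
    using u by (intro time_integral_indicator) simp
  moreover have "(LINT s|time_measure a. g s) = (LINT s|time_measure T. indicator {..<a} s *\<^sub>R g s)"
    using a by (intro time_integral_indicator) simp
  ultimately show "(\<lambda>n. LINT s|time_measure (u n). g s) \<longlonglongrightarrow> (LINT s|time_measure a. g s)"
    by simp
qed

lemma time_integral_0: "(LINT s|time_measure 0. (g s :: 'a::{banach, second_countable_topology})) = 0"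
  by (simp add: integral_restrict_space)

text \<open>The points of the open interval where the functions differ form an open null set, hence
  none; the two end points follow by continuity. This makes values at time 0 meaningful for
  functions known almost everywhere.\<close>

lemma continuous_AE_eq:
  fixes u w :: "real \<Rightarrow> 'a::real_normed_vector"
  assumes T: "0 < T" and u: "continuous_on {0..T} u" and w: "continuous_on {0..T} w"
    and ae: "AE t in time_measure T. u t = w t" and t: "t \<in> {0..T}"
  shows "u t = w t"
proof -
  define f where "f t = norm (u t - w t)" for t
  have f: "continuous_on {0..T} f"
    unfolding f_def by (intro continuous_intros u w)
  let ?S = "{t \<in> {0<..<T}. f t \<noteq> 0}"
  have "open ?S"
  proof -
    have "continuous_on {0<..<T} f" using f by (rule continuous_on_subset) auto
    then have "open ({0<..<T} \<inter> f -` (- {0}))"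
      by (rule continuous_open_preimage) auto
    also have "{0<..<T} \<inter> f -` (- {0}) = ?S" by auto
    finally show ?thesis .
  qed
  moreover have "negligible ?S"
  proof -
    have "AE t in lebesgue. t \<notin> ?S"
      using ae unfolding AE_time_measure_iff by eventually_elim (simp add: f_def)
    then have "?S \<in> null_sets lebesgue"
      by (subst completion.null_sets_iff_AE) simp
    then show ?thesis by (simp add: negligible_iff_null_sets)
  qed
  ultimately have "?S = {}" using open_not_negligible by blast
  then have "f s = 0" if "s \<in> {0<..<T}" for s using that by auto
  moreover have "closure {0<..<T} = {0..T}" using T by simp
  ultimately have "f t = 0"
    using continuous_constant_on_closure[of "{0<..<T}" f 0 t] f t by simp
  then show ?thesis by (simp add: f_def)
qed

text \<open>A Dynkin argument: the integral over half-lines vanishes by hypothesis, half-lines are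
  stable under intersection and generate the Borel sets, so the integral over every measurable set
  vanishes.\<close>

lemma primitive_zero_imp_AE_zero:
  fixes g :: "real \<Rightarrow> 'a::{banach, second_countable_topology}"
  assumes g: "integrable (time_measure T) g" and T: "0 \<le> T"
    and zero: "\<And>t. t \<in> {0..T} \<Longrightarrow> (LINT s|time_measure t. g s) = 0"
  shows "AE t in time_measure T. g t = 0"
proof (rule sigma_finite_measure.density_zero[OF _ g])
  show "sigma_finite_measure (time_measure T)"
    using finite_time_measure by (rule finite_measure.axioms)
next
  have total: "(LINT s|time_measure T. g s) = 0" using zero T by simp
  have sb: "sets borel = sigma_sets UNIV (range (lessThan :: real \<Rightarrow> real set))"
    by (subst borel_Iio) (simp add: sets_measure_of)
  have borel: "(LINT s|time_measure T. indicator A s *\<^sub>R g s) = 0" if A: "A \<in> sets borel" for A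
  proof -
    have "Int_stable (range (lessThan :: real \<Rightarrow> real set))"
    proof (rule Int_stableI)
      fix a b :: "real set" assume "a \<in> range lessThan" "b \<in> range lessThan"
      then obtain x y where "a = {..<x}" "b = {..<y}" by auto
      then show "a \<inter> b \<in> range lessThan" by (intro image_eqI[where x = "min x y"]) auto
    qed
    moreover have "range lessThan \<subseteq> Pow (UNIV :: real set)" by simp
    moreover have "A \<in> sigma_sets UNIV (range lessThan)"
      using A sb by simp
    ultimately show ?thesis
    proof (induction rule: sigma_sets_induct_disjoint)
      case (basic A)
      then obtain t where A: "A = {..<t}" by auto
      show ?case
      proof (cases "0 \<le> t \<and> t \<le> T")
        case True
        then show ?thesis using zero[of t] by (simp add: A time_integral_indicator[of t T])
      next
        case False
        \<comment> \<open>A half-line ending outside \<open>{0..T}\<close> contains all of the time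
          interval or none of it.\<close>
        then have "(\<forall>s\<in>{0<..<T}. indicat_real A s = 1) \<or> (\<forall>s\<in>{0<..<T}. indicat_real A s = 0)"
          by (auto simp: A indicator_def)
        then show ?thesis
        proof
          assume "\<forall>s\<in>{0<..<T}. indicat_real A s = 1"
          then have "(LINT s|time_measure T. indicator A s *\<^sub>R g s) = (LINT s|time_measure T. g s)"
            by (intro Bochner_Integration.integral_cong) auto
          then show ?thesis using total by simp
        next
          assume "\<forall>s\<in>{0<..<T}. indicat_real A s = 0"
          then have "(LINT s|time_measure T. indicator A s *\<^sub>R g s) = (LINT s|time_measure T. 0)"
            by (intro Bochner_Integration.integral_cong) auto
          then show ?thesis by simp
        qed
      qed
    next
      case empty
      then show ?case by simp
    next
      case (compl A)
      then have "A \<in> sets borel"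
        using sb by simp
      have "(LINT s|time_measure T. indicator (UNIV - A) s *\<^sub>R g s) =
          (LINT s|time_measure T. g s - indicator A s *\<^sub>R g s)"
        by (intro Bochner_Integration.integral_cong) (auto simp: indicator_def)
      also have "\<dots> = 0"
        using g compl total integrable_indicator_scaleR[OF g \<open>A \<in> sets borel\<close>] by simp
      finally show ?case .
    next
      case (union A)
      then have A: "A i \<in> sets borel" for i
        using sb by (auto simp: image_subset_iff)
      define B where "B i = A i \<inter> {0<..<T}" for i
      have B: "B i \<in> sets (time_measure T)" for i
        using A[of i] by (auto simp: B_def sets_restrict_space)
      have disj: "B i \<inter> B j = {}" if "i \<noteq> j" for i j
        using union(1) that by (auto simp: B_def disjoint_family_on_def)
      have "set_integrable (time_measure T) (\<Union>i. B i) g"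
        unfolding set_integrable_def using B g by (intro integrable_mult_indicator) auto
      from lebesgue_integral_countable_add[OF B disj this]
      have "(LINT s|time_measure T. indicator (\<Union>i. B i) s *\<^sub>R g s) =
          (\<Sum>i. (LINT s|time_measure T. indicator (B i) s *\<^sub>R g s))"
        by (simp add: set_lebesgue_integral_def)
      moreover have "(LINT s|time_measure T. indicator (B i) s *\<^sub>R g s) =
          (LINT s|time_measure T. indicator (A i) s *\<^sub>R g s)" for i
        by (intro Bochner_Integration.integral_cong) (auto simp: B_def indicator_def)
      moreover have "(LINT s|time_measure T. indicator (\<Union>i. B i) s *\<^sub>R g s) =
          (LINT s|time_measure T. indicator (\<Union>i. A i) s *\<^sub>R g s)"
        by (intro Bochner_Integration.integral_cong) (auto simp: B_def indicator_def)
      ultimately show ?case using union(3) by simp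
    qed
  qed
  \<comment> \<open>A Lebesgue set differs from a Borel set by a subset of a null set, which does
    not change the integral.\<close>
  fix A assume "A \<in> sets (time_measure T)"
  then have "A \<in> sets lebesgue"
    by (auto simp: sets_restrict_space)
  then obtain S N N' where S: "A = S \<union> N" "N \<subseteq> N'" "N' \<in> null_sets lborel" "S \<in> sets lborel"
    by (rule sets_completionE)
  have "AE s in lborel. s \<notin> N'" using S(3) by (rule AE_not_in)
  then have "AE s in lebesgue. s \<notin> N'" by (rule AE_completion)
  then have "AE s in time_measure T. indicat_real A s *\<^sub>R g s = indicat_real S s *\<^sub>R g s"
    unfolding AE_time_measure_iff by eventually_elim (use S in \<open>auto simp: indicator_def\<close>)
  moreover have "(\<lambda>s. indicator A s *\<^sub>R g s) \<in> borel_measurable (time_measure T)"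
    using \<open>A \<in> sets (time_measure T)\<close> g by measurable
  moreover have "(\<lambda>s. indicator S s *\<^sub>R g s) \<in> borel_measurable (time_measure T)"
    using integrable_indicator_scaleR[OF g, of S] S(4) by (auto intro: borel_measurable_integrable)
  ultimately have "(LINT s|time_measure T. indicator A s *\<^sub>R g s) = (LINT s|time_measure T. indicator S s *\<^sub>R g s)"
    by (intro integral_cong_AE)
  then show "set_lebesgue_integral (time_measure T) A g = 0"
    using borel[of S] S(4) by (simp add: set_lebesgue_integral_def)
qed

section \<open>Integrals over subintervals, uniqueness of the time derivative\<close>

lemma time_integral_diff:
  fixes g :: "real \<Rightarrow> 'a::{banach, second_countable_topology}"
  assumes g: "integrable (time_measure T) g" and "s \<le> t" "t \<le> T"
  shows "(LINT r|time_measure t. g r) - (LINT r|time_measure s. g r) =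
    (LINT r|time_measure T. indicator {s..<t} r *\<^sub>R g r)"
proof -
  have "(LINT r|time_measure T. indicator {..<t} r *\<^sub>R g r) - (LINT r|time_measure T. indicator {..<s} r *\<^sub>R g r)
      = (LINT r|time_measure T. indicator {..<t} r *\<^sub>R g r - indicator {..<s} r *\<^sub>R g r)"
    by (intro Bochner_Integration.integral_diff[symmetric] integrable_indicator_scaleR g) auto
  also have "\<dots> = (LINT r|time_measure T. indicator {s..<t} r *\<^sub>R g r)"
  proof (rule Bochner_Integration.integral_cong[OF refl])
    fix r show "indicator {..<t} r *\<^sub>R g r - indicator {..<s} r *\<^sub>R g r = indicator {s..<t} r *\<^sub>R g r"
      using \<open>s \<le> t\<close> by (cases "r < s"; cases "r < t") auto
  qed
  finally show ?thesis
    using time_integral_indicator[of t T g] time_integral_indicator[of s T g] assms by simp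
qed

lemma time_integral_const:
  fixes c :: "'a::{banach, second_countable_topology}"
  assumes "0 \<le> s" "s \<le> t" "t \<le> T"
  shows "(LINT r|time_measure T. indicator {s..<t} r *\<^sub>R c) = (t - s) *\<^sub>R c"
proof -
  have "(LINT r|time_measure T. indicator {s..<t} r *\<^sub>R c) =
      (LINT r|lebesgue. indicator {0<..<T} r *\<^sub>R indicator {s..<t} r *\<^sub>R c)"
    by (simp add: integral_restrict_space)
  also have "\<dots> = (LINT r|lebesgue. indicator ({0<..<T} \<inter> {s..<t}) r *\<^sub>R c)"
    by (intro Bochner_Integration.integral_cong) (auto simp: indicator_def)
  also have "\<dots> = measure lebesgue ({0<..<T} \<inter> {s..<t}) *\<^sub>R c"
  proof -
    have "{0<..<T} \<inter> {s..<t} \<in> lmeasurable"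
      by (rule fmeasurable_Int_fmeasurable) auto
    then show ?thesis by (simp add: fmeasurable_def)
  qed
  also have "measure lebesgue ({0<..<T} \<inter> {s..<t}) = t - s"
  proof (cases "s = 0")
    case True
    then have "{0<..<T} \<inter> {s..<t} = {s<..<t}" using assms by auto
    then show ?thesis using assms by simp
  next
    case False
    then have "{0<..<T} \<inter> {s..<t} = {s..<t}" using assms by auto
    then show ?thesis using assms by simp
  qed
  finally show ?thesis .
qed

text \<open>Two primitives of the same function are continuous, so they agree everywhere. Time 0
  identifies the constants, and the difference of the derivatives then has the zero primitive. This
  identifies the separate existential witnesses in the definitions of the Sobolev spaces.\<close>

lemma has_time_deriv_unique:
  fixes u g1 g2 :: "real \<Rightarrow> 'a::{banach, second_countable_topology}"
  assumes T: "0 < T" and 1: "has_time_deriv T u g1" and 2: "has_time_deriv T u g2"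
  shows "AE t in time_measure T. g1 t = g2 t"
proof -
  obtain c d where g: "integrable (time_measure T) g1" "integrable (time_measure T) g2"
    and c: "AE t in time_measure T. u t = c + (LINT s|time_measure t. g1 s)"
    and d: "AE t in time_measure T. u t = d + (LINT s|time_measure t. g2 s)"
    using 1 2 by (auto simp: has_time_deriv_def)
  have eq: "c + (LINT s|time_measure t. g1 s) = d + (LINT s|time_measure t. g2 s)" if "t \<in> {0..T}" for t
  proof (rule continuous_AE_eq[OF T _ _ _ that])
    show "continuous_on {0..T} (\<lambda>t. c + (LINT s|time_measure t. g1 s))"
      "continuous_on {0..T} (\<lambda>t. d + (LINT s|time_measure t. g2 s))"
      by (intro continuous_intros primitive_continuous g)+
    show "AE t in time_measure T. c + (LINT s|time_measure t. g1 s) = d + (LINT s|time_measure t. g2 s)"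
      using c d by eventually_elim simp
  qed
  have "c = d" using eq[of 0] T by (simp add: time_integral_0)
  have "AE t in time_measure T. g1 t - g2 t = 0"
  proof (rule primitive_zero_imp_AE_zero)
    show "integrable (time_measure T) (\<lambda>t. g1 t - g2 t)" using g by simp
    fix t assume "t \<in> {0..T}"
    then show "(LINT s|time_measure t. g1 s - g2 s) = 0"
      using eq[of t] \<open>c = d\<close> time_integrable_mono[OF g(1), of t] time_integrable_mono[OF g(2), of t] by simp
  qed (use T in simp)
  then show ?thesis by eventually_elim simp
qed

section \<open>The energy identity for symmetric bilinear forms\<close>

lemma form_bound:
  fixes a :: "'a::real_normed_vector \<Rightarrow>\<^sub>L 'a \<Rightarrow>\<^sub>L real"
  shows "\<bar>a x y\<bar> \<le> norm a * norm x * norm y"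
proof -
  have "\<bar>a x y\<bar> \<le> norm (a x) * norm y" using norm_blinfun[of "a x" y] by simp
  also have "\<dots> \<le> norm a * norm x * norm y" by (intro mult_right_mono norm_blinfun) simp
  finally show ?thesis .
qed

text \<open>
  Twice the integral of \<open>a (g r) (g s)\<close> over \<open>r < s\<close> is, by symmetry, the integral over the whole
  square, as the diagonal is a null set.
\<close>

lemma
  fixes a :: "'a::{banach, second_countable_topology} \<Rightarrow>\<^sub>L 'a \<Rightarrow>\<^sub>L real"
  assumes sym: "\<And>x y. a x y = a y x" and g: "integrable (time_measure T) g"
  shows primitive_form_integrable:
      "integrable (time_measure T) (\<lambda>s. a (LINT r|time_measure s. g r) (g s))"
    and primitive_form_integral:
      "2 * (LINT s|time_measure T. a (LINT r|time_measure s. g r) (g s)) =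
        a (LINT r|time_measure T. g r) (LINT r|time_measure T. g r)"
proof -
  let ?M = "time_measure T"
  let ?G = "\<lambda>s. LINT r|time_measure s. g r"
  interpret finite_measure ?M by (rule finite_time_measure)
  interpret pair_sigma_finite ?M ?M ..
  have [measurable]: "g \<in> borel_measurable ?M" using g by simp
  have [measurable]: "(\<lambda>t. t) \<in> borel_measurable ?M" by (rule time_measurable_id)
  have [measurable]: "(\<lambda>p. fst p) \<in> borel_measurable (?M \<Otimes>\<^sub>M ?M)" "(\<lambda>p. snd p) \<in> borel_measurable (?M \<Otimes>\<^sub>M ?M)"
    using measurable_compose[OF measurable_fst time_measurable_id]
      measurable_compose[OF measurable_snd time_measurable_id] by simp_all
  have lin1: "bounded_linear (\<lambda>x. a x y)" for y
    by (rule bounded_linear_compose[OF blinfun.bounded_linear_left blinfun.bounded_linear_right])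
  have lin2: "bounded_linear (\<lambda>y. a x y)" for x
    by (rule blinfun.bounded_linear_right)
  define f where "f = (\<lambda>p. a (g (fst p)) (g (snd p)))"
  have [measurable]: "f \<in> borel_measurable (?M \<Otimes>\<^sub>M ?M)"
    unfolding f_def
    by (rule borel_measurable_continuous_Pair[where H = "\<lambda>x y. a x y"])
      (measurable, intro continuous_intros)
  \<comment> \<open>The bound of \<open>f\<close> by a product of functions of one variable makes it
    absolutely integrable on the square, although \<open>g\<close> is only integrable and not square
    integrable.\<close>
  have F: "integrable (?M \<Otimes>\<^sub>M ?M) f"
  proof (rule Fubini_integrable)
    show "AE x in ?M. integrable ?M (\<lambda>y. f (x, y))"
      unfolding f_def using integrable_bounded_linear[OF lin2 g] by simp
    show "integrable ?M (\<lambda>x. LINT y|?M. norm (f (x, y)))"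
    proof (rule Bochner_Integration.integrable_bound)
      show "integrable ?M (\<lambda>x. norm a * norm (g x) * (LINT y|?M. norm (g y)))"
        using g by simp
      show "AE x in ?M. norm (LINT y|?M. norm (f (x, y))) \<le> norm (norm a * norm (g x) * (LINT y|?M. norm (g y)))"
      proof (rule AE_I2)
        fix x
        have "(LINT y|?M. norm (f (x, y))) \<le> (LINT y|?M. norm a * norm (g x) * norm (g y))"
          using form_bound[of a] g integrable_bounded_linear[OF lin2 g]
          by (intro integral_mono) (auto simp: f_def)
        moreover have "0 \<le> (LINT y|?M. norm (f (x, y)))" by simp
        ultimately show "norm (LINT y|?M. norm (f (x, y))) \<le> norm (norm a * norm (g x) * (LINT y|?M. norm (g y)))"
          by simp
      qed
    qed measurable
  qed measurable
  \<comment> \<open>The part of \<open>f\<close> below the diagonal. Its inner integral is the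
    primitive of \<open>g\<close>, and its reflection is the part above the diagonal.\<close>
  define f1 where "f1 = (\<lambda>p. indicator {p. snd p < fst p} p *\<^sub>R f p)"
  have f1m [measurable]: "f1 \<in> borel_measurable (?M \<Otimes>\<^sub>M ?M)"
    unfolding f1_def by measurable
  have F1: "integrable (?M \<Otimes>\<^sub>M ?M) f1"
    by (rule Bochner_Integration.integrable_bound[OF F f1m]) (auto simp: f1_def indicator_def)
  have swap_eq: "f1 (y, x) = indicator {p. fst p < snd p} (x, y) *\<^sub>R f (x, y)" for x y
    by (auto simp: f1_def f_def indicator_def sym)
  have F2: "integrable (?M \<Otimes>\<^sub>M ?M) (\<lambda>(x, y). f1 (y, x))"
    using integrable_product_swap[OF F1] .
  have inner: "(LINT y|?M. f1 (x, y)) = a (?G x) (g x)" if "x \<in> {0<..<T}" for x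
  proof -
    have "(LINT y|?M. f1 (x, y)) = (LINT y|?M. a (indicator {..<x} y *\<^sub>R g y) (g x))"
      by (intro Bochner_Integration.integral_cong)
        (auto simp: f1_def f_def indicator_def sym)
    also have "\<dots> = a (LINT y|?M. indicator {..<x} y *\<^sub>R g y) (g x)"
      using g by (intro integral_bounded_linear[OF lin1] integrable_indicator_scaleR) auto
    also have "\<dots> = a (?G x) (g x)"
      using that by (simp add: time_integral_indicator[of x T])
    finally show ?thesis .
  qed
  show "integrable ?M (\<lambda>s. a (?G s) (g s))"
    by (rule Bochner_Integration.integrable_cong[THEN iffD1, OF refl _ integrable_fst'[OF F1]])
      (simp add: inner)
  have A: "(LINT s|?M. a (?G s) (g s)) = integral\<^sup>L (?M \<Otimes>\<^sub>M ?M) f1"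
    unfolding integral_fst'[OF F1, symmetric]
    by (intro Bochner_Integration.integral_cong) (auto simp: inner)
  have "2 * (LINT s|?M. a (?G s) (g s)) =
      integral\<^sup>L (?M \<Otimes>\<^sub>M ?M) f1 + (\<integral>(x,y). f1 (y, x) \<partial>(?M \<Otimes>\<^sub>M ?M))"
    using A integral_product_swap[OF f1m] by simp
  also have "\<dots> = (\<integral>p. f1 p + (case p of (x, y) \<Rightarrow> f1 (y, x)) \<partial>(?M \<Otimes>\<^sub>M ?M))"
    using F1 F2 by simp
  also have "\<dots> = (LINT x|?M. LINT y|?M. f1 (x, y) + f1 (y, x))"
    using integral_fst'[of "\<lambda>p. f1 p + (case p of (x, y) \<Rightarrow> f1 (y, x))"] F1 F2 by simp
  also have "\<dots> = (LINT x|?M. LINT y|?M. f (x, y))"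
  proof (rule Bochner_Integration.integral_cong[OF refl], rule integral_cong_AE)
    fix x assume x: "x \<in> space ?M"
    have 1: "(\<lambda>y. f1 (x, y)) \<in> borel_measurable ?M" "(\<lambda>y. f (x, y)) \<in> borel_measurable ?M"
      using x by (auto intro: measurable_Pair2)
    moreover have 2: "(\<lambda>y. f1 (y, x)) \<in> borel_measurable ?M"
      using x by (rule measurable_Pair1[OF f1m])
    ultimately show "(\<lambda>y. f1 (x, y) + f1 (y, x)) \<in> borel_measurable ?M" "(\<lambda>y. f (x, y)) \<in> borel_measurable ?M"
      by auto
    have "AE s in lebesgue. s \<noteq> x"
      by (rule AE_completion) (rule AE_lborel_singleton)
    then have "AE y in ?M. y \<noteq> x"
      unfolding AE_time_measure_iff by eventually_elim simp
    then show "AE y in ?M. f1 (x, y) + f1 (y, x) = f (x, y)"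
      by eventually_elim (auto simp: f1_def f_def sym indicator_def)
  qed
  also have "\<dots> = (LINT x|?M. a (g x) (?G T))"
    unfolding f_def fst_conv snd_conv
    by (intro Bochner_Integration.integral_cong refl integral_bounded_linear[OF lin2] g)
  also have "\<dots> = a (?G T) (?G T)"
    by (intro integral_bounded_linear[OF lin1] g)
  finally show "2 * (LINT s|?M. a (?G s) (g s)) = a (?G T) (?G T)" .
qed

text \<open>The chain rule for \<open>a (u t) (u t)\<close> in integrated form. It needs
  \<open>g\<close> only integrable, as it is the identity on the square applied on each interval
  from 0 to t; \<open>u\<close> starts at 0, so no boundary term remains.\<close>

lemma
  fixes a :: "'a::{banach, second_countable_topology} \<Rightarrow>\<^sub>L 'a \<Rightarrow>\<^sub>L real"
  assumes sym: "\<And>x y. a x y = a y x" and g: "integrable (time_measure T) g"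
    and u: "\<And>t. t \<in> {0..T} \<Longrightarrow> u t = (LINT s|time_measure t. g s)"
  shows energy_integrable: "integrable (time_measure T) (\<lambda>s. a (u s) (g s))"
    and energy_identity: "t \<in> {0..T} \<Longrightarrow> a (u t) (u t) = 2 * (LINT s|time_measure t. a (u s) (g s))"
proof -
  show "integrable (time_measure T) (\<lambda>s. a (u s) (g s))"
    by (rule Bochner_Integration.integrable_cong[THEN iffD1, OF refl _ primitive_form_integrable[OF sym g]])
      (simp add: u)
  assume t: "t \<in> {0..T}"
  then have gt: "integrable (time_measure t) g" by (intro time_integrable_mono[OF g]) simp
  have "(LINT s|time_measure t. a (u s) (g s)) = (LINT s|time_measure t. a (LINT r|time_measure s. g r) (g s))"
    using t by (intro Bochner_Integration.integral_cong) (auto simp: u)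
  then show "a (u t) (u t) = 2 * (LINT s|time_measure t. a (u s) (g s))"
    using t by (simp add: primitive_form_integral[OF sym gt] u)
qed

section \<open>Interpolants as functions of time\<close>

lemma interp_measurable:
  fixes f :: "nat \<Rightarrow> 'a::{banach, second_countable_topology}"
  shows "(\<lambda>t. f (nat \<lfloor>t / h\<rfloor>)) \<in> borel_measurable (time_measure T)"
proof (rule borel_imp_time_measurable)
  have "(\<lambda>t::real. nat \<lfloor>t / h\<rfloor>) \<in> borel \<rightarrow>\<^sub>M count_space UNIV"
    by measurable
  then show "(\<lambda>t. f (nat \<lfloor>t / h\<rfloor>)) \<in> borel_measurable borel"
    by (rule measurable_compose) simp
qed

text \<open>Only finitely many grid cells meet the time interval, so the sum of the norms is a
  bound. It depends on h, which is harmless where only integrability is at stake.\<close>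

lemma interp_bounded:
  fixes f :: "nat \<Rightarrow> 'a::real_normed_vector"
  assumes h: "0 < h"
  obtains B where "0 \<le> B" "\<And>t. t \<in> {0<..<T} \<Longrightarrow> norm (f (nat \<lfloor>t / h\<rfloor>)) \<le> B"
proof
  let ?m = "nat \<lfloor>T / h\<rfloor>"
  show "0 \<le> (\<Sum>k\<le>?m. norm (f k))" by (intro sum_nonneg) simp
  fix t assume t: "t \<in> {0<..<T}"
  then have "t / h \<le> T / h" using h by (simp add: divide_right_mono)
  then have "nat \<lfloor>t / h\<rfloor> \<le> ?m" by (intro nat_mono floor_mono)
  then show "norm (f (nat \<lfloor>t / h\<rfloor>)) \<le> (\<Sum>k\<le>?m. norm (f k))"
    by (intro member_le_sum) auto
qed

lemma interp_integrable:
  fixes f :: "nat \<Rightarrow> 'a::{banach, second_countable_topology}"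
  assumes h: "0 < h"
  shows "integrable (time_measure T) (\<lambda>t. f (nat \<lfloor>t / h\<rfloor>))"
proof -
  obtain B where "\<And>t. t \<in> {0<..<T} \<Longrightarrow> norm (f (nat \<lfloor>t / h\<rfloor>)) \<le> B"
    using interp_bounded[OF h] by metis
  then show ?thesis
    by (intro finite_measure.integrable_const_bound[OF finite_time_measure, where B = B] interp_measurable)
      auto
qed

text \<open>The derivative is constant on each grid cell, so the primitive is affine there, and
  induction over the nodes glues the cells. Hatted errors thereby become primitives, to which the
  energy identity applies.\<close>

lemma hat_interp_primitive:
  fixes x :: "nat \<Rightarrow> 'a::{banach, second_countable_topology}"
  assumes h: "0 < h" and t: "0 \<le> t"
  shows "hat_interp h x t - x 0 = (LINT s|time_measure t. diff_quot h x (nat \<lfloor>s / h\<rfloor>))"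
proof -
  let ?d = "\<lambda>s. diff_quot h x (nat \<lfloor>s / h\<rfloor>)"
  let ?G = "\<lambda>t. LINT s|time_measure t. ?d s"
  \<comment> \<open>The cell is closed at both ends: at the right node the index
    \<open>nat \<lfloor>t / h\<rfloor>\<close> is already \<open>Suc n\<close>, but the integral
    sees only earlier times, and the induction over nodes needs this end point.\<close>
  have step: "?G t = ?G (real n * h) + (t - real n * h) *\<^sub>R diff_quot h x n"
    if "real n * h \<le> t" "t \<le> real (Suc n) * h" for n t
  proof -
    have "?G t - ?G (real n * h) = (LINT r|time_measure t. indicator {real n * h..<t} r *\<^sub>R ?d r)"
      by (rule time_integral_diff) (use that h in \<open>auto intro: interp_integrable\<close>)
    also have "\<dots> = (LINT r|time_measure t. indicator {real n * h..<t} r *\<^sub>R diff_quot h x n)"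
    proof (intro Bochner_Integration.integral_cong refl)
      fix r
      have "nat \<lfloor>r / h\<rfloor> = n" if "r \<in> {real n * h..<t}"
      proof -
        have "real n \<le> r / h" "r / h < real n + 1"
          using that \<open>t \<le> real (Suc n) * h\<close> h by (auto simp: field_simps)
        then have "\<lfloor>r / h\<rfloor> = int n" by (intro floor_unique) auto
        then show ?thesis by simp
      qed
      then show "indicator {real n * h..<t} r *\<^sub>R ?d r = indicator {real n * h..<t} r *\<^sub>R diff_quot h x n"
        by (auto simp: indicator_def)
    qed
    also have "\<dots> = (t - real n * h) *\<^sub>R diff_quot h x n"
      using that h by (intro time_integral_const) auto
    finally show ?thesis by (metis add.commute diff_eq_eq)
  qed
  have node: "?G (real n * h) = x n - x 0" for n
  proof (induction n)
    case 0
    then show ?case by (simp add: time_integral_0)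
  next
    case (Suc n)
    have "?G (real (Suc n) * h) = ?G (real n * h) + (real (Suc n) * h - real n * h) *\<^sub>R diff_quot h x n"
      using h by (intro step) (auto simp: algebra_simps)
    also have "\<dots> = x n - x 0 + (real (Suc n) * h - real n * h) *\<^sub>R diff_quot h x n"
      unfolding Suc ..
    also have "\<dots> = x (Suc n) - x 0"
      using h by (simp add: diff_quot_def algebra_simps)
    finally show ?case .
  qed
  define n where "n = nat \<lfloor>t / h\<rfloor>"
  have "real n \<le> t / h" "t / h \<le> real (Suc n)"
    using t h by (auto simp: n_def) linarith+
  then have "real n * h \<le> t" "t \<le> real (Suc n) * h"
    using h by (auto simp: field_simps)
  from step[OF this] have "?G t = x n - x 0 + (t - real n * h) *\<^sub>R diff_quot h x n"
    unfolding node .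
  then show ?thesis
    unfolding hat_interp_def Let_def n_def[symmetric] by (simp only: diff_add_eq)
qed

section \<open>Gronwall inequalities\<close>

lemma continuous_time_integrable:
  fixes E :: "real \<Rightarrow> real"
  assumes "continuous_on {0..T} E"
  shows "integrable (time_measure T) E"
proof -
  have "integrable (lebesgue_on {0..T}) E"
    using assms by (rule continuous_imp_integrable_real)
  then have "set_integrable lebesgue {0..T} E"
    by (simp add: set_integrable_def integrable_restrict_space)
  then have "set_integrable lebesgue {0<..<T} E"
    by (rule set_integrable_subset) auto
  then show ?thesis
    by (simp add: set_integrable_def integrable_restrict_space)
qed

lemma gronwall:
  fixes E :: "real \<Rightarrow> real"
  assumes E: "continuous_on {0..T} E" and C: "0 \<le> C"
    and le: "\<And>t. t \<in> {0..T} \<Longrightarrow> E t \<le> C * (LINT s|time_measure t. E s) + \<kappa>"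
    and t: "t \<in> {0..T}"
  shows "E t \<le> \<kappa> * exp (C * t)"
proof -
  \<comment> \<open>\<open>Y\<close> is the right-hand side of the hypothesis. It dominates
    \<open>E\<close> and, unlike \<open>E\<close>, is differentiable, and
    \<open>Y t * exp (- C * t)\<close> is nonincreasing.\<close>
  define Y where "Y t = C * integral {0..t} E + \<kappa>" for t
  have int: "(LINT s|time_measure t. E s) = integral {0..t} E" if "t \<in> {0..T}" for t
  proof -
    have "continuous_on {0..t} E" using E that by (auto intro: continuous_on_subset)
    then have "integrable (time_measure t) E" by (rule continuous_time_integrable)
    then have "(LINT s|time_measure t. E s) = integral {0<..<t} E"
      by (rule lebesgue_integral_eq_integral) simp
    then show ?thesis using integral_open_interval_real[of 0 t E] by simp
  qed
  have Y: "E s \<le> Y s" if "s \<in> {0..T}" for s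
    using le[OF that] int[OF that] by (simp add: Y_def)
  have "Y t * exp (- C * t) \<le> Y 0 * exp (- C * 0)"
  proof (rule DERIV_nonpos_imp_decreasing_open[where f = "\<lambda>t. Y t * exp (- C * t)"])
    show "0 \<le> t" using t by simp
    show "continuous_on {0..t} (\<lambda>t. Y t * exp (- C * t))"
      unfolding Y_def using E t
      by (intro continuous_intros indefinite_integral_continuous_1 integrable_continuous_interval)
        (auto intro: continuous_on_subset)
    fix s assume s: "0 < s" "s < t"
    have "((\<lambda>u. integral {0..u} E) has_real_derivative E s) (at s within {0..T})"
      using s t by (intro integral_has_real_derivative E) auto
    then have "((\<lambda>u. integral {0..u} E) has_real_derivative E s) (at s)"
      using s t by (simp add: at_within_Icc_at)
    then have "((\<lambda>t. Y t * exp (- C * t)) has_real_derivative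
        (C * E s) * exp (- C * s) + Y s * (exp (- C * s) * (- C))) (at s)"
      unfolding Y_def by (auto intro!: derivative_eq_intros simp: algebra_simps)
    moreover have "(C * E s) * exp (- C * s) + Y s * (exp (- C * s) * (- C)) = C * exp (- C * s) * (E s - Y s)"
      by (simp add: algebra_simps)
    moreover have "\<dots> \<le> 0"
      using Y[of s] s t C by (intro mult_nonneg_nonpos) auto
    ultimately show "\<exists>y. ((\<lambda>t. Y t * exp (- C * t)) has_real_derivative y) (at s) \<and> y \<le> 0"
      by metis
  qed
  then have "Y t \<le> \<kappa> * exp (C * t)"
    by (simp add: Y_def exp_minus field_simps)
  then show ?thesis using Y[OF t] by simp
qed

lemma measure_time_measure: "0 \<le> T \<Longrightarrow> measure (time_measure T) {0<..<T} = T"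
  by (simp add: measure_restrict_space)

text \<open>Here \<open>F\<close> is the derivative of the energy \<open>E\<close>, which vanishes
  at time 0, \<open>D\<close> is the dissipation and \<open>k\<close> the defect. Gronwall's lemma
  first bounds \<open>E\<close> with the dissipation dropped; integrating the same inequality once
  more over the whole interval then recovers the dissipation.\<close>

lemma energy_gronwall:
  fixes E F D k :: "real \<Rightarrow> real"
  assumes T: "0 \<le> T" and C: "0 \<le> C" and E: "continuous_on {0..T} E" "\<And>t. t \<in> {0..T} \<Longrightarrow> 0 \<le> E t"
    and F: "integrable (time_measure T) F" "\<And>t. t \<in> {0..T} \<Longrightarrow> E t = (LINT s|time_measure t. F s)"
    and D: "integrable (time_measure T) D" "AE t in time_measure T. 0 \<le> D t"
    and k: "integrable (time_measure T) k" "AE t in time_measure T. 0 \<le> k t"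
    and le: "AE t in time_measure T. F t + D t \<le> C * E t + k t"
  defines "\<kappa> \<equiv> LINT t|time_measure T. k t"
  shows "t \<in> {0..T} \<Longrightarrow> E t \<le> \<kappa> * exp (C * T)"
    and "(LINT t|time_measure T. D t) \<le> \<kappa> * (1 + C * T * exp (C * T))"
proof -
  have \<kappa>: "0 \<le> \<kappa>" unfolding \<kappa>_def by (rule integral_nonneg_AE) (rule k)
  have Eint: "integrable (time_measure T) E" by (rule continuous_time_integrable[OF E(1)])
  have bound: "E t \<le> \<kappa> * exp (C * T)" if t: "t \<in> {0..T}" for t
  proof -
    have "E t \<le> \<kappa> * exp (C * t)"
    proof (rule gronwall[OF E(1) C _ t])
      fix t assume t: "t \<in> {0..T}"
      then have tT: "t \<le> T" by simp
      note int = time_integrable_mono[OF F(1) tT] time_integrable_mono[OF Eint tT] time_integrable_mono[OF k(1) tT]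
      have "E t = (LINT s|time_measure t. F s)" by (rule F(2)[OF t])
      also have "\<dots> \<le> (LINT s|time_measure t. C * E s + k s)"
      proof (rule integral_mono_AE)
        show "AE s in time_measure t. F s \<le> C * E s + k s"
          using AE_time_measure_mono[OF le tT] AE_time_measure_mono[OF D(2) tT] by eventually_elim simp
      qed (use int in auto)
      also have "\<dots> = C * (LINT s|time_measure t. E s) + (LINT s|time_measure t. k s)"
        using int by simp
      also have "(LINT s|time_measure t. k s) \<le> \<kappa>"
        unfolding \<kappa>_def time_integral_indicator[OF tT]
      proof (rule integral_mono_AE)
        show "integrable (time_measure T) (\<lambda>s. indicator {..<t} s *\<^sub>R k s)"
          by (rule integrable_indicator_scaleR[OF k(1)]) simp
        show "AE s in time_measure T. indicator {..<t} s *\<^sub>R k s \<le> k s"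
          using k(2) by eventually_elim (simp add: indicator_def)
      qed (rule k)
      finally show "E t \<le> C * (LINT s|time_measure t. E s) + \<kappa>" by simp
    qed
    also have "\<dots> \<le> \<kappa> * exp (C * T)" using t C \<kappa> by (intro mult_left_mono) (auto intro!: mult_left_mono)
    finally show ?thesis .
  qed
  show "t \<in> {0..T} \<Longrightarrow> E t \<le> \<kappa> * exp (C * T)" by (rule bound)
  \<comment> \<open>The integral of \<open>F\<close> is \<open>E T\<close>, which is nonnegative and
    can be discarded. The factor \<open>C * T * exp (C * T)\<close> comes from integrating the bound
    of \<open>E\<close> just obtained.\<close>
  have "(LINT t|time_measure T. D t) \<le> (LINT t|time_measure T. C * E t + k t - F t)"
    by (rule integral_mono_AE) (use D(1) Eint k(1) F(1) le in \<open>auto elim: eventually_mono\<close>)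
  also have "\<dots> = C * (LINT t|time_measure T. E t) + \<kappa> - E T"
    using Eint k(1) F T by (simp add: \<kappa>_def)
  also have "\<dots> \<le> C * (LINT t|time_measure T. E t) + \<kappa>" using E(2)[of T] T by simp
  also have "\<dots> \<le> C * (T * (\<kappa> * exp (C * T))) + \<kappa>"
  proof (intro add_right_mono mult_left_mono C)
    have "(LINT t|time_measure T. E t) \<le> (LINT t|time_measure T. \<kappa> * exp (C * T))"
      by (rule integral_mono) (use Eint bound finite_measure.integrable_const[OF finite_time_measure] in auto)
    then show "(LINT t|time_measure T. E t) \<le> T * (\<kappa> * exp (C * T))"
      using T by (simp add: measure_time_measure)
  qed
  finally show "(LINT t|time_measure T. D t) \<le> \<kappa> * (1 + C * T * exp (C * T))"
    by (simp add: algebra_simps)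
qed

section \<open>Time derivatives under linear maps, and initial values\<close>

lemma has_time_deriv_bounded_linear:
  fixes u g :: "real \<Rightarrow> 'a::{banach, second_countable_topology}"
    and J :: "'a \<Rightarrow> 'b::{banach, second_countable_topology}"
  assumes u: "has_time_deriv T u g" and J: "bounded_linear J"
  shows "has_time_deriv T (\<lambda>t. J (u t)) (\<lambda>t. J (g t))"
proof -
  obtain c where g: "integrable (time_measure T) g"
    and c: "AE t in time_measure T. u t = c + (LINT s|time_measure t. g s)"
    using u by (auto simp: has_time_deriv_def)
  have "AE t in time_measure T. J (u t) = J c + (LINT s|time_measure t. J (g s))"
    using c AE_time_measure_in
  proof eventually_elim
    case (elim t)
    then have "integrable (time_measure t) g" by (intro time_integrable_mono[OF g]) simp
    then have "(LINT s|time_measure t. J (g s)) = J (LINT s|time_measure t. g s)"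
      by (rule integral_bounded_linear[OF J])
    then show ?case using elim J by (simp add: bounded_linear.linear linear_add)
  qed
  then show ?thesis
    using integrable_bounded_linear[OF J g] by (auto simp: has_time_deriv_def)
qed

lemma has_time_deriv_cong_AE:
  assumes "has_time_deriv T u g" "AE t in time_measure T. u t = w t"
  shows "has_time_deriv T w g"
proof -
  obtain c where "integrable (time_measure T) g"
    and c: "AE t in time_measure T. u t = c + (LINT s|time_measure t. g s)"
    using assms(1) by (auto simp: has_time_deriv_def)
  moreover have "AE t in time_measure T. w t = c + (LINT s|time_measure t. g s)"
    using c assms(2) by eventually_elim simp
  ultimately show ?thesis by (auto simp: has_time_deriv_def)
qed

text \<open>Problem (P) prescribes initial values in H, while \<open>u\<close> and its primitive are
  V-valued. The continuous representatives agree at time 0 after \<open>J\<close> is applied, and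
  injectivity brings the equality back.\<close>

lemma has_time_deriv_initial_value:
  fixes u g :: "real \<Rightarrow> 'a::{banach, second_countable_topology}"
    and J :: "'a \<Rightarrow> 'b::{banach, second_countable_topology}"
  assumes T: "0 < T" and u: "has_time_deriv T u g" and J: "bounded_linear J" "inj J"
    and init: "has_initial_value T (\<lambda>t. J (u t)) (J u0)"
  shows "AE t in time_measure T. u t = u0 + (LINT s|time_measure t. g s)"
proof -
  obtain c where g: "integrable (time_measure T) g"
    and c: "AE t in time_measure T. u t = c + (LINT s|time_measure t. g s)"
    using u by (auto simp: has_time_deriv_def)
  obtain w where w: "continuous_on {0..T} w" "AE t in time_measure T. J (u t) = w t" "w 0 = J u0"
    using init by (auto simp: has_initial_value_def)
  have "J (c + (LINT s|time_measure 0. g s)) = w 0"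
  proof (rule continuous_AE_eq[OF T _ w(1), where u = "\<lambda>t. J (c + (LINT s|time_measure t. g s))"])
    show "continuous_on {0..T} (\<lambda>t. J (c + (LINT s|time_measure t. g s)))"
      by (intro bounded_linear.continuous_on[OF J(1)] continuous_intros primitive_continuous g)
    show "AE t in time_measure T. J (c + (LINT s|time_measure t. g s)) = w t"
      using c w(2) by eventually_elim simp
  qed (use T in auto)
  then have "c = u0"
    using J(2) w(3) by (simp add: time_integral_0 inj_eq)
  then show ?thesis using c by simp
qed

text \<open>The coefficient is the \<tau> of the error analysis, the distance from t to the right
  end of its grid cell.\<close>

lemma bar_eq_hat:
  assumes "0 < h"
  shows "bar_interp h x t =
    hat_interp h x t + (real (Suc (nat \<lfloor>t / h\<rfloor>)) * h - t) *\<^sub>R diff_quot h x (nat \<lfloor>t / h\<rfloor>)"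
proof -
  define n where "n = nat \<lfloor>t / h\<rfloor>"
  have "h *\<^sub>R diff_quot h x n = x (Suc n) - x n" using assms by (simp add: diff_quot_def)
  moreover have "(real (Suc n) * h - t) *\<^sub>R diff_quot h x n + (t - real n * h) *\<^sub>R diff_quot h x n
      = h *\<^sub>R diff_quot h x n"
    by (simp add: algebra_simps)
  ultimately show ?thesis
    by (simp add: bar_interp_def hat_interp_def n_def[symmetric] Let_def algebra_simps)
qed

section \<open>Measurability and selfadjoint operators\<close>

text \<open>Lebesgue measure is complete. This matters because an operator has no meaning at the
  times when its argument leaves the domain.\<close>

lemma measurable_time_AE_eq:
  fixes f g :: "real \<Rightarrow> 'a::{banach, second_countable_topology}"
  assumes f: "f \<in> borel_measurable (time_measure T)"
    and ae: "AE t in time_measure T. f t = g t"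
  shows "g \<in> borel_measurable (time_measure T)"
proof (rule borel_measurableI)
  fix S :: "'a set" assume S: "open S"
  have "f -` S \<inter> {0<..<T} \<in> sets (time_measure T)"
    using measurable_sets[OF f, of S] S by simp
  then have A: "f -` S \<inter> {0<..<T} \<in> sets lebesgue"
    by (simp add: sets_restrict_space_iff)
  have "AE t in lebesgue. t \<in> f -` S \<inter> {0<..<T} \<longleftrightarrow> t \<in> g -` S \<inter> {0<..<T}"
    using ae unfolding AE_time_measure_iff by eventually_elim auto
  then have "g -` S \<inter> {0<..<T} \<in> sets lebesgue"
    by (rule completion.in_sets_AE[OF _ A]) simp
  then have "g -` S \<inter> {0<..<T} \<in> sets (time_measure T)"
    by (subst sets_restrict_space_iff) auto
  then show "g -` S \<inter> space (time_measure T) \<in> sets (time_measure T)"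
    by simp
qed

text \<open>One direction of Pettis' theorem: the norm is a supremum over a countable set of functionals.\<close>

lemma weakly_measurable_imp_measurable:
  fixes f :: "'t \<Rightarrow> 'h::{real_inner, banach, second_countable_topology}"
  assumes D: "closure D = UNIV"
    and meas: "\<And>y. y \<in> D \<Longrightarrow> (\<lambda>t. f t \<bullet> y) \<in> borel_measurable M"
  shows "f \<in> borel_measurable M"
proof -
  \<comment> \<open>Limits extend the hypothesis from the dense set \<open>D\<close> to all y; the
    countable dense set \<open>Q\<close> used below need not lie in \<open>D\<close>.\<close>
  have [measurable]: "(\<lambda>t. f t \<bullet> y) \<in> borel_measurable M" for y
  proof -
    have "y \<in> closure D" using D by simp
    then obtain s where s: "\<And>n. s n \<in> D" "s \<longlonglongrightarrow> y"
      by (auto simp: closure_sequential)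
    show ?thesis
    proof (rule borel_measurable_LIMSEQ_metric)
      show "(\<lambda>t. f t \<bullet> s n) \<in> borel_measurable M" for n by (rule meas[OF s(1)])
      show "(\<lambda>n. f t \<bullet> s n) \<longlonglongrightarrow> f t \<bullet> y" for t by (intro tendsto_intros s)
    qed
  qed
  obtain Q :: "'h set" where Q: "countable Q" "\<And>X. open X \<Longrightarrow> X \<noteq> {} \<Longrightarrow> \<exists>d\<in>Q. d \<in> X"
    by (rule countable_dense_setE) blast
  have Qcl: "closure Q = UNIV"
  proof -
    have "y \<in> closure Q" for y
      unfolding closure_approachable
    proof (intro allI impI)
      fix e :: real assume "0 < e"
      then show "\<exists>x\<in>Q. dist x y < e" using Q(2)[of "ball y e"] by (auto simp: dist_commute)
    qed
    then show ?thesis by auto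
  qed
  have norm_iff: "norm x \<le> r \<longleftrightarrow> (\<forall>y\<in>Q. x \<bullet> y \<le> r * norm y)" if "0 \<le> r" for x :: 'h and r
  proof
    assume "norm x \<le> r"
    then show "\<forall>y\<in>Q. x \<bullet> y \<le> r * norm y"
      by (meson norm_cauchy_schwarz mult_right_mono norm_ge_zero order_trans)
  next
    assume le: "\<forall>y\<in>Q. x \<bullet> y \<le> r * norm y"
    have "x \<in> closure Q" using Qcl by simp
    then obtain s where s: "\<And>n. s n \<in> Q" "s \<longlonglongrightarrow> x"
      by (auto simp: closure_sequential)
    have "x \<bullet> x \<le> r * norm x"
    proof (rule LIMSEQ_le)
      show "(\<lambda>n. x \<bullet> s n) \<longlonglongrightarrow> x \<bullet> x" by (intro tendsto_intros s)
      show "(\<lambda>n. r * norm (s n)) \<longlonglongrightarrow> r * norm x" by (intro tendsto_intros s)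
    qed (use le s in auto)
    then have "norm x * norm x \<le> r * norm x"
      by (simp add: power2_eq_square flip: power2_norm_eq_inner)
    then show "norm x \<le> r"
      using that by (cases "x = 0") auto
  qed
  have ball [measurable]: "{t \<in> space M. f t \<in> cball c r} \<in> sets M" if "0 \<le> r" for c r
  proof -
    have "{t \<in> space M. f t \<in> cball c r} = {t \<in> space M. \<forall>y\<in>Q. f t \<bullet> y - c \<bullet> y \<le> r * norm y}"
      using norm_iff[OF that, of "f t - c" for t]
      by (auto simp: dist_norm norm_minus_commute inner_diff_left)
    also have "\<dots> \<in> sets M"
      using Q(1) by measurable
    finally show ?thesis .
  qed
  show ?thesis
  proof (rule borel_measurableI)
    fix S :: "'h set" assume S: "open S"
    \<comment> \<open>An open set is the union of the closed balls in it that have centre in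
      \<open>Q\<close> and radius \<open>1 / real (Suc n)\<close>. There are countably many, so
      preimages of closed balls suffice.\<close>
    define I where "I = {(q, n). q \<in> Q \<and> cball q (1 / real (Suc n)) \<subseteq> S}"
    have I: "countable I"
      by (rule countable_subset[of _ "Q \<times> UNIV"]) (use Q(1) in \<open>auto simp: I_def\<close>)
    have "x \<in> (\<Union>p\<in>I. cball (fst p) (1 / real (Suc (snd p))))" if xS: "x \<in> S" for x
    proof -
      obtain e where e: "0 < e" "ball x e \<subseteq> S" using S xS by (meson open_contains_ball)
      then obtain n where n: "1 / real (Suc n) < e / 2"
        by (meson half_gt_zero nat_approx_posE)
      obtain q where q: "q \<in> Q" "dist x q < 1 / real (Suc n)"
        using Q(2)[of "ball x (1 / real (Suc n))"] by (auto simp: dist_commute)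
      have "cball q (1 / real (Suc n)) \<subseteq> ball x e"
      proof
        fix z assume "z \<in> cball q (1 / real (Suc n))"
        then have "dist q z \<le> 1 / real (Suc n)" by simp
        then show "z \<in> ball x e" using dist_triangle[of x z q] q(2) n by simp
      qed
      then have "(q, n) \<in> I" using q e by (auto simp: I_def)
      moreover have "x \<in> cball q (1 / real (Suc n))" using q(2) by (simp add: dist_commute)
      ultimately show ?thesis by (intro UN_I[of "(q, n)"]) auto
    qed
    then have S_eq: "S = (\<Union>p\<in>I. cball (fst p) (1 / real (Suc (snd p))))"
      by (auto simp: I_def)
    have "f -` S \<inter> space M = (\<Union>p\<in>I. {t \<in> space M. f t \<in> cball (fst p) (1 / real (Suc (snd p)))})"
      unfolding S_eq by (simp only: vimage_UN) blast
    also have "\<dots> \<in> sets M"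
      using I ball by (intro sets.countable_UN') auto
    finally show "f -` S \<inter> space M \<in> sets M" .
  qed
qed

lemma selfadjoint_sym: "selfadjoint_op D A \<Longrightarrow> x \<in> D \<Longrightarrow> y \<in> D \<Longrightarrow> A x \<bullet> y = x \<bullet> A y"
  unfolding selfadjoint_op_def by blast

text \<open>An unbounded operator is not continuous, but symmetry moves it to the other factor: for
  y in the dense domain, \<open>A (g t) \<bullet> y\<close> is the inner product of
  \<open>g t\<close> with a fixed vector. Weak measurability is enough.\<close>

lemma selfadjoint_op_measurable:
  fixes f :: "real \<Rightarrow> 'h::{real_inner, banach, second_countable_topology}"
  assumes A: "selfadjoint_op D A" and f: "f \<in> borel_measurable (time_measure T)"
    and D: "AE t in time_measure T. f t \<in> D"
  shows "(\<lambda>t. A (f t)) \<in> borel_measurable (time_measure T)"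
proof -
  \<comment> \<open>The value 0 at the exceptional times keeps the argument in the domain at all
    times, as symmetry requires.\<close>
  define g where "g t = (if f t \<in> D then f t else 0)" for t
  have "0 \<in> D" using A by (auto simp: selfadjoint_op_def linear_op_def subspace_def)
  then have gD: "g t \<in> D" for t by (simp add: g_def)
  have ae: "AE t in time_measure T. f t = g t"
    using D by eventually_elim (simp add: g_def)
  have g [measurable]: "g \<in> borel_measurable (time_measure T)"
    using f ae by (rule measurable_time_AE_eq)
  have "(\<lambda>t. A (g t)) \<in> borel_measurable (time_measure T)"
  proof (rule weakly_measurable_imp_measurable)
    show "closure D = UNIV" using A by (simp add: selfadjoint_op_def)
    fix y assume "y \<in> D"
    then have "(\<lambda>t. A (g t) \<bullet> y) = (\<lambda>t. g t \<bullet> A y)"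
      using selfadjoint_sym[OF A gD] by (auto simp: fun_eq_iff)
    then show "(\<lambda>t. A (g t) \<bullet> y) \<in> borel_measurable (time_measure T)" by simp
  qed
  then show ?thesis
    by (rule measurable_time_AE_eq) (use ae in eventually_elim, simp)
qed

lemma sqrt_op_dom: "is_sqrt_op DR R D S \<Longrightarrow> x \<in> D \<Longrightarrow> x \<in> DR"
  unfolding is_sqrt_op_def by blast

text \<open>Turns the norms with square roots in the theorem into quadratic forms, the shape in
  which the energy and the dissipation control them.\<close>

lemma sqrt_op_norm:
  assumes "is_sqrt_op DR R D S" "x \<in> D"
  shows "(norm (R x))\<^sup>2 = S x \<bullet> x"
proof -
  have "x \<in> DR" "R x \<in> DR" "S x = R (R x)" "selfadjoint_op DR R"
    using assms by (auto simp: is_sqrt_op_def)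
  then show ?thesis
    using selfadjoint_sym[of DR R "R x" x] by (simp add: power2_norm_eq_inner)
qed

section \<open>Membership and norms in the Bochner spaces\<close>

lemma Linf_spaceI:
  fixes u :: "real \<Rightarrow> 'a::{banach, second_countable_topology}"
  assumes u: "u \<in> borel_measurable (time_measure T)"
    and K: "AE t in time_measure T. norm (u t) \<le> K"
  shows "Linf_space T u"
proof -
  have "esssup (time_measure T) (\<lambda>t. ereal (norm (u t))) \<le> ereal K"
    using K u by (intro esssup_I) (auto elim: eventually_mono)
  then show ?thesis using u by (auto simp: Linf_space_def)
qed

lemma Linf_nrm_le:
  fixes u :: "real \<Rightarrow> 'a::{banach, second_countable_topology}"
  assumes u: "u \<in> borel_measurable (time_measure T)"
    and K: "AE t in time_measure T. norm (u t) \<le> K" and "0 \<le> K"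
  shows "Linf_nrm T u \<le> K"
proof -
  have "esssup (time_measure T) (\<lambda>t. ereal (norm (u t))) \<le> ereal K"
    using K u by (intro esssup_I) (auto elim: eventually_mono)
  then show ?thesis
    \<comment> \<open>\<open>real_of_ereal\<close> sends an infinite value to 0, and
      \<open>0 \<le> K\<close> covers that case.\<close>
    unfolding Linf_nrm_def using \<open>0 \<le> K\<close>
    by (cases "esssup (time_measure T) (\<lambda>t. ereal (norm (u t)))") auto
qed

lemma Linf_spaceD:
  fixes u :: "real \<Rightarrow> 'a::{banach, second_countable_topology}"
  assumes "Linf_space T u"
  shows "u \<in> borel_measurable (time_measure T)" "\<exists>K\<ge>0. AE t in time_measure T. norm (u t) \<le> K"
proof -
  let ?e = "esssup (time_measure T) (\<lambda>t. ereal (norm (u t)))"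
  show "u \<in> borel_measurable (time_measure T)" using assms by (simp add: Linf_space_def)
  have "?e < \<infinity>" using assms by (simp add: Linf_space_def)
  then obtain K where K: "?e \<le> ereal K"
    by (cases ?e) auto
  have "AE t in time_measure T. ereal (norm (u t)) \<le> ?e" by (rule esssup_AE)
  then have "AE t in time_measure T. norm (u t) \<le> max K 0"
    by eventually_elim (use K in \<open>metis ereal_less_eq(3) max.coboundedI1 order_trans\<close>)
  then show "\<exists>K\<ge>0. AE t in time_measure T. norm (u t) \<le> K"
    by (intro exI[of _ "max K 0"]) simp
qed

lemma Linf_imp_L2:
  fixes u :: "real \<Rightarrow> 'a::{banach, second_countable_topology}"
  assumes u: "u \<in> borel_measurable (time_measure T)"
    and K: "AE t in time_measure T. norm (u t) \<le> K"
  shows "L2_space T u"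
  unfolding L2_space_def
proof
  show "integrable (time_measure T) (\<lambda>t. (norm (u t))\<^sup>2)"
  proof (rule finite_measure.integrable_const_bound[OF finite_time_measure])
    show "AE t in time_measure T. norm ((norm (u t))\<^sup>2) \<le> K\<^sup>2"
      using K by eventually_elim (simp add: power_mono)
  qed (use u in measurable)
qed (rule u)

lemma L2_nrm_le:
  assumes "(LINT t|time_measure T. (norm (u t))\<^sup>2) \<le> K\<^sup>2" "0 \<le> K"
  shows "L2_nrm T u \<le> K"
  unfolding L2_nrm_def using real_sqrt_le_mono[OF assms(1)] assms(2) by simp

lemma L2_space_diff:
  fixes u w :: "real \<Rightarrow> 'a::{banach, second_countable_topology}"
  assumes u: "L2_space T u" and w: "L2_space T w"
  shows "L2_space T (\<lambda>t. u t - w t)"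
  unfolding L2_space_def
proof
  have [measurable]: "u \<in> borel_measurable (time_measure T)" "w \<in> borel_measurable (time_measure T)"
    using u w by (auto simp: L2_space_def)
  show "(\<lambda>t. u t - w t) \<in> borel_measurable (time_measure T)" by measurable
  show "integrable (time_measure T) (\<lambda>t. (norm (u t - w t))\<^sup>2)"
  proof (rule Bochner_Integration.integrable_bound)
    show "integrable (time_measure T) (\<lambda>t. 2 * (norm (u t))\<^sup>2 + 2 * (norm (w t))\<^sup>2)"
      using u w by (auto simp: L2_space_def)
    show "AE t in time_measure T. norm ((norm (u t - w t))\<^sup>2) \<le> norm (2 * (norm (u t))\<^sup>2 + 2 * (norm (w t))\<^sup>2)"
    proof (rule AE_I2)
      fix t
      have "(norm (u t - w t))\<^sup>2 \<le> (norm (u t) + norm (w t))\<^sup>2"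
        by (intro power_mono norm_triangle_ineq4) simp
      also have "\<dots> \<le> 2 * (norm (u t))\<^sup>2 + 2 * (norm (w t))\<^sup>2"
        using zero_le_power2[of "norm (u t) - norm (w t)"] by (simp add: power2_eq_square algebra_simps)
      finally show "norm ((norm (u t - w t))\<^sup>2) \<le> norm (2 * (norm (u t))\<^sup>2 + 2 * (norm (w t))\<^sup>2)"
        by simp
    qed
  qed measurable
qed

lemma L2_space_inner:
  fixes u w :: "real \<Rightarrow> 'a::{real_inner, banach, second_countable_topology}"
  assumes u: "L2_space T u" and w: "L2_space T w"
  shows "integrable (time_measure T) (\<lambda>t. u t \<bullet> w t)"
proof (rule Bochner_Integration.integrable_bound)
  have [measurable]: "u \<in> borel_measurable (time_measure T)" "w \<in> borel_measurable (time_measure T)"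
    using u w by (auto simp: L2_space_def)
  show "(\<lambda>t. u t \<bullet> w t) \<in> borel_measurable (time_measure T)" by measurable
  show "integrable (time_measure T) (\<lambda>t. (norm (u t))\<^sup>2 + (norm (w t))\<^sup>2)"
    using u w by (auto simp: L2_space_def)
  show "AE t in time_measure T. norm (u t \<bullet> w t) \<le> norm ((norm (u t))\<^sup>2 + (norm (w t))\<^sup>2)"
  proof (rule AE_I2)
    fix t
    have "\<bar>u t \<bullet> w t\<bar> \<le> norm (u t) * norm (w t)" by (rule Cauchy_Schwarz_ineq2)
    also have "\<dots> \<le> (norm (u t))\<^sup>2 + (norm (w t))\<^sup>2"
    proof -
      have "0 \<le> norm (u t) * norm (w t)" by simp
      then show ?thesis using sum_squares_bound[of "norm (u t)" "norm (w t)"] by linarith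
    qed
    finally show "norm (u t \<bullet> w t) \<le> norm ((norm (u t))\<^sup>2 + (norm (w t))\<^sup>2)" by simp
  qed
qed

lemma L2_space_cong_AE:
  fixes u w :: "real \<Rightarrow> 'a::{banach, second_countable_topology}"
  assumes u: "L2_space T u" and ae: "AE t in time_measure T. u t = w t"
  shows "L2_space T w"
proof -
  have um: "u \<in> borel_measurable (time_measure T)" "integrable (time_measure T) (\<lambda>t. (norm (u t))\<^sup>2)"
    using u by (auto simp: L2_space_def)
  have wm: "w \<in> borel_measurable (time_measure T)" using um(1) ae by (rule measurable_time_AE_eq)
  have "integrable (time_measure T) (\<lambda>t. (norm (w t))\<^sup>2)"
    by (rule integrable_cong_AE_imp[OF um(2)]) (use wm ae in \<open>auto elim: eventually_mono\<close>)
  then show ?thesis using wm by (simp add: L2_space_def)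
qed

lemma interp_L2:
  fixes f :: "nat \<Rightarrow> 'a::{banach, second_countable_topology}"
  assumes h: "0 < h"
  shows "L2_space T (\<lambda>t. f (nat \<lfloor>t / h\<rfloor>))"
proof -
  obtain B where "\<And>t. t \<in> {0<..<T} \<Longrightarrow> norm (f (nat \<lfloor>t / h\<rfloor>)) \<le> B"
    using interp_bounded[OF h] by metis
  then show ?thesis
    by (intro Linf_imp_L2[where K = B] interp_measurable) auto
qed

lemma linear_op_diff:
  assumes "linear_op D A" "x \<in> D" "y \<in> D"
  shows "x - y \<in> D" "A (x - y) = A x - A y"
proof -
  have D: "subspace D" and add: "\<And>x y. x \<in> D \<Longrightarrow> y \<in> D \<Longrightarrow> A (x + y) = A x + A y"
    and scale: "\<And>c x. x \<in> D \<Longrightarrow> A (c *\<^sub>R x) = c *\<^sub>R A x"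
    using assms(1) by (auto simp: linear_op_def)
  show "x - y \<in> D" using D assms(2,3) by (rule subspace_diff)
  have "(-1) *\<^sub>R y \<in> D" using D assms(3) by (rule subspace_scale)
  then have "A (x + (-1) *\<^sub>R y) = A x + (-1) *\<^sub>R A y" using add scale assms(2,3) by metis
  then show "A (x - y) = A x - A y" by simp
qed

section \<open>Boundedness of the discrete solution\<close>

text \<open>The energy identity is stated for bounded bilinear forms; this wraps \<open>L\<close>
  and, through the identity map, the inner product of H as such forms.\<close>

definition form_of :: "('a::real_inner \<Rightarrow> 'a) \<Rightarrow> 'a \<Rightarrow>\<^sub>L 'a \<Rightarrow>\<^sub>L real" where
  "form_of S = Blinfun (\<lambda>w. blinfun_inner_left (S w))"

lemma form_of_apply:
  assumes "bounded_linear S"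
  shows "form_of S w z = S w \<bullet> z"
proof -
  have "bounded_linear (\<lambda>w. blinfun_inner_left (S w))"
    by (rule bounded_linear_compose[OF bounded_linear_blinfun_inner_left assms])
  then show ?thesis
    by (simp add: form_of_def bounded_linear_Blinfun_apply inner_commute)
qed

text \<open>The right side minus the left side is \<open>a (x' - x) (x' - x)\<close>, the numerical
  dissipation of the implicit Euler step.\<close>

lemma form_increment_le:
  fixes a :: "'a::real_normed_vector \<Rightarrow>\<^sub>L 'a \<Rightarrow>\<^sub>L real"
  assumes "\<And>x y. a x y = a y x" "\<And>x. 0 \<le> a x x"
  shows "a x' x' - a x x \<le> 2 * a x' (x' - x)"
  using assms(2)[of "x' - x"] assms(1)[of x' x]
  by (simp add: blinfun.diff_left blinfun.diff_right)

text \<open>The scheme is implicit, so the new value stands on the right and must be absorbed: for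
  \<open>x \<le> 1 / 2\<close> the factor \<open>1 / (1 - x)\<close> is at most
  \<open>1 + 2 * x\<close>, hence at most \<open>exp (2 * x)\<close>.\<close>

lemma discrete_gronwall:
  fixes Y :: "nat \<Rightarrow> real"
  assumes step: "\<And>n. n < N \<Longrightarrow> Y (Suc n) - Y n \<le> x * Y (Suc n)"
    and nonneg: "\<And>n. 0 \<le> Y n" and x: "0 \<le> x" "x \<le> 1 / 2" and n: "n \<le> N"
  shows "Y n \<le> exp (2 * x * real N) * Y 0"
proof -
  have "Y n \<le> exp (2 * x * real n) * Y 0" using n
  proof (induction n)
    case 0
    then show ?case by simp
  next
    case (Suc n)
    have "0 \<le> x * (1 - 2 * x)" using x by simp
    then have "1 \<le> (1 + 2 * x) * (1 - x)" by (simp add: algebra_simps)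
    then have "Y (Suc n) * 1 \<le> Y (Suc n) * ((1 + 2 * x) * (1 - x))"
      by (intro mult_left_mono nonneg)
    also have "\<dots> = (1 + 2 * x) * (Y (Suc n) - x * Y (Suc n))" by (simp add: algebra_simps)
    also have "\<dots> \<le> (1 + 2 * x) * Y n"
      using step[of n] Suc.prems x by (intro mult_left_mono) auto
    also have "\<dots> \<le> exp (2 * x) * Y n"
      using exp_ge_add_one_self[of "2 * x"] by (intro mult_right_mono nonneg) auto
    also have "\<dots> \<le> exp (2 * x) * (exp (2 * x * real n) * Y 0)"
      using Suc by (intro mult_left_mono) auto
    also have "\<dots> = exp (2 * x * real (Suc n)) * Y 0"
      by (simp add: algebra_simps exp_add)
    finally show ?case by simp
  qed
  also have "\<dots> \<le> exp (2 * x * real N) * Y 0"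
    using n x nonneg[of 0] by (intro mult_right_mono) (auto intro!: mult_left_mono)
  finally show ?thesis .
qed

lemma sum_mult_le_squares:
  fixes a b c d :: real
  shows "(a + b) * (c + d) \<le> a\<^sup>2 + b\<^sup>2 + c\<^sup>2 + d\<^sup>2"
proof -
  have "0 \<le> (a - c)\<^sup>2 + (a - d)\<^sup>2 + (b - c)\<^sup>2 + (b - d)\<^sup>2" by simp
  then show ?thesis by (simp add: power2_eq_square algebra_simps)
qed

text \<open>Prepared for the lower-order terms of the discrete energy inequality: x and y are the H
  norms of \<open>\<phi>\<close> and v, n and l are the norm of \<open>Lip 0\<close> and the
  Lipschitz constant, and c is the dissipation of \<open>B1\<close>.\<close>

lemma affine_product_le:
  fixes a b c n l x y :: real
  assumes "a \<le> x * y" "- b \<le> (n + l * x) * y" "0 \<le> c" "0 \<le> x" "0 \<le> y" "0 \<le> n" "0 \<le> l"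
  shows "a - b - c \<le> (n + l + 1) * (1 + x\<^sup>2 + y\<^sup>2)"
proof -
  have "0 \<le> x * y" using assms by simp
  then have xy: "x * y \<le> 1 + x\<^sup>2 + y\<^sup>2"
    using sum_squares_bound[of x y] by linarith
  have y: "y \<le> 1 + x\<^sup>2 + y\<^sup>2"
    using sum_squares_bound[of 1 y] assms(5) zero_le_power2[of x] by (simp only: power_one mult_1_right)
  have "(n + l * x) * y = n * y + l * (x * y)" by (simp add: algebra_simps)
  also have "\<dots> \<le> n * (1 + x\<^sup>2 + y\<^sup>2) + l * (1 + x\<^sup>2 + y\<^sup>2)"
    using assms by (intro add_mono mult_left_mono xy y)
  finally have "- b \<le> n * (1 + x\<^sup>2 + y\<^sup>2) + l * (1 + x\<^sup>2 + y\<^sup>2)" using assms(2) by (rule order_trans[rotated])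
  moreover have "a \<le> 1 * (1 + x\<^sup>2 + y\<^sup>2)" using assms(1) xy by simp
  ultimately have "- b + a \<le> (n + l + 1) * (1 + x\<^sup>2 + y\<^sup>2)"
    unfolding distrib_right by (rule add_mono)
  then show ?thesis using assms(3) by simp
qed

lemma monotone_sym_extension_apply:
  assumes "monotone_sym_extension \<iota> D A As" "\<iota> w \<in> D"
  shows "As w z = A (\<iota> w) \<bullet> \<iota> z"
  using assms by (simp add: monotone_sym_extension_def dual_embed_def inner_commute)

context parabolic_hyperbolic_system
begin

section \<open>Forms of the operators and their increments\<close>

lemmas A1s_apply = monotone_sym_extension_apply[OF A1s_ext]
lemmas A2s_apply = monotone_sym_extension_apply[OF A2s_ext]
lemmas B1s_apply = monotone_sym_extension_apply[OF B1s_ext]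
lemmas B2s_apply = monotone_sym_extension_apply[OF B2s_ext]

lemma form_sym: "A1s w z = A1s z w" "A2s w z = A2s z w" "B1s w z = B1s z w" "B2s w z = B2s z w"
  using A1s_ext A2s_ext B1s_ext B2s_ext by (auto simp: monotone_sym_extension_def)

lemma form_nonneg: "0 \<le> A1s w w" "0 \<le> A2s w w" "0 \<le> B1s w w" "0 \<le> B2s w w"
  using A1s_ext A2s_ext B1s_ext B2s_ext by (auto simp: monotone_sym_extension_def)

lemma L_nonneg: "0 \<le> L w \<bullet> w"
proof -
  obtain c where "c > 0" "L w \<bullet> w \<ge> c * (norm w)\<^sup>2" using L_coercive by blast
  then show ?thesis by (meson less_imp_le mult_nonneg_nonneg order_trans zero_le_power2)
qed

lemma L_increment_le: "L w' \<bullet> w' - L w \<bullet> w \<le> 2 * (L (w' - w) \<bullet> w')"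
proof -
  have L_comm: "L x \<bullet> y = L y \<bullet> x" for x y by (metis L_sym inner_commute)
  have eq: "form_of L x y = L x \<bullet> y" for x y by (rule form_of_apply[OF L_bounded])
  have "form_of L w' w' - form_of L w w \<le> 2 * form_of L w' (w' - w)"
    by (rule form_increment_le) (auto simp: eq L_nonneg intro: L_comm)
  then show ?thesis using L_comm[of "w' - w" w'] by (simp add: eq)
qed

lemma B2_increment_le:
  assumes "\<iota> w' \<in> DA1"
  shows "B2s w' w' - B2s w w \<le> 2 * (B2 (\<iota> w') \<bullet> \<iota> (w' - w))"
  using form_increment_le[of B2s w' w, OF form_sym(4) form_nonneg(4)] B2s_apply[of w' "w' - w"] assms DA1_DB2
  by auto

lemma A2_increment_le:
  assumes "\<iota> w' \<in> DA2"
  shows "A2s w' w' - A2s w w \<le> 2 * (A2 (\<iota> w') \<bullet> \<iota> (w' - w))"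
  using form_increment_le[of A2s w' w, OF form_sym(2) form_nonneg(2)] A2s_apply[of w' "w' - w"] assms
  by auto

lemma norm_increment_le: "(norm (w' :: 'h))\<^sup>2 - (norm w)\<^sup>2 \<le> 2 * (w' \<bullet> (w' - w))"
  using inner_ge_zero[of "w' - w"] by (simp add: power2_norm_eq_inner inner_diff inner_commute)

text \<open>The second discrete equation is tested with the new velocity. The potential of
  \<open>\<Phi>\<close> turns the nonlinear term into an increment, so its growth does not enter,
  and the coupling cancels against the first equation tested with \<open>B2\<close> of the new
  temperature. The resulting bound is uniform in h.\<close>

lemma discrete_bounded:
  obtains R h1 where "0 \<le> R" "0 < h1"
    "\<And>N h \<theta>s \<phi>s vs zs n. 0 < N \<Longrightarrow> h = T / real N \<Longrightarrow> h \<le> h1 \<Longrightarrow>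
      discrete_solution \<eta> \<iota> L DA1 A1 DA2 A2 DB1 B1 B2 \<Phi> Lip \<theta>0 \<phi>0 v0 h N \<theta>s \<phi>s vs zs \<Longrightarrow>
      n \<le> N \<Longrightarrow> norm (\<phi>s n) \<le> R"
proof -
  obtain cL where cL: "0 < cL" "\<And>w. cL * (norm w)\<^sup>2 \<le> L w \<bullet> w" using L_coercive by auto
  obtain CL where CL: "0 < CL" "CL-lipschitz_on UNIV Lip" using Lip_lipschitz by auto
  obtain i :: "'v \<Rightarrow> real" where i0: "\<And>w. 0 \<le> i w"
    and i: "\<And>w z. i w - i z \<le> \<Phi> (\<iota> w) \<bullet> (\<iota> w - \<iota> z)"
    using \<Phi>_potential by auto
  obtain \<omega> where \<omega>: "0 < \<omega>" "\<And>w. \<omega> * (norm w)\<^sup>2 \<le> A2s w w + (norm (\<iota> w))\<^sup>2"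
    using A2s_coercive unfolding coercive_up_to_H_def by (metis mult_1 zero_less_one)
  \<comment> \<open>\<open>C0\<close> is the constant of \<open>affine_product_le\<close>. In
    \<open>C\<close>, the 2 comes from doubling the tested equation and \<open>1 + 1 / cL\<close>
    from bounding the H norms by the energy.\<close>
  define C0 where "C0 = norm (Lip 0) + CL + 1"
  define C where "C = 2 * C0 * (1 + 1 / cL)"
  have C0: "0 < C0" using CL by (auto simp: C0_def intro: add_nonneg_pos)
  have C: "0 < C" using C0 cL by (auto simp: C_def intro!: mult_pos_pos add_pos_pos)
  \<comment> \<open>The potential enters with factor 2 because its increment inequality lacks the
    factor 2 of the quadratic terms. The H norm of \<open>\<phi>\<close> makes up for the coercivity
    of \<open>A2s\<close>, and the weight \<open>1 / \<eta>\<close> makes the coupling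
    cancel.\<close>
  define E where "E \<theta> \<phi> v = L (\<iota> v) \<bullet> \<iota> v + A2s \<phi> \<phi> + 2 * i \<phi> + (norm (\<iota> \<phi>))\<^sup>2 + B2s \<theta> \<theta> / \<eta>"
    for \<theta> \<phi> v :: 'v
  have E_ge: "L (\<iota> v) \<bullet> \<iota> v \<le> E \<theta> \<phi> v" "A2s \<phi> \<phi> + (norm (\<iota> \<phi>))\<^sup>2 \<le> E \<theta> \<phi> v"
    "(norm (\<iota> \<phi>))\<^sup>2 \<le> E \<theta> \<phi> v" "0 \<le> E \<theta> \<phi> v" for \<theta> \<phi> v :: 'v
    using L_nonneg[of "\<iota> v"] form_nonneg(2)[of \<phi>] divide_nonneg_pos[OF form_nonneg(4)[of \<theta>] \<eta>_pos]
      i0[of \<phi>] zero_le_power2[of "norm (\<iota> \<phi>)"] unfolding E_def by linarith+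
  define Z where "Z = exp (2 * C * T) * (1 + E \<theta>0 \<phi>0 v0)"
  have Z: "0 \<le> Z" using E_ge(4)[of \<theta>0 \<phi>0 v0] by (simp add: Z_def)
  show thesis
  \<comment> \<open>The step bound \<open>1 / (2 * C)\<close> is the condition
    \<open>h * C \<le> 1 / 2\<close> of the discrete Gronwall lemma.\<close>
  proof (rule that[of "sqrt (Z / \<omega>)" "1 / (2 * C)"])
    show "0 \<le> sqrt (Z / \<omega>)" using Z \<omega> by simp
    show "0 < 1 / (2 * C)" using C by simp
    fix N h \<theta>s \<phi>s vs zs n
    assume N: "0 < N" and h: "h = T / real N" and h1: "h \<le> 1 / (2 * C)"
      and sol: "discrete_solution \<eta> \<iota> L DA1 A1 DA2 A2 DB1 B1 B2 \<Phi> Lip \<theta>0 \<phi>0 v0 h N \<theta>s \<phi>s vs zs"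
      and n: "n \<le> N"
    have hpos: "0 < h" using h N T_pos by simp
    let ?E = "\<lambda>n. E (\<theta>s n) (\<phi>s n) (vs n)"
    \<comment> \<open>The added 1 absorbs the inhomogeneous term that \<open>Lip 0\<close>
      causes.\<close>
    have step: "(1 + ?E (Suc n)) - (1 + ?E n) \<le> (h * C) * (1 + ?E (Suc n))" if n: "n < N" for n
    proof -
      let ?v = "\<iota> (vs (Suc n))" and ?p = "\<iota> (\<phi>s (Suc n))" and ?t = "\<iota> (\<theta>s (Suc n))"
      let ?d = "diff_quot h \<theta>s n"
      have tD: "?t \<in> DA1" and pD: "?p \<in> DB1" "?p \<in> DA2"
        and eq1: "\<iota> ?d + \<eta> *\<^sub>R \<iota> (diff_quot h \<phi>s n) + A1 ?t = 0"
        and eq2: "L (\<iota> (zs (Suc n))) + B1 ?v + A2 ?p + \<Phi> ?p + Lip ?p = B2 ?t"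
        and z: "zs (Suc n) = diff_quot h vs n" and v: "vs (Suc n) = diff_quot h \<phi>s n"
        using sol n by (auto simp: discrete_solution_def)
      have pD0: "\<iota> (\<phi>s n) \<in> DB1"
        using sol n \<phi>0_dom by (cases n) (auto simp: discrete_solution_def)
      have "subspace DB1" using B1_op(1) by (simp add: linear_op_def)
      then have vD: "?v \<in> DB1"
        unfolding v diff_quot_def blinfun.scaleR_right blinfun.diff_right
        by (intro subspace_scale subspace_diff pD pD0)
      have dz: "\<iota> (vs (Suc n)) - \<iota> (vs n) = h *\<^sub>R \<iota> (zs (Suc n))"
        and dv: "\<phi>s (Suc n) - \<phi>s n = h *\<^sub>R vs (Suc n)"
        and dt: "\<theta>s (Suc n) - \<theta>s n = h *\<^sub>R ?d"
        using hpos by (simp_all add: z v diff_quot_def blinfun.diff_right blinfun.scaleR_right)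
      have Lh: "L (h *\<^sub>R x) = h *\<^sub>R L x" for x
        using L_bounded by (simp add: bounded_linear.linear linear_cmul)
      have a: "L ?v \<bullet> ?v - L (\<iota> (vs n)) \<bullet> \<iota> (vs n) \<le> 2 * h * (L (\<iota> (zs (Suc n))) \<bullet> ?v)"
        using L_increment_le[of ?v "\<iota> (vs n)"] unfolding dz Lh by simp
      have b: "A2s (\<phi>s (Suc n)) (\<phi>s (Suc n)) - A2s (\<phi>s n) (\<phi>s n) \<le> 2 * h * (A2 ?p \<bullet> ?v)"
        using A2_increment_le[OF pD(2), of "\<phi>s n"] unfolding dv blinfun.scaleR_right by simp
      have c: "i (\<phi>s (Suc n)) - i (\<phi>s n) \<le> h * (\<Phi> ?p \<bullet> ?v)"
        using i[of "\<phi>s (Suc n)" "\<phi>s n"] unfolding blinfun.diff_right[symmetric] dv blinfun.scaleR_right by simp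
      have d: "(norm ?p)\<^sup>2 - (norm (\<iota> (\<phi>s n)))\<^sup>2 \<le> 2 * h * (?p \<bullet> ?v)"
        using norm_increment_le[of ?p "\<iota> (\<phi>s n)"]
        unfolding blinfun.diff_right[symmetric] dv blinfun.scaleR_right by simp
      have e: "B2s (\<theta>s (Suc n)) (\<theta>s (Suc n)) - B2s (\<theta>s n) (\<theta>s n) \<le> 2 * h * (B2 ?t \<bullet> \<iota> ?d)"
        using B2_increment_le[OF tD, of "\<theta>s n"] unfolding dt blinfun.scaleR_right by simp
      \<comment> \<open>First equation tested with \<open>B2 ?t\<close>; the product with
        \<open>A1 ?t\<close> has a sign by assumption.\<close>
      have "B2 ?t \<bullet> (\<iota> ?d + \<eta> *\<^sub>R ?v + A1 ?t) = 0" using eq1 by (simp add: v)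
      then have "B2 ?t \<bullet> \<iota> ?d \<le> - \<eta> * (B2 ?t \<bullet> ?v)"
        using B2_A1_nonneg[OF tD] by (simp add: inner_add_right)
      then have "2 * h * (B2 ?t \<bullet> \<iota> ?d) \<le> 2 * h * (- \<eta> * (B2 ?t \<bullet> ?v))"
        using hpos by (intro mult_left_mono) auto
      also have "\<dots> = - (2 * h * (B2 ?t \<bullet> ?v)) * \<eta>" by algebra
      finally have "B2s (\<theta>s (Suc n)) (\<theta>s (Suc n)) - B2s (\<theta>s n) (\<theta>s n) \<le> - (2 * h * (B2 ?t \<bullet> ?v)) * \<eta>"
        using e by linarith
      then have e': "B2s (\<theta>s (Suc n)) (\<theta>s (Suc n)) / \<eta> - B2s (\<theta>s n) (\<theta>s n) / \<eta> \<le> - (2 * h * (B2 ?t \<bullet> ?v))"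
        unfolding diff_divide_distrib[symmetric] using \<eta>_pos by (subst pos_divide_le_eq)
      \<comment> \<open>Second equation tested with the new velocity. Its right side is the coupling
        term already bounded in \<open>e'\<close>.\<close>
      have "(L (\<iota> (zs (Suc n))) + B1 ?v + A2 ?p + \<Phi> ?p + Lip ?p) \<bullet> ?v = B2 ?t \<bullet> ?v"
        using eq2 by simp
      then have sum: "L (\<iota> (zs (Suc n))) \<bullet> ?v + A2 ?p \<bullet> ?v + \<Phi> ?p \<bullet> ?v - B2 ?t \<bullet> ?v =
          - (B1 ?v \<bullet> ?v) - Lip ?p \<bullet> ?v"
        by (simp add: inner_add_left)
      have B1v: "0 \<le> B1 ?v \<bullet> ?v"
        using form_nonneg(3)[of "vs (Suc n)"] B1s_apply[OF vD, of "vs (Suc n)"] by simp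
      have "?E (Suc n) - ?E n \<le> 2 * h * (L (\<iota> (zs (Suc n))) \<bullet> ?v + A2 ?p \<bullet> ?v + \<Phi> ?p \<bullet> ?v - B2 ?t \<bullet> ?v)
          + 2 * h * (?p \<bullet> ?v)"
        using a b c d e' unfolding E_def by (simp add: algebra_simps)
      also have "\<dots> = 2 * h * (?p \<bullet> ?v - Lip ?p \<bullet> ?v - B1 ?v \<bullet> ?v)"
        unfolding sum by (simp add: algebra_simps)
      also have "\<dots> \<le> 2 * h * (C0 * (1 + (norm ?p)\<^sup>2 + (norm ?v)\<^sup>2))"
      proof (intro mult_left_mono)
        have "norm (Lip ?p) \<le> norm (Lip 0) + norm (Lip ?p - Lip 0)"
          by (metis add.commute diff_add_cancel norm_triangle_ineq)
        also have "norm (Lip ?p - Lip 0) \<le> CL * norm ?p"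
          using lipschitz_onD[OF CL(2), of ?p 0] by (simp add: dist_norm)
        finally have "norm (Lip ?p) * norm ?v \<le> (norm (Lip 0) + CL * norm ?p) * norm ?v"
          by (intro mult_right_mono) auto
        moreover have "- (Lip ?p \<bullet> ?v) \<le> norm (Lip ?p) * norm ?v"
          using Cauchy_Schwarz_ineq2[of "Lip ?p" ?v] by linarith
        ultimately show "?p \<bullet> ?v - Lip ?p \<bullet> ?v - B1 ?v \<bullet> ?v \<le> C0 * (1 + (norm ?p)\<^sup>2 + (norm ?v)\<^sup>2)"
          unfolding C0_def using CL(1) B1v norm_cauchy_schwarz[of ?p ?v]
          by (intro affine_product_le) auto
      qed (use hpos in simp)
      also have "\<dots> \<le> 2 * h * (C0 * ((1 + 1 / cL) * (1 + ?E (Suc n))))"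
      proof (intro mult_left_mono)
        have "cL * (norm ?v)\<^sup>2 \<le> ?E (Suc n)"
          using cL(2)[of ?v] E_ge(1)[where v = "vs (Suc n)" and \<theta> = "\<theta>s (Suc n)" and \<phi> = "\<phi>s (Suc n)"]
          by linarith
        then have "(norm ?v)\<^sup>2 \<le> ?E (Suc n) / cL" using cL(1) by (simp add: field_simps)
        moreover have "(norm ?p)\<^sup>2 \<le> ?E (Suc n)" by (rule E_ge(3))
        moreover have "0 \<le> 1 / cL" using cL(1) by simp
        moreover have "(1 + 1 / cL) * (1 + ?E (Suc n)) = 1 + 1 / cL + ?E (Suc n) + ?E (Suc n) / cL"
          by (simp add: algebra_simps)
        ultimately show "1 + (norm ?p)\<^sup>2 + (norm ?v)\<^sup>2 \<le> (1 + 1 / cL) * (1 + ?E (Suc n))"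
          by linarith
      qed (use hpos C0 in auto)
      also have "\<dots> = (h * C) * (1 + ?E (Suc n))" by (simp add: C_def algebra_simps)
      finally show ?thesis by simp
    qed
    have "1 + ?E n \<le> exp (2 * (h * C) * real N) * (1 + ?E 0)"
    proof (rule discrete_gronwall[of N "\<lambda>n. 1 + ?E n", OF step _ _ _ n])
      show "0 \<le> 1 + ?E n" for n using E_ge(4) by (simp add: add_nonneg_nonneg)
      show "0 \<le> h * C" using hpos C by simp
      show "h * C \<le> 1 / 2" using h1 C by (simp add: field_simps)
    qed
    also have "\<dots> = Z"
      using sol N by (simp add: Z_def h discrete_solution_def mult.commute mult.left_commute)
    finally have "\<omega> * (norm (\<phi>s n))\<^sup>2 \<le> Z"
      using \<omega>(2)[of "\<phi>s n"] E_ge(2)[of "\<phi>s n" "\<theta>s n" "vs n"] by linarith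
    then have "(norm (\<phi>s n))\<^sup>2 \<le> Z / \<omega>" using \<omega>(1) by (simp add: field_simps)
    then show "norm (\<phi>s n) \<le> sqrt (Z / \<omega>)" by (rule real_le_rsqrt)
  qed
qed

end

section \<open>The energy inequality\<close>

context parabolic_hyperbolic_system
begin

text \<open>
  The barred error is the hatted error plus \<open>\<tau>\<close> times the discrete derivative. The squares of the
  discrete derivatives that this produces carry the factor \<open>\<tau>\<^sup>2\<close>, and they are absorbed by \<open>\<tau> R\<close>, where
  \<open>R\<close> collects the terms (discrete derivative, discrete minus continuous derivative).
\<close>

lemma energy_derivative_bound:
  assumes K: "0 \<le> K"
  obtains C h1 \<omega> where "0 < C" "0 < h1" "0 < \<omega>"
    "\<And>\<tau> x Z y vb v u d q c N. 0 \<le> \<tau> \<Longrightarrow> \<tau> \<le> h1 \<Longrightarrow> vb - v = x + \<tau> *\<^sub>R Z \<Longrightarrow>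
      \<iota> (vb - v) \<in> DB1 \<Longrightarrow> \<iota> (y + \<tau> *\<^sub>R vb) \<in> DA2 \<Longrightarrow> \<iota> (u + \<tau> *\<^sub>R d) \<in> DA1 \<Longrightarrow>
      norm N \<le> K * norm (y + \<tau> *\<^sub>R vb) \<Longrightarrow>
      L (\<iota> Z - c) + B1 (\<iota> (vb - v)) + A2 (\<iota> (y + \<tau> *\<^sub>R vb)) + N = B2 (\<iota> (u + \<tau> *\<^sub>R d)) \<Longrightarrow>
      \<iota> (d - q) + \<eta> *\<^sub>R \<iota> (vb - v) + A1 (\<iota> (u + \<tau> *\<^sub>R d)) = 0 \<Longrightarrow>
      L (\<iota> x) \<bullet> (\<iota> Z - c) + A2s y (vb - v) + \<iota> y \<bullet> \<iota> (vb - v) + \<iota> u \<bullet> \<iota> (d - q) + B2s u (d - q) / \<eta>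
        + B1 (\<iota> (vb - v)) \<bullet> \<iota> (vb - v) + \<omega> * (norm (u + \<tau> *\<^sub>R d))\<^sup>2
        + B2 (\<iota> (u + \<tau> *\<^sub>R d)) \<bullet> A1 (\<iota> (u + \<tau> *\<^sub>R d)) / \<eta>
      \<le> C * (L (\<iota> x) \<bullet> \<iota> x + A2s y y + (norm (\<iota> y))\<^sup>2 + (norm (\<iota> u))\<^sup>2 + B2s u u / \<eta>)
        + \<tau> * (C * ((norm c)\<^sup>2 + (norm v)\<^sup>2 + (norm q)\<^sup>2))"
proof -
  obtain cL where cL: "0 < cL" "\<And>w. cL * (norm w)\<^sup>2 \<le> L w \<bullet> w" using L_coercive by auto
  obtain \<omega>1 where \<omega>1: "0 < \<omega>1" "\<And>w. \<omega>1 * (norm w)\<^sup>2 \<le> A1s w w + (norm (\<iota> w))\<^sup>2"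
    using A1s_coercive unfolding coercive_up_to_H_def by (metis mult_1 zero_less_one)
  obtain \<omega>2 where \<omega>2: "0 < \<omega>2" "\<And>w. \<omega>2 * (norm w)\<^sup>2 \<le> A2s w w + (norm (\<iota> w))\<^sup>2"
    using A2s_coercive unfolding coercive_up_to_H_def by (metis mult_1 zero_less_one)
  obtain l where l: "0 < l" "\<And>w. norm (L w) \<le> norm w * l"
    using bounded_linear.pos_bounded[OF L_bounded] by auto
  define \<kappa> where "\<kappa> = norm \<iota>"
  have \<kappa>: "0 \<le> \<kappa>" "\<And>w. norm (\<iota> w) \<le> \<kappa> * norm w" by (auto simp: \<kappa>_def norm_blinfun)
  \<comment> \<open>Half of each coercivity constant survives Young's inequality in the lower bound
    of \<open>R\<close>; \<open>m\<close> is the smallest of the three halves.\<close>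
  define m where "m = min (cL / 2) (min (\<omega>2 / 2) (1 / 2))"
  have m: "0 < m" "m \<le> cL / 2" "m \<le> \<omega>2 / 2" "m \<le> 1 / 2" using cL \<omega>2 by (auto simp: m_def)
  \<comment> \<open>\<open>c1\<close>, \<open>c2\<close>, \<open>c3\<close> are the prices paid in
    the squares of c, v and q by Young's inequality, by splitting the H norm of \<open>vb\<close>,
    and by completing a square for \<open>B2s\<close>.\<close>
  define c1 where "c1 = l\<^sup>2 / (2 * cL)"
  define c2 where "c2 = 2 * \<kappa>\<^sup>2 + (norm A2s)\<^sup>2 / (2 * \<omega>2)"
  define c3 where "c3 = \<kappa>\<^sup>2 / 2 + norm B2s / (4 * \<eta>)"
  have c123: "0 \<le> c1" "0 \<le> c2" "0 \<le> c3"
    using cL \<omega>2 \<eta>_pos by (auto simp: c1_def c2_def c3_def)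
  define C1 where "C1 = c1 + c2 + c3"
  \<comment> \<open>\<open>G\<close> collects the factors of \<tau>^2 times the squared discrete
    derivatives: \<open>K\<close> from the nonlinearity, \<kappa> from the added H norm, \<eta> from
    the coupling, and 6 = 2 + 4 from the estimates \<open>t4\<close> and \<open>t5\<close>.\<close>
  define G where "G = K + \<kappa> + \<eta> + 6"
  have G: "0 < G" using K \<kappa> \<eta>_pos by (simp add: G_def)
  \<comment> \<open>The first summand converts the squared norms of the errors into the energy.
    Adding \<open>C1\<close> lets the same constant bound the defect.\<close>
  define C where "C = G * (1 / cL + 1 / \<omega>2 + 1) + C1"
  have young: "a * b \<le> e / 2 * a\<^sup>2 + b\<^sup>2 / (2 * e)" if "0 < e" for a b e :: real
  proof -
    have "0 \<le> (e * a - b)\<^sup>2 / (2 * e)" using that by simp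
    also have "(e * a - b)\<^sup>2 / (2 * e) = e / 2 * a\<^sup>2 + b\<^sup>2 / (2 * e) - a * b"
      using that by (simp add: power2_eq_square field_simps)
    finally show ?thesis by simp
  qed
  show thesis
  \<comment> \<open>The bound \<open>m / G\<close> makes the terms of order \<tau>^2 absorbable, and
    the bound 1 is spent in \<open>t5\<close>.\<close>
  proof (rule that[of C "min 1 (m / G)" \<omega>1])
    have "0 < G * (1 / cL + 1 / \<omega>2 + 1)" using G cL(1) \<omega>2(1) by (intro mult_pos_pos add_pos_pos) auto
    then show "0 < C" using c123 unfolding C_def C1_def by linarith
    show "0 < min 1 (m / G)" using m G by simp
    show "0 < \<omega>1" by fact
    \<comment> \<open>In the application x, y, u are the hatted errors of v, \<open>\<phi>\<close>,
      \<open>\<theta>\<close>; Z, vb, d are the discrete and c, v, q the continuous derivatives of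
      v, \<open>\<phi>\<close>, \<open>\<theta>\<close>; N is the difference of the lower-order
      terms.\<close>
    fix \<tau> x Z y vb v u d q c N
    assume \<tau>0: "0 \<le> \<tau>" and \<tau>: "\<tau> \<le> min 1 (m / G)" and ev_eq: "vb - v = x + \<tau> *\<^sub>R Z"
      and ev_dom: "\<iota> (vb - v) \<in> DB1" and ep_dom: "\<iota> (y + \<tau> *\<^sub>R vb) \<in> DA2"
      and et_dom: "\<iota> (u + \<tau> *\<^sub>R d) \<in> DA1"
      and N: "norm N \<le> K * norm (y + \<tau> *\<^sub>R vb)"
      and eq1: "L (\<iota> Z - c) + B1 (\<iota> (vb - v)) + A2 (\<iota> (y + \<tau> *\<^sub>R vb)) + N = B2 (\<iota> (u + \<tau> *\<^sub>R d))"
      and eq2: "\<iota> (d - q) + \<eta> *\<^sub>R \<iota> (vb - v) + A1 (\<iota> (u + \<tau> *\<^sub>R d)) = 0"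
    define ev ep et where "ev = vb - v" and "ep = y + \<tau> *\<^sub>R vb" and "et = u + \<tau> *\<^sub>R d"
    note defs = ev_def[symmetric] ep_def[symmetric] et_def[symmetric]
    define F where "F = L (\<iota> x) \<bullet> (\<iota> Z - c) + A2s y ev + \<iota> y \<bullet> \<iota> ev + \<iota> u \<bullet> \<iota> (d - q) + B2s u (d - q) / \<eta>"
    define BA where "BA = B2 (\<iota> et) \<bullet> A1 (\<iota> et) / \<eta>"
    define R where "R = L (\<iota> Z - c) \<bullet> \<iota> Z + A2s vb ev + \<iota> d \<bullet> \<iota> (d - q) + B2s d (d - q) / \<eta>"
    define X Zn Y Vn U Q where "X = norm (\<iota> x)" and "Zn = norm (\<iota> Z)" and "Y = norm y" and "Vn = norm vb"
      and "U = norm (\<iota> u)" and "Q = norm (\<iota> d)"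
    have nonneg: "0 \<le> X" "0 \<le> Zn" "0 \<le> Y" "0 \<le> Vn" "0 \<le> U" "0 \<le> Q"
      by (auto simp: X_def Zn_def Y_def Vn_def U_def Q_def)
    define S where "S = Zn\<^sup>2 + Vn\<^sup>2 + Q\<^sup>2"
    define k where "k = (norm c)\<^sup>2 + (norm v)\<^sup>2 + (norm q)\<^sup>2"
    have et_dom2: "\<iota> et \<in> DB2" using et_dom DA1_DB2 by (auto simp: et_def)
    \<comment> \<open>The sum of three tests: the second equation with \<open>ev\<close>, the first
      with \<open>et\<close>, and the first with \<open>B2 (\<iota> et) / \<eta>\<close>. The
      products of \<open>B2 (\<iota> et)\<close> with \<open>ev\<close> cancel, and replacing barred
      by hatted errors on the left leaves \<open>\<tau> * R\<close>.\<close>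
    have identity: "F + B1 (\<iota> ev) \<bullet> \<iota> ev + A1s et et + BA =
        - (N \<bullet> \<iota> ev) + \<iota> y \<bullet> \<iota> ev - \<eta> * (\<iota> et \<bullet> \<iota> ev) - \<tau> * R"
    proof -
      have "(L (\<iota> Z - c) + B1 (\<iota> ev) + A2 (\<iota> ep) + N) \<bullet> \<iota> ev = B2 (\<iota> et) \<bullet> \<iota> ev"
        using eq1 by (simp add: defs)
      then have g1: "L (\<iota> Z - c) \<bullet> \<iota> ev + B1 (\<iota> ev) \<bullet> \<iota> ev + A2s ep ev + N \<bullet> \<iota> ev = B2 (\<iota> et) \<bullet> \<iota> ev"
        using A2s_apply[OF ep_dom, of ev] by (simp add: defs inner_add_left)
      have "(\<iota> (d - q) + \<eta> *\<^sub>R \<iota> ev + A1 (\<iota> et)) \<bullet> \<iota> et = 0" using eq2 by (simp add: defs)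
      then have g2: "\<iota> et \<bullet> \<iota> (d - q) + \<eta> * (\<iota> et \<bullet> \<iota> ev) + A1s et et = 0"
        using A1s_apply[OF et_dom, of et] by (simp add: defs inner_add_left inner_add_right inner_commute)
      have "B2 (\<iota> et) \<bullet> (\<iota> (d - q) + \<eta> *\<^sub>R \<iota> ev + A1 (\<iota> et)) / \<eta> = 0" using eq2 by (simp add: defs)
      then have g3: "B2s et (d - q) / \<eta> + B2 (\<iota> et) \<bullet> \<iota> ev + BA = 0"
        using B2s_apply[OF et_dom2, of "d - q"] \<eta>_pos
        by (simp add: inner_add_right add_divide_distrib BA_def)
      have h1: "L (\<iota> Z - c) \<bullet> \<iota> ev = L (\<iota> x) \<bullet> (\<iota> Z - c) + \<tau> * (L (\<iota> Z - c) \<bullet> \<iota> Z)"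
        unfolding ev_def ev_eq using L_sym[of "\<iota> x" "\<iota> Z - c"]
        by (simp add: blinfun.add_right blinfun.scaleR_right inner_add_right inner_commute)
      have h2: "A2s ep ev = A2s y ev + \<tau> * A2s vb ev"
        by (simp add: ep_def blinfun.add_right blinfun.add_left blinfun.scaleR_left blinfun.scaleR_right)
      have h3: "\<iota> et \<bullet> \<iota> (d - q) = \<iota> u \<bullet> \<iota> (d - q) + \<tau> * (\<iota> d \<bullet> \<iota> (d - q))"
        by (simp add: et_def blinfun.add_right blinfun.scaleR_right inner_add_left)
      have h4: "B2s et (d - q) / \<eta> = B2s u (d - q) / \<eta> + \<tau> * (B2s d (d - q) / \<eta>)"
        by (simp add: et_def blinfun.add_right blinfun.add_left blinfun.scaleR_left
            blinfun.scaleR_right add_divide_distrib)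
      have "\<tau> * R = \<tau> * (L (\<iota> Z - c) \<bullet> \<iota> Z) + \<tau> * A2s vb ev + \<tau> * (\<iota> d \<bullet> \<iota> (d - q)) + \<tau> * (B2s d (d - q) / \<eta>)"
        by (simp add: R_def distrib_left)
      then show ?thesis
        using g1 g2 g3 unfolding F_def h1 h2 h3 h4 by linarith
    qed
    have ev_le: "norm (\<iota> ev) \<le> X + \<tau> * Zn"
    proof -
      have "\<iota> ev = \<iota> x + \<tau> *\<^sub>R \<iota> Z" by (simp add: ev_def ev_eq blinfun.add_right blinfun.scaleR_right)
      then show ?thesis using norm_triangle_ineq[of "\<iota> x" "\<tau> *\<^sub>R \<iota> Z"] \<tau>0 by (simp add: X_def Zn_def)
    qed
    have ep_le: "norm ep \<le> Y + \<tau> * Vn"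
      using norm_triangle_ineq[of y "\<tau> *\<^sub>R vb"] \<tau>0 by (simp add: ep_def Y_def Vn_def)
    have et_le: "norm (\<iota> et) \<le> U + \<tau> * Q"
    proof -
      have "\<iota> et = \<iota> u + \<tau> *\<^sub>R \<iota> d" by (simp add: et_def blinfun.add_right blinfun.scaleR_right)
      then show ?thesis using norm_triangle_ineq[of "\<iota> u" "\<tau> *\<^sub>R \<iota> d"] \<tau>0 by (simp add: U_def Q_def)
    qed
    have sq_le: "(a + \<tau> * b)\<^sup>2 \<le> 2 * a\<^sup>2 + 2 * (\<tau>\<^sup>2 * b\<^sup>2)" for a b :: real
      using zero_le_power2[of "a - \<tau> * b"] by (simp add: power2_eq_square algebra_simps)
    have pr_le: "(a + \<tau> * b) * (a' + \<tau> * b') \<le> a\<^sup>2 + a'\<^sup>2 + \<tau>\<^sup>2 * (b\<^sup>2 + b'\<^sup>2)" for a b a' b' :: real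
      using sum_mult_le_squares[of a "\<tau> * b" a' "\<tau> * b'"] by (simp add: power_mult_distrib algebra_simps)
    \<comment> \<open>The loss of twice the squared H norm of \<open>ev\<close> stems from the
      coercivity of \<open>A2s\<close> only up to the H norm of \<open>vb\<close>, which is split as
      \<open>ev + v\<close>: the error part returns to the energy, the rest joins the
      defect.\<close>
    have R_ge: "m * S - C1 * k - 2 * (norm (\<iota> ev))\<^sup>2 \<le> R"
    proof -
      have r1: "cL / 2 * Zn\<^sup>2 - c1 * (norm c)\<^sup>2 \<le> L (\<iota> Z - c) \<bullet> \<iota> Z"
      proof -
        have "L (\<iota> Z - c) \<bullet> \<iota> Z = L (\<iota> Z) \<bullet> \<iota> Z - L c \<bullet> \<iota> Z"
          using L_bounded by (simp add: bounded_linear.linear linear_diff inner_diff_left)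
        moreover have "L c \<bullet> \<iota> Z \<le> Zn * (norm c * l)"
          using norm_cauchy_schwarz[of "L c" "\<iota> Z"] mult_right_mono[OF l(2)[of c], of Zn] nonneg
          by (simp add: Zn_def mult.commute)
        moreover have "Zn * (norm c * l) \<le> cL / 2 * Zn\<^sup>2 + (norm c * l)\<^sup>2 / (2 * cL)"
          by (rule young[OF cL(1)])
        moreover have "(norm c * l)\<^sup>2 / (2 * cL) = c1 * (norm c)\<^sup>2"
          by (simp add: c1_def power_mult_distrib)
        moreover have "cL * Zn\<^sup>2 \<le> L (\<iota> Z) \<bullet> \<iota> Z" using cL(2) by (simp add: Zn_def)
        ultimately show ?thesis by simp
      qed
      have r2: "\<omega>2 / 2 * Vn\<^sup>2 - 2 * (norm (\<iota> ev))\<^sup>2 - c2 * (norm v)\<^sup>2 \<le> A2s vb ev"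
      proof -
        have "A2s vb ev = A2s vb vb - A2s vb v" by (simp add: ev_def blinfun.diff_right)
        moreover have "\<omega>2 * Vn\<^sup>2 \<le> A2s vb vb + (norm (\<iota> vb))\<^sup>2" using \<omega>2(2) by (simp add: Vn_def)
        moreover have "A2s vb v \<le> Vn * (norm A2s * norm v)"
          using form_bound[of A2s vb v] by (simp add: Vn_def mult.commute mult.left_commute)
        moreover have "Vn * (norm A2s * norm v) \<le> \<omega>2 / 2 * Vn\<^sup>2 + (norm A2s * norm v)\<^sup>2 / (2 * \<omega>2)"
          by (rule young[OF \<omega>2(1)])
        moreover have "(norm A2s * norm v)\<^sup>2 / (2 * \<omega>2) = (norm A2s)\<^sup>2 / (2 * \<omega>2) * (norm v)\<^sup>2"
          by (simp add: power_mult_distrib)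
        moreover have "(norm (\<iota> vb))\<^sup>2 \<le> 2 * (norm (\<iota> ev))\<^sup>2 + 2 * (\<kappa>\<^sup>2 * (norm v)\<^sup>2)"
        proof -
          have "vb = ev + v" by (simp add: ev_def)
          then have "norm (\<iota> vb) \<le> norm (\<iota> ev) + norm (\<iota> v)"
            by (metis blinfun.add_right norm_triangle_ineq)
          also have "\<dots> \<le> norm (\<iota> ev) + \<kappa> * norm v" using \<kappa>(2)[of v] by simp
          finally have "(norm (\<iota> vb))\<^sup>2 \<le> (norm (\<iota> ev) + \<kappa> * norm v)\<^sup>2" by (intro power_mono) auto
          also have "\<dots> \<le> 2 * (norm (\<iota> ev))\<^sup>2 + 2 * (\<kappa>\<^sup>2 * (norm v)\<^sup>2)"
            using zero_le_power2[of "norm (\<iota> ev) - \<kappa> * norm v"] by (simp add: power2_eq_square algebra_simps)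
          finally show ?thesis .
        qed
        ultimately show ?thesis unfolding c2_def distrib_right by linarith
      qed
      have r3: "1 / 2 * Q\<^sup>2 - \<kappa>\<^sup>2 / 2 * (norm q)\<^sup>2 \<le> \<iota> d \<bullet> \<iota> (d - q)"
      proof -
        have "\<iota> d \<bullet> \<iota> (d - q) = Q\<^sup>2 - \<iota> d \<bullet> \<iota> q"
          by (simp add: blinfun.diff_right inner_diff_right Q_def power2_norm_eq_inner)
        moreover have "\<iota> d \<bullet> \<iota> q \<le> Q * (\<kappa> * norm q)"
          using norm_cauchy_schwarz[of "\<iota> d" "\<iota> q"] mult_left_mono[OF \<kappa>(2)[of q], of Q] nonneg
          by (simp add: Q_def)
        moreover have "Q * (\<kappa> * norm q) \<le> 1 / 2 * Q\<^sup>2 + (\<kappa> * norm q)\<^sup>2 / (2 * 1)"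
          by (rule young) simp
        ultimately show ?thesis by (simp add: power_mult_distrib)
      qed
      \<comment> \<open>\<open>B2s\<close> is only nonnegative, so there is no square of
        \<open>d\<close> to absorb into. Completing the square at
        \<open>d - (1/2) *\<^sub>R q\<close> leaves a quarter of the form at q.\<close>
      have r4: "- (norm B2s / (4 * \<eta>)) * (norm q)\<^sup>2 \<le> B2s d (d - q) / \<eta>"
      proof -
        have "0 \<le> B2s (d - (1/2) *\<^sub>R q) (d - (1/2) *\<^sub>R q)" by (rule form_nonneg(4))
        also have "\<dots> = B2s d (d - q) + B2s q q / 4"
          using form_sym(4)[of q d]
          by (simp add: blinfun.diff_right blinfun.diff_left blinfun.scaleR_left blinfun.scaleR_right field_simps)
        finally have "- (norm B2s * (norm q)\<^sup>2 / 4) \<le> B2s d (d - q)"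
          using form_bound[of B2s q q] by (simp add: power2_eq_square)
        then have "- (norm B2s * (norm q)\<^sup>2 / 4) / \<eta> \<le> B2s d (d - q) / \<eta>"
          using \<eta>_pos by (intro divide_right_mono) auto
        then show ?thesis using \<eta>_pos by (simp add: mult.commute)
      qed
      have s1: "m * S \<le> cL / 2 * Zn\<^sup>2 + \<omega>2 / 2 * Vn\<^sup>2 + 1 / 2 * Q\<^sup>2"
        unfolding S_def distrib_left using m by (intro add_mono mult_right_mono) auto
      have "c1 * (norm c)\<^sup>2 + c2 * (norm v)\<^sup>2 + c3 * (norm q)\<^sup>2 \<le> C1 * (norm c)\<^sup>2 + C1 * (norm v)\<^sup>2 + C1 * (norm q)\<^sup>2"
        using c123 by (intro add_mono mult_right_mono) (auto simp: C1_def)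
      then have s2: "c1 * (norm c)\<^sup>2 + c2 * (norm v)\<^sup>2 + (\<kappa>\<^sup>2 / 2 * (norm q)\<^sup>2 + norm B2s / (4 * \<eta>) * (norm q)\<^sup>2) \<le> C1 * k"
        by (simp add: k_def c3_def algebra_simps)
      have r4': "- (norm B2s / (4 * \<eta>) * (norm q)\<^sup>2) \<le> B2s d (d - q) / \<eta>" using r4 by simp
      show ?thesis
        using r1 r2 r3 r4' s1 s2 unfolding R_def by linarith
    qed
    have t1: "- (N \<bullet> \<iota> ev) \<le> K * (Y\<^sup>2 + X\<^sup>2 + \<tau>\<^sup>2 * S)"
    proof -
      have "- (N \<bullet> \<iota> ev) \<le> norm N * norm (\<iota> ev)" using Cauchy_Schwarz_ineq2[of N "\<iota> ev"] by linarith
      also have "\<dots> \<le> (K * (Y + \<tau> * Vn)) * (X + \<tau> * Zn)"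
      proof (intro mult_mono ev_le)
        have "K * norm ep \<le> K * (Y + \<tau> * Vn)" using K ep_le by (rule mult_left_mono[rotated])
        then show "norm N \<le> K * (Y + \<tau> * Vn)" using N by (simp add: ep_def)
      qed (use K \<tau>0 nonneg in auto)
      also have "\<dots> = K * ((Y + \<tau> * Vn) * (X + \<tau> * Zn))" by simp
      also have "\<dots> \<le> K * (Y\<^sup>2 + X\<^sup>2 + \<tau>\<^sup>2 * (Vn\<^sup>2 + Zn\<^sup>2))" using K by (intro mult_left_mono pr_le)
      also have "\<dots> \<le> K * (Y\<^sup>2 + X\<^sup>2 + \<tau>\<^sup>2 * S)" using K by (intro mult_left_mono add_left_mono) (auto simp: S_def)
      finally show ?thesis .
    qed
    have t2: "\<iota> y \<bullet> \<iota> ev \<le> \<kappa> * (Y\<^sup>2 + X\<^sup>2 + \<tau>\<^sup>2 * S)"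
    proof -
      have "\<iota> y \<bullet> \<iota> ev \<le> norm (\<iota> y) * norm (\<iota> ev)" by (rule norm_cauchy_schwarz)
      also have "\<dots> \<le> (\<kappa> * Y) * (X + \<tau> * Zn)"
        using \<kappa> nonneg by (intro mult_mono ev_le) (auto simp: Y_def)
      also have "\<dots> = \<kappa> * ((Y + \<tau> * 0) * (X + \<tau> * Zn))" by simp
      also have "\<dots> \<le> \<kappa> * (Y\<^sup>2 + X\<^sup>2 + \<tau>\<^sup>2 * (0\<^sup>2 + Zn\<^sup>2))" using \<kappa> by (intro mult_left_mono pr_le)
      also have "\<dots> \<le> \<kappa> * (Y\<^sup>2 + X\<^sup>2 + \<tau>\<^sup>2 * S)"
        using \<kappa> by (intro mult_left_mono add_left_mono) (auto simp: S_def)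
      finally show ?thesis .
    qed
    have t3: "- (\<eta> * (\<iota> et \<bullet> \<iota> ev)) \<le> \<eta> * (U\<^sup>2 + X\<^sup>2 + \<tau>\<^sup>2 * S)"
    proof -
      have "- (\<iota> et \<bullet> \<iota> ev) \<le> norm (\<iota> et) * norm (\<iota> ev)"
        using Cauchy_Schwarz_ineq2[of "\<iota> et" "\<iota> ev"] by linarith
      also have "\<dots> \<le> (U + \<tau> * Q) * (X + \<tau> * Zn)"
        using \<tau>0 nonneg by (intro mult_mono ev_le et_le) auto
      also have "\<dots> \<le> U\<^sup>2 + X\<^sup>2 + \<tau>\<^sup>2 * (Q\<^sup>2 + Zn\<^sup>2)" by (rule pr_le)
      also have "\<dots> \<le> U\<^sup>2 + X\<^sup>2 + \<tau>\<^sup>2 * S"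
        by (intro add_left_mono mult_left_mono) (auto simp: S_def)
      finally have "\<eta> * - (\<iota> et \<bullet> \<iota> ev) \<le> \<eta> * (U\<^sup>2 + X\<^sup>2 + \<tau>\<^sup>2 * S)"
        using \<eta>_pos by (intro mult_left_mono) auto
      then show ?thesis by simp
    qed
    have t4: "(norm (\<iota> et))\<^sup>2 \<le> 2 * U\<^sup>2 + 2 * (\<tau>\<^sup>2 * S)"
    proof -
      have "(norm (\<iota> et))\<^sup>2 \<le> (U + \<tau> * Q)\<^sup>2" by (intro power_mono et_le) simp
      also have "\<dots> \<le> 2 * U\<^sup>2 + 2 * (\<tau>\<^sup>2 * Q\<^sup>2)" by (rule sq_le)
      also have "\<dots> \<le> 2 * U\<^sup>2 + 2 * (\<tau>\<^sup>2 * S)"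
        by (intro add_left_mono mult_left_mono) (auto simp: S_def)
      finally show ?thesis .
    qed
    have t5: "\<tau> * (2 * (norm (\<iota> ev))\<^sup>2) \<le> 4 * X\<^sup>2 + 4 * (\<tau>\<^sup>2 * S)"
    proof -
      \<comment> \<open>The factor \<tau> may be given up here: \<open>X\<close> belongs to the
        energy, and the square of \<open>Zn\<close> still carries \<tau>^2.\<close>
      have "\<tau> * (2 * (norm (\<iota> ev))\<^sup>2) \<le> 1 * (2 * (norm (\<iota> ev))\<^sup>2)"
        using \<tau> by (intro mult_right_mono) auto
      also have "(norm (\<iota> ev))\<^sup>2 \<le> (X + \<tau> * Zn)\<^sup>2" by (intro power_mono ev_le) simp
      also have "(X + \<tau> * Zn)\<^sup>2 \<le> 2 * X\<^sup>2 + 2 * (\<tau>\<^sup>2 * Zn\<^sup>2)" by (rule sq_le)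
      also have "\<tau>\<^sup>2 * Zn\<^sup>2 \<le> \<tau>\<^sup>2 * S" by (intro mult_left_mono) (auto simp: S_def)
      finally show ?thesis by simp
    qed
    have absorb: "G * (\<tau>\<^sup>2 * S) \<le> \<tau> * (m * S)"
    proof -
      have "G * \<tau> \<le> m" using \<tau> G by (simp add: field_simps)
      then have "(G * \<tau>) * (\<tau> * S) \<le> m * (\<tau> * S)"
        using \<tau>0 by (intro mult_right_mono) (auto simp: S_def)
      then show ?thesis by (simp add: power2_eq_square algebra_simps)
    qed
    have "- (\<tau> * R) \<le> - (\<tau> * (m * S)) + C1 * (\<tau> * k) + \<tau> * (2 * (norm (\<iota> ev))\<^sup>2)"
      using mult_left_mono[OF R_ge \<tau>0] by (simp add: algebra_simps)
    \<comment> \<open>The squared H norm of \<open>et\<close> is added on both sides so that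
      coercivity of \<open>A1s\<close> yields the V norm on the left.\<close>
    then have main: "F + B1 (\<iota> ev) \<bullet> \<iota> ev + (A1s et et + (norm (\<iota> et))\<^sup>2) + BA \<le>
        K * (Y\<^sup>2 + X\<^sup>2 + \<tau>\<^sup>2 * S) + \<kappa> * (Y\<^sup>2 + X\<^sup>2 + \<tau>\<^sup>2 * S) + \<eta> * (U\<^sup>2 + X\<^sup>2 + \<tau>\<^sup>2 * S)
        + (2 * U\<^sup>2 + 4 * X\<^sup>2 + 6 * (\<tau>\<^sup>2 * S)) - \<tau> * (m * S) + C1 * (\<tau> * k)"
      using identity t1 t2 t3 t4 t5 by linarith
    define P where "P = X\<^sup>2 + Y\<^sup>2 + U\<^sup>2"
    have "K * (Y\<^sup>2 + X\<^sup>2 + \<tau>\<^sup>2 * S) + \<kappa> * (Y\<^sup>2 + X\<^sup>2 + \<tau>\<^sup>2 * S) + \<eta> * (U\<^sup>2 + X\<^sup>2 + \<tau>\<^sup>2 * S)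
        + (2 * U\<^sup>2 + 4 * X\<^sup>2 + 6 * (\<tau>\<^sup>2 * S)) \<le>
        K * (P + \<tau>\<^sup>2 * S) + \<kappa> * (P + \<tau>\<^sup>2 * S) + \<eta> * (P + \<tau>\<^sup>2 * S) + 6 * (P + \<tau>\<^sup>2 * S)"
      using K \<kappa>(1) \<eta>_pos by (intro add_mono mult_left_mono) (auto simp: P_def)
    also have "\<dots> = G * P + G * (\<tau>\<^sup>2 * S)" by (simp add: G_def algebra_simps)
    finally have main2: "F + B1 (\<iota> ev) \<bullet> \<iota> ev + \<omega>1 * (norm et)\<^sup>2 + BA \<le> G * P + C1 * (\<tau> * k)"
      using main absorb \<omega>1(2)[of et] by linarith
    define E where "E = L (\<iota> x) \<bullet> \<iota> x + A2s y y + (norm (\<iota> y))\<^sup>2 + (norm (\<iota> u))\<^sup>2 + B2s u u / \<eta>"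
    have pos: "0 \<le> L (\<iota> x) \<bullet> \<iota> x" "0 \<le> A2s y y" "0 \<le> (norm (\<iota> y))\<^sup>2" "0 \<le> (norm (\<iota> u))\<^sup>2"
      "0 \<le> B2s u u / \<eta>"
      using L_nonneg form_nonneg \<eta>_pos by auto
    have "X\<^sup>2 \<le> E / cL"
    proof -
      have "cL * X\<^sup>2 \<le> E" using cL(2)[of "\<iota> x"] pos unfolding X_def E_def by linarith
      then show ?thesis using cL(1) by (simp add: field_simps)
    qed
    moreover have "Y\<^sup>2 \<le> E / \<omega>2"
    proof -
      have "\<omega>2 * Y\<^sup>2 \<le> E" using \<omega>2(2)[of y] pos unfolding Y_def E_def by linarith
      then show ?thesis using \<omega>2(1) by (simp add: field_simps)
    qed
    moreover have "U\<^sup>2 \<le> E" using pos unfolding U_def E_def by linarith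
    ultimately have "P \<le> (1 / cL + 1 / \<omega>2 + 1) * E" by (simp add: P_def algebra_simps)
    then have "G * P \<le> G * (1 / cL + 1 / \<omega>2 + 1) * E"
      using mult_left_mono[of P "(1 / cL + 1 / \<omega>2 + 1) * E" G] G by (simp add: mult.assoc)
    also have "\<dots> \<le> C * E"
      using c123 pos by (intro mult_right_mono) (auto simp: C_def C1_def E_def)
    finally have GP: "G * P \<le> C * E" .
    have "C1 * (\<tau> * k) \<le> C * (\<tau> * k)"
    proof (rule mult_right_mono)
      show "C1 \<le> C" using G cL(1) \<omega>2(1) by (simp add: C_def)
      show "0 \<le> \<tau> * k" using \<tau>0 by (simp add: k_def)
    qed
    with main2 GP have "F + B1 (\<iota> ev) \<bullet> \<iota> ev + \<omega>1 * (norm et)\<^sup>2 + BA \<le> C * E + \<tau> * (C * k)"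
      by (simp add: mult.left_commute)
    then show "L (\<iota> x) \<bullet> (\<iota> Z - c) + A2s y (vb - v) + \<iota> y \<bullet> \<iota> (vb - v) + \<iota> u \<bullet> \<iota> (d - q) + B2s u (d - q) / \<eta>
        + B1 (\<iota> (vb - v)) \<bullet> \<iota> (vb - v) + \<omega>1 * (norm (u + \<tau> *\<^sub>R d))\<^sup>2
        + B2 (\<iota> (u + \<tau> *\<^sub>R d)) \<bullet> A1 (\<iota> (u + \<tau> *\<^sub>R d)) / \<eta>
      \<le> C * (L (\<iota> x) \<bullet> \<iota> x + A2s y y + (norm (\<iota> y))\<^sup>2 + (norm (\<iota> u))\<^sup>2 + B2s u u / \<eta>)
        + \<tau> * (C * ((norm c)\<^sup>2 + (norm v)\<^sup>2 + (norm q)\<^sup>2))"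
      by (simp only: F_def BA_def E_def k_def ev_def ep_def et_def)
  qed
qed

end

section \<open>Error estimate\<close>

context parabolic_hyperbolic_system
begin

text \<open>Problem (P) spreads its regularity over several existential derivatives. Uniqueness of
  the time derivative merges them into one \<open>\<theta>'\<close>, one \<open>\<phi>''\<close> and
  the given v, and the initial values fix the constants of the primitives.\<close>

lemma solution_normal_form:
  assumes sol: "solution_P T \<eta> \<iota> L DA1 A1 DA2 A2 DB1 B1 B2 \<Phi> Lip \<theta>0 \<phi>0 v0 \<theta> \<phi>"
    and v: "has_time_deriv T \<phi> v"
  obtains \<theta>' \<phi>'' where
    "integrable (time_measure T) \<theta>'" "L2_space T \<theta>'"
    "integrable (time_measure T) \<phi>''" "L2_space T \<phi>''"
    "integrable (time_measure T) v" "L2_space T v"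
    "Linf_space T \<theta>" "Linf_space T \<phi>"
    "Linf_space T (\<lambda>t. A1 (\<iota> (\<theta> t)))" "L2_space T (\<lambda>t. B1 (\<iota> (v t)))"
    "AE t in time_measure T. \<theta> t = \<theta>0 + (LINT s|time_measure t. \<theta>' s)"
    "AE t in time_measure T. \<phi> t = \<phi>0 + (LINT s|time_measure t. v s)"
    "AE t in time_measure T. \<iota> (v t) = \<iota> v0 + (LINT s|time_measure t. \<phi>'' s)"
    "AE t in time_measure T. \<iota> (\<theta> t) \<in> DA1"
    "AE t in time_measure T. \<iota> (\<phi> t) \<in> DA2"
    "AE t in time_measure T. \<iota> (v t) \<in> DB1"
    "AE t in time_measure T. \<iota> (\<theta>' t) + \<eta> *\<^sub>R \<iota> (v t) + A1 (\<iota> (\<theta> t)) = 0"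
    "AE t in time_measure T. L (\<phi>'' t) + B1 (\<iota> (v t)) + A2 (\<iota> (\<phi> t)) + \<Phi> (\<iota> (\<phi> t)) + Lip (\<iota> (\<phi> t))
       = B2 (\<iota> (\<theta> t))"
proof -
  obtain \<theta>' \<phi>' \<phi>'' where \<theta>': "has_time_deriv T \<theta> \<theta>'" and \<phi>': "has_time_deriv T \<phi> \<phi>'"
    and \<phi>'': "has_time_deriv T (\<lambda>t. \<iota> (\<phi>' t)) \<phi>''"
    and B1dom: "L2_dom T DB1 B1 (\<lambda>t. \<iota> (\<phi>' t))"
    and eq1: "AE t in time_measure T. \<iota> (\<theta>' t) + \<eta> *\<^sub>R \<iota> (\<phi>' t) + A1 (\<iota> (\<theta> t)) = 0"
    and eq2: "AE t in time_measure T. L (\<phi>'' t) + B1 (\<iota> (\<phi>' t)) + A2 (\<iota> (\<phi> t)) + \<Phi> (\<iota> (\<phi> t))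
        + Lip (\<iota> (\<phi> t)) = B2 (\<iota> (\<theta> t))"
    and init: "has_initial_value T (\<lambda>t. \<iota> (\<theta> t)) (\<iota> \<theta>0)" "has_initial_value T (\<lambda>t. \<iota> (\<phi> t)) (\<iota> \<phi>0)"
      "has_initial_value T (\<lambda>t. \<iota> (\<phi>' t)) (\<iota> v0)"
    using sol unfolding solution_P_def by blast
  have spaces: "H1_space T \<theta>" "Linf_space T \<theta>" "Linf_dom T DA1 A1 (\<lambda>t. \<iota> (\<theta> t))"
    "W2inf_space T (\<lambda>t. \<iota> (\<phi> t))" "W1inf_space T \<phi>" "L2_dom T DA2 A2 (\<lambda>t. \<iota> (\<phi> t))"
    using sol unfolding solution_P_def by blast+
  have vv: "AE t in time_measure T. \<phi>' t = v t"
    by (rule has_time_deriv_unique[OF T_pos \<phi>' v])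
  have \<iota>: "bounded_linear \<iota>" by (rule blinfun.bounded_linear_right)
  show thesis
  proof (rule that[of \<theta>' \<phi>''])
    show "integrable (time_measure T) \<theta>'" "integrable (time_measure T) \<phi>''" "integrable (time_measure T) v"
      using \<theta>' \<phi>'' v by (auto simp: has_time_deriv_def)
    obtain g where g: "has_time_deriv T \<theta> g" "L2_space T g" using spaces(1) by (auto simp: H1_space_def)
    show "L2_space T \<theta>'"
      by (rule L2_space_cong_AE[OF g(2) has_time_deriv_unique[OF T_pos g(1) \<theta>']])
    obtain g where g: "has_time_deriv T \<phi> g" "Linf_space T g" using spaces(5) by (auto simp: W1inf_space_def)
    from Linf_spaceD[OF g(2)] have "L2_space T g" by (auto intro: Linf_imp_L2)
    then show "L2_space T v"
      by (rule L2_space_cong_AE[OF _ has_time_deriv_unique[OF T_pos g(1) v]])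
    obtain g1 where g1: "has_time_deriv T (\<lambda>t. \<iota> (\<phi> t)) g1" "W1inf_space T g1"
      using spaces(4) by (auto simp: W2inf_space_def)
    obtain g2 where g2: "has_time_deriv T g1 g2" "Linf_space T g2"
      using g1(2) by (auto simp: W1inf_space_def)
    \<comment> \<open>The regularity of second order is stated for the H-valued function, so
      \<open>g1\<close> is compared with the image of \<open>\<phi>'\<close> before its derivative
      \<open>g2\<close> can be compared with \<open>\<phi>''\<close>.\<close>
    have "AE t in time_measure T. g1 t = \<iota> (\<phi>' t)"
      by (rule has_time_deriv_unique[OF T_pos g1(1) has_time_deriv_bounded_linear[OF \<phi>' \<iota>]])
    then have "has_time_deriv T (\<lambda>t. \<iota> (\<phi>' t)) g2"
      by (rule has_time_deriv_cong_AE[OF g2(1)])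
    then have eq: "AE t in time_measure T. g2 t = \<phi>'' t"
      by (rule has_time_deriv_unique[OF T_pos _ \<phi>''])
    from Linf_spaceD[OF g2(2)] have "L2_space T g2" by (auto intro: Linf_imp_L2)
    then show "L2_space T \<phi>''" by (rule L2_space_cong_AE[OF _ eq])
    show "Linf_space T \<theta>" by fact
    show "Linf_space T \<phi>" using spaces(5) by (simp add: W1inf_space_def)
    show "Linf_space T (\<lambda>t. A1 (\<iota> (\<theta> t)))" using spaces(3) by (simp add: Linf_dom_def)
    have "L2_space T (\<lambda>t. B1 (\<iota> (\<phi>' t)))" using B1dom by (simp add: L2_dom_def)
    then show "L2_space T (\<lambda>t. B1 (\<iota> (v t)))"
      by (rule L2_space_cong_AE) (use vv in eventually_elim, simp)
    show "AE t in time_measure T. \<theta> t = \<theta>0 + (LINT s|time_measure t. \<theta>' s)"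
      by (rule has_time_deriv_initial_value[OF T_pos \<theta>' \<iota> embed_inj init(1)])
    show "AE t in time_measure T. \<phi> t = \<phi>0 + (LINT s|time_measure t. v s)"
      by (rule has_time_deriv_initial_value[OF T_pos v \<iota> embed_inj init(2)])
    have "AE t in time_measure T. \<iota> (\<phi>' t) = \<iota> v0 + (LINT s|time_measure t. \<phi>'' s)"
      by (rule has_time_deriv_initial_value[OF T_pos \<phi>'' bounded_linear_ident _ init(3)]) simp
    then show "AE t in time_measure T. \<iota> (v t) = \<iota> v0 + (LINT s|time_measure t. \<phi>'' s)"
      using vv by eventually_elim simp
    show "AE t in time_measure T. \<iota> (\<theta> t) \<in> DA1" using spaces(3) by (simp add: Linf_dom_def)
    show "AE t in time_measure T. \<iota> (\<phi> t) \<in> DA2" using spaces(6) by (simp add: L2_dom_def)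
    have "AE t in time_measure T. \<iota> (\<phi>' t) \<in> DB1" using B1dom by (simp add: L2_dom_def)
    then show "AE t in time_measure T. \<iota> (v t) \<in> DB1" using vv by eventually_elim simp
    show "AE t in time_measure T. \<iota> (\<theta>' t) + \<eta> *\<^sub>R \<iota> (v t) + A1 (\<iota> (\<theta> t)) = 0"
      using eq1 vv by eventually_elim simp
    show "AE t in time_measure T. L (\<phi>'' t) + B1 (\<iota> (v t)) + A2 (\<iota> (\<phi> t)) + \<Phi> (\<iota> (\<phi> t)) + Lip (\<iota> (\<phi> t))
       = B2 (\<iota> (\<theta> t))"
      using eq2 vv by eventually_elim simp
  qed
qed

section \<open>Domains of the discrete solution\<close>

lemma subspace_domains: "subspace DA1" "subspace DA2" "subspace DB1" "subspace DB2"
  using A1_op(1) A2_op(1) B1_op(1) B2_op(1) by (auto simp: linear_op_def)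

lemma discrete_solution_domains:
  assumes "discrete_solution \<eta> \<iota> L DA1 A1 DA2 A2 DB1 B1 B2 \<Phi> Lip \<theta>0 \<phi>0 v0 h N \<theta>s \<phi>s vs zs"
    and "n \<le> N"
  shows "\<iota> (\<theta>s n) \<in> DA1" "\<iota> (\<phi>s n) \<in> DB1 \<inter> DA2"
  using assms \<theta>0_dom \<phi>0_dom by (cases n; auto simp: discrete_solution_def)+

text \<open>A difference quotient of elements of the subspace \<open>DB1\<close>; for
  \<open>n = 0\<close> this includes the initial datum.\<close>

lemma discrete_velocity_domain:
  assumes sol: "discrete_solution \<eta> \<iota> L DA1 A1 DA2 A2 DB1 B1 B2 \<Phi> Lip \<theta>0 \<phi>0 v0 h N \<theta>s \<phi>s vs zs"
    and n: "n < N"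
  shows "\<iota> (vs (Suc n)) \<in> DB1"
proof -
  have "vs (Suc n) = diff_quot h \<phi>s n" using assms by (auto simp: discrete_solution_def)
  moreover have "\<iota> (\<phi>s n) \<in> DB1" "\<iota> (\<phi>s (Suc n)) \<in> DB1"
    using discrete_solution_domains(2)[OF sol] n by auto
  ultimately show ?thesis
    using subspace_domains(3)
    by (simp add: diff_quot_def blinfun.scaleR_right blinfun.diff_right subspace_scale subspace_diff)
qed

lemma hat_interp_domain:
  assumes sol: "discrete_solution \<eta> \<iota> L DA1 A1 DA2 A2 DB1 B1 B2 \<Phi> Lip \<theta>0 \<phi>0 v0 h N \<theta>s \<phi>s vs zs"
    and n: "nat \<lfloor>t / h\<rfloor> < N"
  shows "\<iota> (hat_interp h \<theta>s t) \<in> DA1"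
proof -
  have "\<iota> (\<theta>s (nat \<lfloor>t / h\<rfloor>)) \<in> DA1" "\<iota> (\<theta>s (Suc (nat \<lfloor>t / h\<rfloor>))) \<in> DA1"
    using discrete_solution_domains(1)[OF sol] n by auto
  then show ?thesis
    using subspace_domains(1)
    by (simp add: hat_interp_def Let_def diff_quot_def blinfun.add_right blinfun.scaleR_right
        blinfun.diff_right subspace_add subspace_scale subspace_diff)
qed

text \<open>The Lipschitz constant of \<open>\<Phi>\<close> grows with the V norms, so it is uniform
  only on a ball of V. The bounds on the discrete and the continuous \<open>\<phi>\<close> are used
  here.\<close>

lemma nonlinearity_lipschitz:
  assumes "0 \<le> R"
  obtains K where "0 \<le> K"
    "\<And>w z. norm w \<le> R \<Longrightarrow> norm z \<le> R \<Longrightarrow>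
      norm (\<Phi> (\<iota> w) - \<Phi> (\<iota> z) + (Lip (\<iota> w) - Lip (\<iota> z))) \<le> K * norm (w - z)"
proof -
  obtain p q C where pqC: "0 < p" "0 < q" "0 < C"
    and \<Phi>: "\<And>w z. norm (\<Phi> (\<iota> w) - \<Phi> (\<iota> z)) \<le> C * (1 + norm w powr p + norm z powr q) * norm (w - z)"
    using \<Phi>_growth by auto
  obtain CL where CL: "0 < CL" "CL-lipschitz_on UNIV Lip" using Lip_lipschitz by auto
  define K where "K = C * (1 + R powr p + R powr q) + CL * norm \<iota>"
  show thesis
  proof
    show "0 \<le> K" using pqC CL by (simp add: K_def)
    fix w z :: 'v assume wz: "norm w \<le> R" "norm z \<le> R"
    have "C * (1 + norm w powr p + norm z powr q) * norm (w - z) \<le> C * (1 + R powr p + R powr q) * norm (w - z)"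
      using pqC wz by (intro mult_right_mono mult_left_mono add_mono powr_mono2) auto
    then have 1: "norm (\<Phi> (\<iota> w) - \<Phi> (\<iota> z)) \<le> C * (1 + R powr p + R powr q) * norm (w - z)"
      using \<Phi>[of w z] by linarith
    have "norm (Lip (\<iota> w) - Lip (\<iota> z)) \<le> CL * norm (\<iota> w - \<iota> z)"
      using lipschitz_onD[OF CL(2), of "\<iota> w" "\<iota> z"] by (simp add: dist_norm)
    also have "\<dots> \<le> CL * (norm \<iota> * norm (w - z))"
      using CL(1) norm_blinfun[of \<iota> "w - z"] by (simp add: blinfun.diff_right)
    finally have 2: "norm (Lip (\<iota> w) - Lip (\<iota> z)) \<le> CL * norm \<iota> * norm (w - z)" by simp
    show "norm (\<Phi> (\<iota> w) - \<Phi> (\<iota> z) + (Lip (\<iota> w) - Lip (\<iota> z))) \<le> K * norm (w - z)"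
      using norm_triangle_ineq[of "\<Phi> (\<iota> w) - \<Phi> (\<iota> z)" "Lip (\<iota> w) - Lip (\<iota> z)"] 1 2
      by (simp add: K_def distrib_right)
  qed
qed

text \<open>Its arguments are the hatted errors of v, \<open>\<phi>\<close> and
  \<open>\<theta>\<close>, and it controls every supremum norm in the theorem. The weight
  \<open>1 / \<eta>\<close> is forced by the cancellation of the coupling.\<close>

definition energy :: "'v \<Rightarrow> 'v \<Rightarrow> 'v \<Rightarrow> real" where
  "energy x y u = L (\<iota> x) \<bullet> \<iota> x + A2s y y + (norm (\<iota> y))\<^sup>2 + (norm (\<iota> u))\<^sup>2 + B2s u u / \<eta>"

lemma energy_bounds:
  "L (\<iota> x) \<bullet> \<iota> x \<le> energy x y u" "A2s y y + (norm (\<iota> y))\<^sup>2 \<le> energy x y u"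
  "(norm (\<iota> u))\<^sup>2 \<le> energy x y u" "B2s u u \<le> \<eta> * energy x y u"
proof -
  have pos: "0 \<le> L (\<iota> x) \<bullet> \<iota> x" "0 \<le> A2s y y" "0 \<le> (norm (\<iota> y))\<^sup>2" "0 \<le> (norm (\<iota> u))\<^sup>2"
    "0 \<le> B2s u u / \<eta>"
    using L_nonneg form_nonneg \<eta>_pos by auto
  then show "L (\<iota> x) \<bullet> \<iota> x \<le> energy x y u" "A2s y y + (norm (\<iota> y))\<^sup>2 \<le> energy x y u"
    "(norm (\<iota> u))\<^sup>2 \<le> energy x y u"
    unfolding energy_def by linarith+
  have "B2s u u / \<eta> \<le> energy x y u" using pos unfolding energy_def by linarith
  then show "B2s u u \<le> \<eta> * energy x y u" using \<eta>_pos by (simp add: field_simps)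
qed

text \<open>The energy of the hatted errors has a derivative bounded pointwise by itself plus h
  times a function of the continuous solution, while the barred errors sit in the dissipation.
  Gronwall's lemma makes both of order h with one constant.\<close>

lemma error_estimate:
  assumes sol: "solution_P T \<eta> \<iota> L DA1 A1 DA2 A2 DB1 B1 B2 \<Phi> Lip \<theta>0 \<phi>0 v0 \<theta> \<phi>"
    and v: "has_time_deriv T \<phi> v"
  obtains \<kappa> h1 where "0 \<le> \<kappa>" "0 < h1"
    "\<And>N h \<theta>s \<phi>s vs zs. 0 < N \<Longrightarrow> h = T / real N \<Longrightarrow> h \<le> h1 \<Longrightarrow>
      discrete_solution \<eta> \<iota> L DA1 A1 DA2 A2 DB1 B1 B2 \<Phi> Lip \<theta>0 \<phi>0 v0 h N \<theta>s \<phi>s vs zs \<Longrightarrow>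
      (AE t in time_measure T. energy (hat_interp h vs t - v t) (hat_interp h \<phi>s t - \<phi> t)
          (hat_interp h \<theta>s t - \<theta> t) \<le> \<kappa> * h) \<and>
      integrable (time_measure T) (\<lambda>t. B1 (\<iota> (bar_interp h vs t - v t)) \<bullet> \<iota> (bar_interp h vs t - v t)) \<and>
      L2_space T (\<lambda>t. bar_interp h \<theta>s t - \<theta> t) \<and>
      integrable (time_measure T)
        (\<lambda>t. B2 (\<iota> (bar_interp h \<theta>s t - \<theta> t)) \<bullet> A1 (\<iota> (bar_interp h \<theta>s t - \<theta> t))) \<and>
      (LINT t|time_measure T. B1 (\<iota> (bar_interp h vs t - v t)) \<bullet> \<iota> (bar_interp h vs t - v t)) \<le> \<kappa> * h \<and>
      (LINT t|time_measure T. (norm (bar_interp h \<theta>s t - \<theta> t))\<^sup>2) \<le> \<kappa> * h \<and>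
      (LINT t|time_measure T. B2 (\<iota> (bar_interp h \<theta>s t - \<theta> t)) \<bullet> A1 (\<iota> (bar_interp h \<theta>s t - \<theta> t))) \<le> \<kappa> * h"
proof -
  obtain \<theta>' \<phi>'' where
    int1: "integrable (time_measure T) \<theta>'" and L21: "L2_space T \<theta>'"
    and int2: "integrable (time_measure T) \<phi>''" and L22: "L2_space T \<phi>''"
    and int3: "integrable (time_measure T) v" and L23: "L2_space T v"
    and Linf12: "Linf_space T \<theta>" "Linf_space T \<phi>"
    and Linf3: "Linf_space T (\<lambda>t. A1 (\<iota> (\<theta> t)))" and L24: "L2_space T (\<lambda>t. B1 (\<iota> (v t)))"
    and prim: "AE t in time_measure T. \<theta> t = \<theta>0 + (LINT s|time_measure t. \<theta>' s)"
      "AE t in time_measure T. \<phi> t = \<phi>0 + (LINT s|time_measure t. v s)"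
      "AE t in time_measure T. \<iota> (v t) = \<iota> v0 + (LINT s|time_measure t. \<phi>'' s)"
    and dom: "AE t in time_measure T. \<iota> (\<theta> t) \<in> DA1" "AE t in time_measure T. \<iota> (\<phi> t) \<in> DA2"
      "AE t in time_measure T. \<iota> (v t) \<in> DB1"
    and eq1: "AE t in time_measure T. \<iota> (\<theta>' t) + \<eta> *\<^sub>R \<iota> (v t) + A1 (\<iota> (\<theta> t)) = 0"
    and eq2: "AE t in time_measure T. L (\<phi>'' t) + B1 (\<iota> (v t)) + A2 (\<iota> (\<phi> t)) + \<Phi> (\<iota> (\<phi> t))
        + Lip (\<iota> (\<phi> t)) = B2 (\<iota> (\<theta> t))"
    by (rule solution_normal_form[OF sol v])
  note int = int1 int2 int3 and L2 = L21 L22 L23 L24 and Linf = Linf12 Linf3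
  obtain R1 h2 where R1: "0 \<le> R1" "0 < h2"
    "\<And>N h \<theta>s \<phi>s vs zs n. 0 < N \<Longrightarrow> h = T / real N \<Longrightarrow> h \<le> h2 \<Longrightarrow>
      discrete_solution \<eta> \<iota> L DA1 A1 DA2 A2 DB1 B1 B2 \<Phi> Lip \<theta>0 \<phi>0 v0 h N \<theta>s \<phi>s vs zs \<Longrightarrow>
      n \<le> N \<Longrightarrow> norm (\<phi>s n) \<le> R1"
  proof (rule discrete_bounded)
    fix R h1
    assume a: "0 \<le> R" "0 < h1" "\<And>N h \<theta>s \<phi>s vs zs n. 0 < N \<Longrightarrow> h = T / real N \<Longrightarrow> h \<le> h1 \<Longrightarrow>
      discrete_solution \<eta> \<iota> L DA1 A1 DA2 A2 DB1 B1 B2 \<Phi> Lip \<theta>0 \<phi>0 v0 h N \<theta>s \<phi>s vs zs \<Longrightarrow>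
      n \<le> N \<Longrightarrow> norm (\<phi>s n) \<le> R"
    show ?thesis by (rule that, fact a(1), fact a(2), fact a(3))
  qed
  obtain R2 where R2: "0 \<le> R2" "AE t in time_measure T. norm (\<phi> t) \<le> R2"
    using Linf_spaceD(2)[OF Linf(2)] by auto
  \<comment> \<open>Both arguments of the nonlinearity must lie in one ball of V.\<close>
  have "0 \<le> max R1 R2" using R1(1) by simp
  then obtain K where K: "0 \<le> K"
    "\<And>w z. norm w \<le> max R1 R2 \<Longrightarrow> norm z \<le> max R1 R2 \<Longrightarrow>
      norm (\<Phi> (\<iota> w) - \<Phi> (\<iota> z) + (Lip (\<iota> w) - Lip (\<iota> z))) \<le> K * norm (w - z)"
    by (rule nonlinearity_lipschitz) blast
  obtain C h3 \<omega> where C: "0 < C" "0 < h3" "0 < \<omega>"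
    and bound: "\<And>\<tau> x Z y vb v u d q c N. 0 \<le> \<tau> \<Longrightarrow> \<tau> \<le> h3 \<Longrightarrow> vb - v = x + \<tau> *\<^sub>R Z \<Longrightarrow>
      \<iota> (vb - v) \<in> DB1 \<Longrightarrow> \<iota> (y + \<tau> *\<^sub>R vb) \<in> DA2 \<Longrightarrow> \<iota> (u + \<tau> *\<^sub>R d) \<in> DA1 \<Longrightarrow>
      norm N \<le> K * norm (y + \<tau> *\<^sub>R vb) \<Longrightarrow>
      L (\<iota> Z - c) + B1 (\<iota> (vb - v)) + A2 (\<iota> (y + \<tau> *\<^sub>R vb)) + N = B2 (\<iota> (u + \<tau> *\<^sub>R d)) \<Longrightarrow>
      \<iota> (d - q) + \<eta> *\<^sub>R \<iota> (vb - v) + A1 (\<iota> (u + \<tau> *\<^sub>R d)) = 0 \<Longrightarrow>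
      L (\<iota> x) \<bullet> (\<iota> Z - c) + A2s y (vb - v) + \<iota> y \<bullet> \<iota> (vb - v) + \<iota> u \<bullet> \<iota> (d - q) + B2s u (d - q) / \<eta>
        + B1 (\<iota> (vb - v)) \<bullet> \<iota> (vb - v) + \<omega> * (norm (u + \<tau> *\<^sub>R d))\<^sup>2
        + B2 (\<iota> (u + \<tau> *\<^sub>R d)) \<bullet> A1 (\<iota> (u + \<tau> *\<^sub>R d)) / \<eta>
      \<le> C * (L (\<iota> x) \<bullet> \<iota> x + A2s y y + (norm (\<iota> y))\<^sup>2 + (norm (\<iota> u))\<^sup>2 + B2s u u / \<eta>)
        + \<tau> * (C * ((norm c)\<^sup>2 + (norm v)\<^sup>2 + (norm q)\<^sup>2))"
  proof (rule energy_derivative_bound[OF K(1)])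
    fix C h1 \<omega> :: real
    assume a: "0 < C" "0 < h1" "0 < \<omega>"
    "\<And>\<tau> x Z y vb v u d q c N. 0 \<le> \<tau> \<Longrightarrow> \<tau> \<le> h1 \<Longrightarrow> vb - v = x + \<tau> *\<^sub>R Z \<Longrightarrow>
      \<iota> (vb - v) \<in> DB1 \<Longrightarrow> \<iota> (y + \<tau> *\<^sub>R vb) \<in> DA2 \<Longrightarrow> \<iota> (u + \<tau> *\<^sub>R d) \<in> DA1 \<Longrightarrow>
      norm N \<le> K * norm (y + \<tau> *\<^sub>R vb) \<Longrightarrow>
      L (\<iota> Z - c) + B1 (\<iota> (vb - v)) + A2 (\<iota> (y + \<tau> *\<^sub>R vb)) + N = B2 (\<iota> (u + \<tau> *\<^sub>R d)) \<Longrightarrow>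
      \<iota> (d - q) + \<eta> *\<^sub>R \<iota> (vb - v) + A1 (\<iota> (u + \<tau> *\<^sub>R d)) = 0 \<Longrightarrow>
      L (\<iota> x) \<bullet> (\<iota> Z - c) + A2s y (vb - v) + \<iota> y \<bullet> \<iota> (vb - v) + \<iota> u \<bullet> \<iota> (d - q) + B2s u (d - q) / \<eta>
        + B1 (\<iota> (vb - v)) \<bullet> \<iota> (vb - v) + \<omega> * (norm (u + \<tau> *\<^sub>R d))\<^sup>2
        + B2 (\<iota> (u + \<tau> *\<^sub>R d)) \<bullet> A1 (\<iota> (u + \<tau> *\<^sub>R d)) / \<eta>
      \<le> C * (L (\<iota> x) \<bullet> \<iota> x + A2s y y + (norm (\<iota> y))\<^sup>2 + (norm (\<iota> u))\<^sup>2 + B2s u u / \<eta>)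
        + \<tau> * (C * ((norm c)\<^sup>2 + (norm v)\<^sup>2 + (norm q)\<^sup>2))"
    show ?thesis by (rule that, fact a(1), fact a(2), fact a(3), fact a(4))
  qed
  \<comment> \<open>The defect per unit of \<tau>, built from the continuous solution alone. The 2
    matches the derivative of the energy, which is twice \<open>F\<close>.\<close>
  define k0 where "k0 t = 2 * (C * ((norm (\<phi>'' t))\<^sup>2 + (norm (v t))\<^sup>2 + (norm (\<theta>' t))\<^sup>2))" for t
  have k0: "integrable (time_measure T) k0" "\<And>t. 0 \<le> k0 t"
    using L2 C(1) unfolding k0_def L2_space_def by auto
  define k1 where "k1 = (LINT t|time_measure T. k0 t)"
  have k1: "0 \<le> k1" unfolding k1_def using k0(2) by simp
  define \<kappa>1 where "\<kappa>1 = k1 * exp (2 * C * T)"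
  define \<kappa>2 where "\<kappa>2 = k1 * (1 + 2 * C * T * exp (2 * C * T))"
  have \<kappa>2: "0 \<le> \<kappa>2" using k1 C T_pos by (simp add: \<kappa>2_def)
  \<comment> \<open>\<open>\<kappa>1\<close> bounds the energy and \<open>\<kappa>2\<close> the
    dissipation; \<open>\<kappa>2 / \<omega>\<close> and \<open>\<eta> * \<kappa>2\<close> undo the
    weights of two terms in the dissipation. A sum of nonnegative terms dominates each of
    them.\<close>
  define \<kappa> where "\<kappa> = \<kappa>1 + \<kappa>2 + \<kappa>2 / \<omega> + \<eta> * \<kappa>2"
  have \<kappa>1: "0 \<le> \<kappa>1" using k1 by (simp add: \<kappa>1_def)
  have \<kappa>: "0 \<le> \<kappa>" "\<kappa>1 \<le> \<kappa>" "\<kappa>2 \<le> \<kappa>" "\<kappa>2 / \<omega> \<le> \<kappa>" "\<eta> * \<kappa>2 \<le> \<kappa>"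
    using \<kappa>1 \<kappa>2 C(3) \<eta>_pos by (auto simp: \<kappa>_def)
  show thesis
  proof (rule that[of \<kappa> "min h2 h3"])
    show "0 \<le> \<kappa>" by fact
    show "0 < min h2 h3" using R1 C by simp
    fix N h \<theta>s \<phi>s vs zs
    assume N: "0 < N" and h: "h = T / real N" and hle: "h \<le> min h2 h3"
      and disc: "discrete_solution \<eta> \<iota> L DA1 A1 DA2 A2 DB1 B1 B2 \<Phi> Lip \<theta>0 \<phi>0 v0 h N \<theta>s \<phi>s vs zs"
    have hpos: "0 < h" using h N T_pos by simp
    have start: "\<theta>s 0 = \<theta>0" "\<phi>s 0 = \<phi>0" "vs 0 = v0" using disc by (auto simp: discrete_solution_def)
    have index: "nat \<lfloor>t / h\<rfloor> < N" "real (nat \<lfloor>t / h\<rfloor>) * h \<le> t" "t \<le> real (Suc (nat \<lfloor>t / h\<rfloor>)) * h"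
      if "t \<in> {0<..<T}" for t
    proof -
      have "t / h < real N" "0 \<le> t / h" using that hpos N by (auto simp: h field_simps)
      then show "nat \<lfloor>t / h\<rfloor> < N" by linarith
      have "real (nat \<lfloor>t / h\<rfloor>) \<le> t / h" "t / h \<le> real (Suc (nat \<lfloor>t / h\<rfloor>))"
        using \<open>0 \<le> t / h\<close> by linarith+
      then show "real (nat \<lfloor>t / h\<rfloor>) * h \<le> t" "t \<le> real (Suc (nat \<lfloor>t / h\<rfloor>)) * h"
        using hpos by (auto simp: field_simps)
    qed
    define dv where "dv t = diff_quot h vs (nat \<lfloor>t / h\<rfloor>)" for t
    define dp where "dp t = diff_quot h \<phi>s (nat \<lfloor>t / h\<rfloor>)" for t
    define dt where "dt t = diff_quot h \<theta>s (nat \<lfloor>t / h\<rfloor>)" for t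
    have d_int: "integrable (time_measure T) dv" "integrable (time_measure T) dp" "integrable (time_measure T) dt"
      unfolding dv_def[abs_def] dp_def[abs_def] dt_def[abs_def] by (intro interp_integrable hpos)+
    have \<iota>: "bounded_linear \<iota>" by (rule blinfun.bounded_linear_right)
    define g1 where "g1 t = \<iota> (dv t) - \<phi>'' t" for t
    define g2 where "g2 t = dp t - v t" for t
    define g3 where "g3 t = dt t - \<theta>' t" for t
    have g_int: "integrable (time_measure T) g1" "integrable (time_measure T) g2" "integrable (time_measure T) g3"
      unfolding g1_def[abs_def] g2_def[abs_def] g3_def[abs_def]
      using d_int int integrable_bounded_linear[OF \<iota> d_int(1)] by auto
    have ig_int: "integrable (time_measure T) (\<lambda>t. \<iota> (g2 t))" "integrable (time_measure T) (\<lambda>t. \<iota> (g3 t))"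
      using g_int by (auto intro: integrable_bounded_linear[OF \<iota>])
    \<comment> \<open>Continuous representatives of the hatted errors, starting at 0 because the
      initial data agree. \<open>w1\<close> takes values in H, where alone v has a derivative;
      \<open>w2\<close> and \<open>w3\<close> take values in V.\<close>
    define w1 where "w1 t = (LINT s|time_measure t. g1 s)" for t
    define w2 where "w2 t = (LINT s|time_measure t. g2 s)" for t
    define w3 where "w3 t = (LINT s|time_measure t. g3 s)" for t
    have w_cont: "continuous_on {0..T} w1" "continuous_on {0..T} w2" "continuous_on {0..T} w3"
      unfolding w1_def[abs_def] w2_def[abs_def] w3_def[abs_def] by (intro primitive_continuous g_int)+
    have iw: "\<iota> (w2 t) = (LINT s|time_measure t. \<iota> (g2 s))" "\<iota> (w3 t) = (LINT s|time_measure t. \<iota> (g3 s))"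
      if "t \<in> {0..T}" for t
      unfolding w2_def w3_def using that
      by (intro integral_bounded_linear[OF \<iota>, symmetric] time_integrable_mono[OF g_int(2)]
          time_integrable_mono[OF g_int(3)]; simp)+
    have w_eq: "AE t in time_measure T. w1 t = \<iota> (hat_interp h vs t - v t) \<and> w2 t = hat_interp h \<phi>s t - \<phi> t
        \<and> w3 t = hat_interp h \<theta>s t - \<theta> t"
      using prim AE_time_measure_in
    proof eventually_elim
      case (elim t)
      then have t: "0 \<le> t" "t \<le> T" by auto
      have "w1 t = \<iota> (LINT s|time_measure t. dv s) - (LINT s|time_measure t. \<phi>'' s)"
        unfolding w1_def g1_def
        using integral_bounded_linear[OF \<iota> time_integrable_mono[OF d_int(1) t(2)]]
          integrable_bounded_linear[OF \<iota> time_integrable_mono[OF d_int(1) t(2)]]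
          time_integrable_mono[OF int(2) t(2)] by simp
      moreover have "w2 t = (LINT s|time_measure t. dp s) - (LINT s|time_measure t. v s)"
        unfolding w2_def g2_def
        using time_integrable_mono[OF d_int(2) t(2)] time_integrable_mono[OF int(3) t(2)] by simp
      moreover have "w3 t = (LINT s|time_measure t. dt s) - (LINT s|time_measure t. \<theta>' s)"
        unfolding w3_def g3_def
        using time_integrable_mono[OF d_int(3) t(2)] time_integrable_mono[OF int(1) t(2)] by simp
      moreover have "(LINT s|time_measure t. dv s) = hat_interp h vs t - v0"
        "(LINT s|time_measure t. dp s) = hat_interp h \<phi>s t - \<phi>0"
        "(LINT s|time_measure t. dt s) = hat_interp h \<theta>s t - \<theta>0"
        unfolding dv_def dp_def dt_def start[symmetric]
        by (rule hat_interp_primitive[OF hpos t(1), symmetric])+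
      ultimately show ?case using elim by (simp add: blinfun.diff_right)
    qed
    let ?L = "form_of L" and ?I = "form_of (\<lambda>x::'h. x)"
    have L_app: "?L x y = L x \<bullet> y" for x y by (rule form_of_apply[OF L_bounded])
    have I_app: "?I x y = x \<bullet> y" for x y by (rule form_of_apply[OF bounded_linear_ident])
    have L_form_sym: "?L x y = ?L y x" for x y by (metis L_app L_sym inner_commute)
    have I_form_sym: "?I x y = ?I y x" for x y by (simp add: I_app inner_commute)
    \<comment> \<open>The energy written with bilinear forms of primitives. Unlike
      \<open>energy\<close>, which is evaluated at functions known almost everywhere, it is
      continuous; \<open>F\<close> is half its derivative.\<close>
    define E where "E t = ?L (w1 t) (w1 t) + A2s (w2 t) (w2 t) + ?I (\<iota> (w2 t)) (\<iota> (w2 t))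
        + ?I (\<iota> (w3 t)) (\<iota> (w3 t)) + B2s (w3 t) (w3 t) / \<eta>" for t
    define F where "F t = ?L (w1 t) (g1 t) + A2s (w2 t) (g2 t) + ?I (\<iota> (w2 t)) (\<iota> (g2 t))
        + ?I (\<iota> (w3 t)) (\<iota> (g3 t)) + B2s (w3 t) (g3 t) / \<eta>" for t
    note energy_L = energy_integrable[OF L_form_sym g_int(1) w1_def] energy_identity[OF L_form_sym g_int(1) w1_def]
      and energy_A = energy_integrable[OF form_sym(2) g_int(2) w2_def] energy_identity[OF form_sym(2) g_int(2) w2_def]
      and energy_B = energy_integrable[OF form_sym(4) g_int(3) w3_def] energy_identity[OF form_sym(4) g_int(3) w3_def]
    have energy_2: "integrable (time_measure T) (\<lambda>t. ?I (\<iota> (w2 t)) (\<iota> (g2 t)))"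
      "?I (\<iota> (w2 t)) (\<iota> (w2 t)) = 2 * (LINT s|time_measure t. ?I (\<iota> (w2 s)) (\<iota> (g2 s)))" if "t \<in> {0..T}" for t
      using energy_integrable[OF I_form_sym ig_int(1), of "\<lambda>t. \<iota> (w2 t)"]
        energy_identity[OF I_form_sym ig_int(1), of "\<lambda>t. \<iota> (w2 t)" t] iw(1) that by auto
    have energy_3: "integrable (time_measure T) (\<lambda>t. ?I (\<iota> (w3 t)) (\<iota> (g3 t)))"
      "?I (\<iota> (w3 t)) (\<iota> (w3 t)) = 2 * (LINT s|time_measure t. ?I (\<iota> (w3 s)) (\<iota> (g3 s)))" if "t \<in> {0..T}" for t
      using energy_integrable[OF I_form_sym ig_int(2), of "\<lambda>t. \<iota> (w3 t)"]
        energy_identity[OF I_form_sym ig_int(2), of "\<lambda>t. \<iota> (w3 t)" t] iw(2) that by auto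
    have F_int: "integrable (time_measure T) F"
      unfolding F_def[abs_def]
      using energy_L(1) energy_A(1) energy_B(1) energy_2(1)[of 0] energy_3(1)[of 0] T_pos by auto
    have E_int: "E t = (LINT s|time_measure t. 2 * F s)" if t: "t \<in> {0..T}" for t
    proof -
      have tT: "t \<le> T" using t by simp
      note i = time_integrable_mono[OF energy_L(1) tT] time_integrable_mono[OF energy_A(1) tT]
        time_integrable_mono[OF energy_2(1)[OF t] tT] time_integrable_mono[OF energy_3(1)[OF t] tT]
        time_integrable_mono[OF energy_B(1) tT]
      have "(LINT s|time_measure t. F s) = (LINT s|time_measure t. ?L (w1 s) (g1 s))
          + (LINT s|time_measure t. A2s (w2 s) (g2 s)) + (LINT s|time_measure t. ?I (\<iota> (w2 s)) (\<iota> (g2 s)))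
          + (LINT s|time_measure t. ?I (\<iota> (w3 s)) (\<iota> (g3 s))) + (LINT s|time_measure t. B2s (w3 s) (g3 s)) / \<eta>"
        unfolding F_def using i by simp
      then show ?thesis
        unfolding E_def energy_L(2)[OF t] energy_A(2)[OF t] energy_B(2)[OF t] energy_2(2)[OF t] energy_3(2)[OF t]
        by (simp add: algebra_simps)
    qed
    have E_cont: "continuous_on {0..T} E"
      unfolding E_def[abs_def] using \<eta>_pos by (intro continuous_intros w_cont) auto
    have E_nonneg: "0 \<le> E t" for t
      unfolding E_def L_app I_app using L_nonneg form_nonneg \<eta>_pos
      by (intro add_nonneg_nonneg) auto
    have E_eq: "AE t in time_measure T. E t = energy (hat_interp h vs t - v t) (hat_interp h \<phi>s t - \<phi> t)
          (hat_interp h \<theta>s t - \<theta> t)"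
      using w_eq
    proof eventually_elim
      case (elim t)
      then show ?case by (simp add: E_def energy_def L_app I_app power2_norm_eq_inner)
    qed
    define ev where "ev t = bar_interp h vs t - v t" for t
    define et where "et t = bar_interp h \<theta>s t - \<theta> t" for t
    have ev_dom: "AE t in time_measure T. \<iota> (bar_interp h vs t) \<in> DB1"
      using AE_time_measure_in
      by eventually_elim (simp add: bar_interp_def discrete_velocity_domain[OF disc index(1)])
    have et_dom: "AE t in time_measure T. \<iota> (bar_interp h \<theta>s t) \<in> DA1"
      using AE_time_measure_in
    proof eventually_elim
      case (elim t)
      then show ?case
        using index(1)[of t] by (auto simp: bar_interp_def intro!: discrete_solution_domains(1)[OF disc])
    qed
    have L2_ev: "L2_space T (\<lambda>t. \<iota> (ev t))" "L2_space T (\<lambda>t. B1 (\<iota> (ev t)))"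
    proof -
      have [measurable]: "v \<in> borel_measurable (time_measure T)" using int(3) by simp
      have "L2_space T (\<lambda>t. \<iota> (v t))"
        unfolding L2_space_def
      proof
        show "(\<lambda>t. \<iota> (v t)) \<in> borel_measurable (time_measure T)"
          using integrable_bounded_linear[OF \<iota> int(3)] by simp
        then have [measurable]: "(\<lambda>t. \<iota> (v t)) \<in> borel_measurable (time_measure T)" .
        show "integrable (time_measure T) (\<lambda>t. (norm (\<iota> (v t)))\<^sup>2)"
        proof (rule Bochner_Integration.integrable_bound)
          show "integrable (time_measure T) (\<lambda>t. (norm \<iota>)\<^sup>2 * (norm (v t))\<^sup>2)"
            using L2(3) by (simp add: L2_space_def)
          show "AE t in time_measure T. norm ((norm (\<iota> (v t)))\<^sup>2) \<le> norm ((norm \<iota>)\<^sup>2 * (norm (v t))\<^sup>2)"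
            by (rule AE_I2) (simp add: power_mult_distrib[symmetric] power_mono norm_blinfun)
        qed measurable
      qed
      then have "L2_space T (\<lambda>t. \<iota> (vs (Suc (nat \<lfloor>t / h\<rfloor>))) - \<iota> (v t))"
        by (intro L2_space_diff interp_L2[where f = "\<lambda>n. \<iota> (vs (Suc n))"] hpos)
      then show "L2_space T (\<lambda>t. \<iota> (ev t))"
        by (simp add: ev_def bar_interp_def blinfun.diff_right)
      have "L2_space T (\<lambda>t. B1 (\<iota> (vs (Suc (nat \<lfloor>t / h\<rfloor>)))) - B1 (\<iota> (v t)))"
        by (intro L2_space_diff interp_L2[where f = "\<lambda>n. B1 (\<iota> (vs (Suc n)))"] hpos L2(4))
      then show "L2_space T (\<lambda>t. B1 (\<iota> (ev t)))"
      proof (rule L2_space_cong_AE)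
        show "AE t in time_measure T. B1 (\<iota> (vs (Suc (nat \<lfloor>t / h\<rfloor>)))) - B1 (\<iota> (v t)) = B1 (\<iota> (ev t))"
          using ev_dom dom(3)
          by eventually_elim (simp add: ev_def bar_interp_def blinfun.diff_right linear_op_diff(2)[OF B1_op(1)])
      qed
    qed
    have D1: "integrable (time_measure T) (\<lambda>t. B1 (\<iota> (ev t)) \<bullet> \<iota> (ev t))"
      by (rule L2_space_inner[OF L2_ev(2) L2_ev(1)])
    have D2: "L2_space T et"
    proof -
      obtain B where "AE t in time_measure T. norm (\<theta> t) \<le> B" using Linf_spaceD(2)[OF Linf(1)] by auto
      then have "L2_space T \<theta>" using Linf_spaceD(1)[OF Linf(1)] by (intro Linf_imp_L2)
      then show ?thesis
        unfolding et_def[abs_def] bar_interp_def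
        by (intro L2_space_diff interp_L2[where f = "\<lambda>n. \<theta>s (Suc n)"] hpos)
    qed
    have et_DA1: "AE t in time_measure T. \<iota> (et t) \<in> DA1"
      using et_dom dom(1)
      by eventually_elim (simp add: et_def blinfun.diff_right linear_op_diff(1)[OF A1_op(1)])
    \<comment> \<open>A solution comes with a bound on \<open>A1\<close> of \<open>\<theta>\<close>
      only; the relative bound of \<open>B2\<close> by \<open>A1\<close> on \<open>DA1\<close>
      supplies the other factor.\<close>
    have D3: "integrable (time_measure T) (\<lambda>t. B2 (\<iota> (et t)) \<bullet> A1 (\<iota> (et t)))"
    proof -
      obtain B1' where B1': "AE t in time_measure T. norm (A1 (\<iota> (\<theta> t))) \<le> B1'"
        using Linf_spaceD(2)[OF Linf(3)] by auto
      obtain B2' where B2': "AE t in time_measure T. norm (\<theta> t) \<le> B2'" using Linf_spaceD(2)[OF Linf(1)] by auto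
      obtain B3 where B3: "0 \<le> B3" "\<And>t. t \<in> {0<..<T} \<Longrightarrow> norm (A1 (\<iota> (\<theta>s (Suc (nat \<lfloor>t / h\<rfloor>))))) \<le> B3"
        using interp_bounded[OF hpos, where f = "\<lambda>n. A1 (\<iota> (\<theta>s (Suc n)))"] by metis
      obtain B4 where B4: "0 \<le> B4" "\<And>t. t \<in> {0<..<T} \<Longrightarrow> norm (\<theta>s (Suc (nat \<lfloor>t / h\<rfloor>))) \<le> B4"
        using interp_bounded[OF hpos, where f = "\<lambda>n. \<theta>s (Suc n)"] by metis
      obtain CB where CB: "0 < CB" "\<And>w. w \<in> DA1 \<Longrightarrow> norm (B2 w) \<le> CB * (norm (A1 w) + norm w)"
        using B2_bound by auto
      have [measurable]: "et \<in> borel_measurable (time_measure T)" using D2 by (simp add: L2_space_def)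
      have "et \<in> borel_measurable (time_measure T) \<Longrightarrow> (\<lambda>t. \<iota> (et t)) \<in> borel_measurable (time_measure T)"
        by (rule borel_measurable_continuous_on[of "\<lambda>x. \<iota> x"]) (intro continuous_intros)
      then have im: "(\<lambda>t. \<iota> (et t)) \<in> borel_measurable (time_measure T)" by simp
      have A1b: "AE t in time_measure T. norm (A1 (\<iota> (et t))) \<le> B3 + B1'"
        using B1' et_dom dom(1) AE_time_measure_in
      proof eventually_elim
        case (elim t)
        have "A1 (\<iota> (et t)) = A1 (\<iota> (bar_interp h \<theta>s t)) - A1 (\<iota> (\<theta> t))"
          using elim by (simp add: et_def blinfun.diff_right linear_op_diff(2)[OF A1_op(1)])
        then show ?case
          using elim B3(2)[OF elim(4)] norm_triangle_ineq4[of "A1 (\<iota> (bar_interp h \<theta>s t))" "A1 (\<iota> (\<theta> t))"]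
          by (simp add: bar_interp_def)
      qed
      have etb: "AE t in time_measure T. norm (\<iota> (et t)) \<le> norm \<iota> * (B4 + B2')"
        using B2' AE_time_measure_in
      proof eventually_elim
        case (elim t)
        have "norm (et t) \<le> B4 + B2'"
          using elim B4(2)[OF elim(2)] norm_triangle_ineq4[of "bar_interp h \<theta>s t" "\<theta> t"]
          by (simp add: bar_interp_def et_def)
        then have "norm \<iota> * norm (et t) \<le> norm \<iota> * (B4 + B2')" by (intro mult_left_mono) auto
        then show ?case using norm_blinfun[of \<iota> "et t"] by linarith
      qed
      have B2b: "AE t in time_measure T. norm (B2 (\<iota> (et t))) \<le> CB * ((B3 + B1') + norm \<iota> * (B4 + B2'))"
        using A1b etb et_DA1
      proof eventually_elim
        case (elim t)
        have "CB * (norm (A1 (\<iota> (et t))) + norm (\<iota> (et t))) \<le> CB * ((B3 + B1') + norm \<iota> * (B4 + B2'))"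
          using elim CB(1) by (intro mult_left_mono add_mono) auto
        then show ?case using CB(2)[OF elim(3)] by linarith
      qed
      have et_DB2: "AE t in time_measure T. \<iota> (et t) \<in> DB2"
        using et_DA1 by eventually_elim (use DA1_DB2 in auto)
      show ?thesis
        by (intro L2_space_inner Linf_imp_L2[OF _ B2b] Linf_imp_L2[OF _ A1b]
            selfadjoint_op_measurable[OF B2_op(3) im et_DB2] selfadjoint_op_measurable[OF A1_op(3) im et_DA1])
    qed
    define D where "D t = 2 * (B1 (\<iota> (ev t)) \<bullet> \<iota> (ev t) + \<omega> * (norm (et t))\<^sup>2 + B2 (\<iota> (et t)) \<bullet> A1 (\<iota> (et t)) / \<eta>)"
      for t
    have D_int: "integrable (time_measure T) D"
      unfolding D_def[abs_def] using D1 D2 D3 by (auto simp: L2_space_def)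
    have nonneg: "AE t in time_measure T. 0 \<le> B1 (\<iota> (ev t)) \<bullet> \<iota> (ev t) \<and> 0 \<le> B2 (\<iota> (et t)) \<bullet> A1 (\<iota> (et t))"
      using ev_dom dom(3) et_DA1
    proof eventually_elim
      case (elim t)
      have "\<iota> (ev t) \<in> DB1"
        using elim by (simp add: ev_def blinfun.diff_right linear_op_diff(1)[OF B1_op(1)])
      then have "0 \<le> B1 (\<iota> (ev t)) \<bullet> \<iota> (ev t)"
        using form_nonneg(3)[of "ev t"] B1s_apply[of "ev t" "ev t"] by simp
      then show ?case using B2_A1_nonneg elim by simp
    qed
    have D_nonneg: "AE t in time_measure T. 0 \<le> D t"
      using nonneg by eventually_elim (use C(3) \<eta>_pos in \<open>simp add: D_def\<close>)
    have D_ge: "AE t in time_measure T. B1 (\<iota> (ev t)) \<bullet> \<iota> (ev t) \<le> D t \<and> \<omega> * (norm (et t))\<^sup>2 \<le> D t \<and>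
        B2 (\<iota> (et t)) \<bullet> A1 (\<iota> (et t)) / \<eta> \<le> D t"
      using nonneg
    proof eventually_elim
      case (elim t)
      have "0 \<le> \<omega> * (norm (et t))\<^sup>2" "0 \<le> B2 (\<iota> (et t)) \<bullet> A1 (\<iota> (et t)) / \<eta>"
        using elim C(3) \<eta>_pos by simp_all
      moreover have "x \<le> 2 * (x + y + z) \<and> y \<le> 2 * (x + y + z) \<and> z \<le> 2 * (x + y + z)"
        if "0 \<le> x" "0 \<le> y" "0 \<le> z" for x y z :: real
        using that by auto
      ultimately show ?case using elim[THEN conjunct1] unfolding D_def by blast
    qed
    \<comment> \<open>The continuous equations at t are subtracted from the discrete ones on the
      cell of t, and the difference enters the pointwise inequality with \<tau> the distance to the
      right end of the cell.\<close>
    have ineq: "AE t in time_measure T. 2 * F t + D t \<le> (2 * C) * E t + h * k0 t"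
      using w_eq R2(2) dom eq1 eq2 AE_time_measure_in
    proof eventually_elim
      case (elim t)
      define n where "n = nat \<lfloor>t / h\<rfloor>"
      define \<tau> where "\<tau> = real (Suc n) * h - t"
      have n: "n < N" and \<tau>: "0 \<le> \<tau>" "\<tau> \<le> h"
        using index[OF elim(8)] by (auto simp: n_def \<tau>_def algebra_simps)
      have w: "w1 t = \<iota> (hat_interp h vs t - v t)" "w2 t = hat_interp h \<phi>s t - \<phi> t" "w3 t = hat_interp h \<theta>s t - \<theta> t"
        using elim(1) by auto
      have bar: "bar_interp h x t = hat_interp h x t + \<tau> *\<^sub>R diff_quot h x n" for x :: "nat \<Rightarrow> 'v"
        using bar_eq_hat[OF hpos, of x t] by (simp add: n_def \<tau>_def)
      have barS: "bar_interp h x t = x (Suc n)" for x :: "nat \<Rightarrow> 'v" by (simp add: bar_interp_def n_def)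
      have d_eq: "dv t = diff_quot h vs n" "dp t = diff_quot h \<phi>s n" "dt t = diff_quot h \<theta>s n"
        by (simp_all add: dv_def dp_def dt_def n_def)
      have zs: "zs (Suc n) = dv t" and vs: "vs (Suc n) = dp t" and tD: "\<iota> (\<theta>s (Suc n)) \<in> DA1"
        and pD: "\<iota> (\<phi>s (Suc n)) \<in> DA2" and vD: "\<iota> (vs (Suc n)) \<in> DB1"
        and deq1: "\<iota> (dt t) + \<eta> *\<^sub>R \<iota> (dp t) + A1 (\<iota> (\<theta>s (Suc n))) = 0"
        and deq2: "L (\<iota> (zs (Suc n))) + B1 (\<iota> (vs (Suc n))) + A2 (\<iota> (\<phi>s (Suc n)))
          + \<Phi> (\<iota> (\<phi>s (Suc n))) + Lip (\<iota> (\<phi>s (Suc n))) = B2 (\<iota> (\<theta>s (Suc n)))"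
        using disc n discrete_velocity_domain[OF disc n] unfolding d_eq by (auto simp: discrete_solution_def)
      have ep: "w2 t + \<tau> *\<^sub>R dp t = \<phi>s (Suc n) - \<phi> t"
        using bar[of \<phi>s] by (simp add: w barS d_eq)
      have ett: "w3 t + \<tau> *\<^sub>R dt t = \<theta>s (Suc n) - \<theta> t"
        using bar[of \<theta>s] by (simp add: w barS d_eq)
      \<comment> \<open>The two lower-order differences are treated as one, in the grouping that
        \<open>nonlinearity_lipschitz\<close> bounds.\<close>
      let ?N = "\<Phi> (\<iota> (\<phi>s (Suc n))) - \<Phi> (\<iota> (\<phi> t)) + (Lip (\<iota> (\<phi>s (Suc n))) - Lip (\<iota> (\<phi> t)))"
      note diff = blinfun.diff_right linear_op_diff[OF A1_op(1)] linear_op_diff[OF A2_op(1)]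
        linear_op_diff[OF B1_op(1)] linear_op_diff[OF B2_op(1)]
      have tDB2: "\<iota> (\<theta>s (Suc n)) \<in> DB2" "\<iota> (\<theta> t) \<in> DB2" using tD elim DA1_DB2 by auto
      have "L (\<iota> (hat_interp h vs t - v t)) \<bullet> (\<iota> (dv t) - \<phi>'' t) + A2s (w2 t) (dp t - v t)
          + \<iota> (w2 t) \<bullet> \<iota> (dp t - v t) + \<iota> (w3 t) \<bullet> \<iota> (dt t - \<theta>' t) + B2s (w3 t) (dt t - \<theta>' t) / \<eta>
          + B1 (\<iota> (dp t - v t)) \<bullet> \<iota> (dp t - v t) + \<omega> * (norm (w3 t + \<tau> *\<^sub>R dt t))\<^sup>2
          + B2 (\<iota> (w3 t + \<tau> *\<^sub>R dt t)) \<bullet> A1 (\<iota> (w3 t + \<tau> *\<^sub>R dt t)) / \<eta>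
        \<le> C * (L (\<iota> (hat_interp h vs t - v t)) \<bullet> \<iota> (hat_interp h vs t - v t) + A2s (w2 t) (w2 t)
            + (norm (\<iota> (w2 t)))\<^sup>2 + (norm (\<iota> (w3 t)))\<^sup>2 + B2s (w3 t) (w3 t) / \<eta>)
          + \<tau> * (C * ((norm (\<phi>'' t))\<^sup>2 + (norm (v t))\<^sup>2 + (norm (\<theta>' t))\<^sup>2))"
      proof (rule bound[where N = ?N])
        show "0 \<le> \<tau>" by fact
        show "\<tau> \<le> h3" using \<tau> hle by simp
        show "dp t - v t = hat_interp h vs t - v t + \<tau> *\<^sub>R dv t"
          using bar[of vs] by (simp add: barS vs d_eq)
        show "\<iota> (dp t - v t) \<in> DB1" using vD elim by (simp add: vs diff)
        show "\<iota> (w2 t + \<tau> *\<^sub>R dp t) \<in> DA2" unfolding ep using pD elim by (simp add: diff)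
        show "\<iota> (w3 t + \<tau> *\<^sub>R dt t) \<in> DA1" unfolding ett using tD elim by (simp add: diff)
        show "norm ?N \<le> K * norm (w2 t + \<tau> *\<^sub>R dp t)"
          unfolding ep
        proof (rule K(2))
          show "norm (\<phi>s (Suc n)) \<le> max R1 R2" using R1(3)[OF N h _ disc, of "Suc n"] hle n by simp
          show "norm (\<phi> t) \<le> max R1 R2" using elim by simp
        qed
        have diffs: "L (\<iota> (dv t) - \<phi>'' t) = L (\<iota> (dv t)) - L (\<phi>'' t)"
          "B1 (\<iota> (dp t - v t)) = B1 (\<iota> (dp t)) - B1 (\<iota> (v t))"
          "A2 (\<iota> (\<phi>s (Suc n) - \<phi> t)) = A2 (\<iota> (\<phi>s (Suc n))) - A2 (\<iota> (\<phi> t))"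
          "B2 (\<iota> (\<theta>s (Suc n) - \<theta> t)) = B2 (\<iota> (\<theta>s (Suc n))) - B2 (\<iota> (\<theta> t))"
          using L_bounded vD pD tDB2 elim(4,5)
          by (simp_all add: bounded_linear.linear linear_diff diff vs)
        show "L (\<iota> (dv t) - \<phi>'' t) + B1 (\<iota> (dp t - v t)) + A2 (\<iota> (w2 t + \<tau> *\<^sub>R dp t)) + ?N
            = B2 (\<iota> (w3 t + \<tau> *\<^sub>R dt t))"
          unfolding ep ett diffs deq2[symmetric] elim(7)[symmetric] zs vs by simp
        show "\<iota> (dt t - \<theta>' t) + \<eta> *\<^sub>R \<iota> (dp t - v t) + A1 (\<iota> (w3 t + \<tau> *\<^sub>R dt t)) = 0"
        proof -
          have "A1 (\<iota> (\<theta>s (Suc n) - \<theta> t)) = A1 (\<iota> (\<theta>s (Suc n))) - A1 (\<iota> (\<theta> t))"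
            using tD elim(3) by (simp add: diff)
          then have "\<iota> (dt t - \<theta>' t) + \<eta> *\<^sub>R \<iota> (dp t - v t) + A1 (\<iota> (\<theta>s (Suc n) - \<theta> t))
              = (\<iota> (dt t) + \<eta> *\<^sub>R \<iota> (dp t) + A1 (\<iota> (\<theta>s (Suc n))))
                - (\<iota> (\<theta>' t) + \<eta> *\<^sub>R \<iota> (v t) + A1 (\<iota> (\<theta> t)))"
            by (simp add: blinfun.diff_right scaleR_diff_right)
          then show ?thesis unfolding ett deq1 elim(6) by simp
        qed
      qed
      note main = this
      have E_t: "C * (L (\<iota> (hat_interp h vs t - v t)) \<bullet> \<iota> (hat_interp h vs t - v t) + A2s (w2 t) (w2 t)
            + (norm (\<iota> (w2 t)))\<^sup>2 + (norm (\<iota> (w3 t)))\<^sup>2 + B2s (w3 t) (w3 t) / \<eta>) = C * E t"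
        by (simp only: E_def L_app I_app w(1) power2_norm_eq_inner)
      have F_t: "F t = L (\<iota> (hat_interp h vs t - v t)) \<bullet> (\<iota> (dv t) - \<phi>'' t) + A2s (w2 t) (dp t - v t)
          + \<iota> (w2 t) \<bullet> \<iota> (dp t - v t) + \<iota> (w3 t) \<bullet> \<iota> (dt t - \<theta>' t) + B2s (w3 t) (dt t - \<theta>' t) / \<eta>"
        by (simp only: F_def L_app I_app w(1) g1_def g2_def g3_def)
      have "ev t = dp t - v t" "et t = w3 t + \<tau> *\<^sub>R dt t"
        by (simp_all add: ev_def et_def barS vs ett)
      then have D_t: "D t = 2 * (B1 (\<iota> (dp t - v t)) \<bullet> \<iota> (dp t - v t) + \<omega> * (norm (w3 t + \<tau> *\<^sub>R dt t))\<^sup>2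
          + B2 (\<iota> (w3 t + \<tau> *\<^sub>R dt t)) \<bullet> A1 (\<iota> (w3 t + \<tau> *\<^sub>R dt t)) / \<eta>)"
        by (simp only: D_def)
      let ?K = "\<tau> * (C * ((norm (\<phi>'' t))\<^sup>2 + (norm (v t))\<^sup>2 + (norm (\<theta>' t))\<^sup>2))"
      have "F t + (B1 (\<iota> (dp t - v t)) \<bullet> \<iota> (dp t - v t) + \<omega> * (norm (w3 t + \<tau> *\<^sub>R dt t))\<^sup>2
          + B2 (\<iota> (w3 t + \<tau> *\<^sub>R dt t)) \<bullet> A1 (\<iota> (w3 t + \<tau> *\<^sub>R dt t)) / \<eta>) \<le> C * E t + ?K"
        using main unfolding F_t E_t by (simp only: add.assoc)
      then have "2 * F t + D t \<le> 2 * (C * E t + ?K)"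
        unfolding D_t distrib_left[symmetric] by (rule mult_left_mono) simp
      also have "\<dots> = (2 * C) * E t + \<tau> * k0 t" by (simp add: k0_def)
      also have "\<dots> \<le> (2 * C) * E t + h * k0 t" by (intro add_left_mono mult_right_mono \<tau>(2) k0(2))
      finally show ?case .
    qed
    have "AE t in time_measure T. 0 \<le> h * k0 t" using hpos k0(2) by simp
    \<comment> \<open>Since the derivative of the energy is twice \<open>F\<close>, the whole
      pointwise inequality is used doubled, which explains \<open>2 * C\<close> and the 2 in
      \<open>D\<close> and \<open>k0\<close>.\<close>
    note gr = energy_gronwall[where C = "2 * C" and E = E and F = "\<lambda>t. 2 * F t" and D = D and k = "\<lambda>t. h * k0 t",
        OF _ _ E_cont E_nonneg _ E_int D_int D_nonneg _ this ineq]
    have k_eq: "(LINT t|time_measure T. h * k0 t) = h * k1" by (simp add: k1_def)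
    have E_le: "E t \<le> \<kappa>1 * h" if "t \<in> {0..T}" for t
    proof -
      have "E t \<le> (LINT t|time_measure T. h * k0 t) * exp (2 * C * T)"
        by (rule gr(1)) (use T_pos C F_int k0 that in auto)
      then show ?thesis unfolding k_eq by (simp add: \<kappa>1_def mult_ac)
    qed
    have D_le: "(LINT t|time_measure T. D t) \<le> \<kappa>2 * h"
    proof -
      have "(LINT t|time_measure T. D t) \<le> (LINT t|time_measure T. h * k0 t) * (1 + 2 * C * T * exp (2 * C * T))"
        by (rule gr(2)) (use T_pos C F_int k0 in auto)
      then show ?thesis unfolding k_eq \<kappa>2_def by (simp only: mult.assoc mult.commute[of h] mult.left_commute[of h])
    qed
    have "AE t in time_measure T. energy (hat_interp h vs t - v t) (hat_interp h \<phi>s t - \<phi> t)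
          (hat_interp h \<theta>s t - \<theta> t) \<le> \<kappa> * h"
      using E_eq AE_time_measure_in
    proof eventually_elim
      case (elim t)
      have "E t \<le> \<kappa>1 * h" using elim by (intro E_le) auto
      also have "\<dots> \<le> \<kappa> * h" using \<kappa> hpos by (intro mult_right_mono) auto
      finally show ?case using elim by simp
    qed
    moreover have "(LINT t|time_measure T. B1 (\<iota> (ev t)) \<bullet> \<iota> (ev t)) \<le> \<kappa> * h"
    proof -
      have "(LINT t|time_measure T. B1 (\<iota> (ev t)) \<bullet> \<iota> (ev t)) \<le> (LINT t|time_measure T. D t)"
        by (rule integral_mono_AE[OF D1 D_int]) (use D_ge in eventually_elim, simp)
      also have "\<dots> \<le> \<kappa> * h" using D_le mult_right_mono[OF \<kappa>(3), of h] hpos by linarith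
      finally show ?thesis .
    qed
    moreover have "(LINT t|time_measure T. (norm (et t))\<^sup>2) \<le> \<kappa> * h"
    proof -
      have i: "integrable (time_measure T) (\<lambda>t. (norm (et t))\<^sup>2)" using D2 by (simp add: L2_space_def)
      have "\<omega> * (LINT t|time_measure T. (norm (et t))\<^sup>2) = (LINT t|time_measure T. \<omega> * (norm (et t))\<^sup>2)" by simp
      also have "\<dots> \<le> (LINT t|time_measure T. D t)"
        by (rule integral_mono_AE[OF _ D_int]) (use i in simp, use D_ge in eventually_elim, simp)
      also have "\<dots> \<le> \<kappa>2 * h" by (rule D_le)
      finally have "(LINT t|time_measure T. (norm (et t))\<^sup>2) \<le> \<kappa>2 / \<omega> * h"
        using C(3) by (simp add: field_simps)
      also have "\<dots> \<le> \<kappa> * h" using \<kappa> hpos by (intro mult_right_mono) auto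
      finally show ?thesis .
    qed
    moreover have "(LINT t|time_measure T. B2 (\<iota> (et t)) \<bullet> A1 (\<iota> (et t))) \<le> \<kappa> * h"
    proof -
      have "(LINT t|time_measure T. B2 (\<iota> (et t)) \<bullet> A1 (\<iota> (et t))) / \<eta>
          = (LINT t|time_measure T. B2 (\<iota> (et t)) \<bullet> A1 (\<iota> (et t)) / \<eta>)" by simp
      also have "\<dots> \<le> (LINT t|time_measure T. D t)"
        by (rule integral_mono_AE[OF _ D_int]) (use D3 in simp, use D_ge in eventually_elim, simp)
      also have "\<dots> \<le> \<kappa>2 * h" by (rule D_le)
      finally have "(LINT t|time_measure T. B2 (\<iota> (et t)) \<bullet> A1 (\<iota> (et t))) \<le> \<eta> * \<kappa>2 * h"
        using \<eta>_pos by (simp add: field_simps)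
      also have "\<dots> \<le> \<kappa> * h" using \<kappa> hpos by (intro mult_right_mono) auto
      finally show ?thesis .
    qed
    ultimately show "(AE t in time_measure T. energy (hat_interp h vs t - v t) (hat_interp h \<phi>s t - \<phi> t)
          (hat_interp h \<theta>s t - \<theta> t) \<le> \<kappa> * h) \<and>
      integrable (time_measure T) (\<lambda>t. B1 (\<iota> (bar_interp h vs t - v t)) \<bullet> \<iota> (bar_interp h vs t - v t)) \<and>
      L2_space T (\<lambda>t. bar_interp h \<theta>s t - \<theta> t) \<and>
      integrable (time_measure T)
        (\<lambda>t. B2 (\<iota> (bar_interp h \<theta>s t - \<theta> t)) \<bullet> A1 (\<iota> (bar_interp h \<theta>s t - \<theta> t))) \<and>
      (LINT t|time_measure T. B1 (\<iota> (bar_interp h vs t - v t)) \<bullet> \<iota> (bar_interp h vs t - v t)) \<le> \<kappa> * h \<and>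
      (LINT t|time_measure T. (norm (bar_interp h \<theta>s t - \<theta> t))\<^sup>2) \<le> \<kappa> * h \<and>
      (LINT t|time_measure T. B2 (\<iota> (bar_interp h \<theta>s t - \<theta> t)) \<bullet> A1 (\<iota> (bar_interp h \<theta>s t - \<theta> t))) \<le> \<kappa> * h"
      using D1 D2 D3 unfolding ev_def et_def[abs_def] by simp
  qed
qed

end

section \<open>From the energy to the norms\<close>

theorem theorem1p3:
  fixes T \<eta> h0 :: real
    and \<iota> :: "'v::{real_inner, banach, second_countable_topology}
              \<Rightarrow>\<^sub>L 'h::{real_inner, banach, second_countable_topology}"
    and \<theta> \<phi> v :: "real \<Rightarrow> 'v"
  assumes standing: "parabolic_hyperbolic_system T \<eta> \<iota> L DA1 A1 A1s DA2 A2 A2s DB1 B1 B1s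
      DB2 B2 B2s D\<Phi> \<Phi> Lip \<theta>0 \<phi>0 v0"
    and sqrt_L: "is_sqrt_op DLh Lh UNIV L"
    and sqrt_B1: "is_sqrt_op DB1h B1h DB1 B1"
    and sqrt_B2: "is_sqrt_op DB2h B2h DB2 B2"
    and h0: "h0 \<in> {0<..<1}"
    and discrete_ex: "\<And>N h. 0 < N \<Longrightarrow> h = T / real N \<Longrightarrow> h \<in> {0<..<h0} \<Longrightarrow>
      \<exists>\<theta>s \<phi>s vs zs. discrete_solution \<eta> \<iota> L DA1 A1 DA2 A2 DB1 B1 B2 \<Phi> Lip \<theta>0 \<phi>0 v0 h N \<theta>s \<phi>s vs zs"
    and discrete_unique: "\<And>N h \<theta>s \<phi>s vs zs \<theta>t \<phi>t vt zt n.
      0 < N \<Longrightarrow> h = T / real N \<Longrightarrow> h \<in> {0<..<h0} \<Longrightarrow>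
      discrete_solution \<eta> \<iota> L DA1 A1 DA2 A2 DB1 B1 B2 \<Phi> Lip \<theta>0 \<phi>0 v0 h N \<theta>s \<phi>s vs zs \<Longrightarrow>
      discrete_solution \<eta> \<iota> L DA1 A1 DA2 A2 DB1 B1 B2 \<Phi> Lip \<theta>0 \<phi>0 v0 h N \<theta>t \<phi>t vt zt \<Longrightarrow>
      n < N \<Longrightarrow> \<theta>s (Suc n) = \<theta>t (Suc n) \<and> \<phi>s (Suc n) = \<phi>t (Suc n)"
    and solution: "solution_P T \<eta> \<iota> L DA1 A1 DA2 A2 DB1 B1 B2 \<Phi> Lip \<theta>0 \<phi>0 v0 \<theta> \<phi>"
    and v_deriv: "has_time_deriv T \<phi> v"
  shows "\<exists>h00 M. h00 \<in> {0<..<h0} \<and> M > 0 \<and>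
    (\<forall>N h \<theta>s \<phi>s vs zs. 0 < N \<longrightarrow> h = T / real N \<longrightarrow> h \<in> {0<..<h00} \<longrightarrow>
      discrete_solution \<eta> \<iota> L DA1 A1 DA2 A2 DB1 B1 B2 \<Phi> Lip \<theta>0 \<phi>0 v0 h N \<theta>s \<phi>s vs zs \<longrightarrow>
      (let e_v = (\<lambda>t. Lh (\<iota> (hat_interp h vs t - v t)));
           e_vB = (\<lambda>t. B1h (\<iota> (bar_interp h vs t - v t)));
           e_\<phi> = (\<lambda>t. hat_interp h \<phi>s t - \<phi> t);
           e_\<theta> = (\<lambda>t. \<iota> (hat_interp h \<theta>s t - \<theta> t));
           e_\<theta>V = (\<lambda>t. bar_interp h \<theta>s t - \<theta> t);
           e_\<theta>B = (\<lambda>t. B2h (\<iota> (hat_interp h \<theta>s t - \<theta> t)));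
           e_BA = (\<lambda>t. B2 (\<iota> (bar_interp h \<theta>s t - \<theta> t)) \<bullet> A1 (\<iota> (bar_interp h \<theta>s t - \<theta> t)))
       in Linf_space T e_v \<and> L2_space T e_vB \<and> Linf_space T e_\<phi> \<and> Linf_space T e_\<theta> \<and>
          L2_space T e_\<theta>V \<and> Linf_space T e_\<theta>B \<and> integrable (time_measure T) e_BA \<and>
          Linf_nrm T e_v + L2_nrm T e_vB + Linf_nrm T e_\<phi> + Linf_nrm T e_\<theta>
          + L2_nrm T e_\<theta>V + Linf_nrm T e_\<theta>B + (LINT t|time_measure T. e_BA t)
            \<le> M * h powr (1/2)))"
proof -
  interpret parabolic_hyperbolic_system T \<eta> \<iota> L DA1 A1 A1s DA2 A2 A2s DB1 B1 B1s
      DB2 B2 B2s D\<Phi> \<Phi> Lip \<theta>0 \<phi>0 v0 by (rule standing)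
  obtain \<omega> where \<omega>: "0 < \<omega>" "\<And>w. \<omega> * (norm w)\<^sup>2 \<le> A2s w w + (norm (\<iota> w))\<^sup>2"
    using A2s_coercive unfolding coercive_up_to_H_def by (metis mult_1 zero_less_one)
  obtain \<theta>' \<phi>'' where vint: "integrable (time_measure T) v"
    and Linf: "Linf_space T \<theta>" "Linf_space T \<phi>"
    and dom: "AE t in time_measure T. \<iota> (\<theta> t) \<in> DA1" "AE t in time_measure T. \<iota> (v t) \<in> DB1"
    by (rule solution_normal_form[OF solution v_deriv])
  show ?thesis
  proof (rule error_estimate[OF solution v_deriv])
    fix \<kappa> h1 :: real
    assume \<kappa>: "0 \<le> \<kappa>" and h1: "0 < h1"
      and est: "\<And>N h \<theta>s \<phi>s vs zs. 0 < N \<Longrightarrow> h = T / real N \<Longrightarrow> h \<le> h1 \<Longrightarrow>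
      discrete_solution \<eta> \<iota> L DA1 A1 DA2 A2 DB1 B1 B2 \<Phi> Lip \<theta>0 \<phi>0 v0 h N \<theta>s \<phi>s vs zs \<Longrightarrow>
      (AE t in time_measure T. energy (hat_interp h vs t - v t) (hat_interp h \<phi>s t - \<phi> t)
          (hat_interp h \<theta>s t - \<theta> t) \<le> \<kappa> * h) \<and>
      integrable (time_measure T) (\<lambda>t. B1 (\<iota> (bar_interp h vs t - v t)) \<bullet> \<iota> (bar_interp h vs t - v t)) \<and>
      L2_space T (\<lambda>t. bar_interp h \<theta>s t - \<theta> t) \<and>
      integrable (time_measure T)
        (\<lambda>t. B2 (\<iota> (bar_interp h \<theta>s t - \<theta> t)) \<bullet> A1 (\<iota> (bar_interp h \<theta>s t - \<theta> t))) \<and>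
      (LINT t|time_measure T. B1 (\<iota> (bar_interp h vs t - v t)) \<bullet> \<iota> (bar_interp h vs t - v t)) \<le> \<kappa> * h \<and>
      (LINT t|time_measure T. (norm (bar_interp h \<theta>s t - \<theta> t))\<^sup>2) \<le> \<kappa> * h \<and>
      (LINT t|time_measure T. B2 (\<iota> (bar_interp h \<theta>s t - \<theta> t)) \<bullet> A1 (\<iota> (bar_interp h \<theta>s t - \<theta> t))) \<le> \<kappa> * h"
    \<comment> \<open>One summand for each term of the estimate, in the same order: square roots for
      the six norms, \<kappa> itself for the integral. The final 1 keeps \<open>M\<close> positive
      when \<kappa> is 0.\<close>
    define M where "M = sqrt \<kappa> + sqrt \<kappa> + sqrt (\<kappa> / \<omega>) + sqrt \<kappa> + sqrt \<kappa> + sqrt (\<eta> * \<kappa>) + \<kappa> + 1"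
    \<comment> \<open>Halving \<open>h0\<close> makes \<open>h00\<close> strictly smaller, and
      \<open>h0 < 1\<close> gives the \<open>h \<le> 1\<close> used for the last integral.\<close>
    define h00 where "h00 = min (h0 / 2) h1"
    have "h00 \<in> {0<..<h0}" using h0 h1 by (auto simp: h00_def)
    moreover have "M > 0" using \<kappa> \<omega>(1) \<eta>_pos by (simp add: M_def add_nonneg_pos)
    moreover have "Linf_space T (\<lambda>t. Lh (\<iota> (hat_interp h vs t - v t))) \<and>
        L2_space T (\<lambda>t. B1h (\<iota> (bar_interp h vs t - v t))) \<and>
        Linf_space T (\<lambda>t. hat_interp h \<phi>s t - \<phi> t) \<and>
        Linf_space T (\<lambda>t. \<iota> (hat_interp h \<theta>s t - \<theta> t)) \<and>
        L2_space T (\<lambda>t. bar_interp h \<theta>s t - \<theta> t) \<and>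
        Linf_space T (\<lambda>t. B2h (\<iota> (hat_interp h \<theta>s t - \<theta> t))) \<and>
        integrable (time_measure T)
          (\<lambda>t. B2 (\<iota> (bar_interp h \<theta>s t - \<theta> t)) \<bullet> A1 (\<iota> (bar_interp h \<theta>s t - \<theta> t))) \<and>
        Linf_nrm T (\<lambda>t. Lh (\<iota> (hat_interp h vs t - v t))) + L2_nrm T (\<lambda>t. B1h (\<iota> (bar_interp h vs t - v t)))
          + Linf_nrm T (\<lambda>t. hat_interp h \<phi>s t - \<phi> t) + Linf_nrm T (\<lambda>t. \<iota> (hat_interp h \<theta>s t - \<theta> t))
          + L2_nrm T (\<lambda>t. bar_interp h \<theta>s t - \<theta> t) + Linf_nrm T (\<lambda>t. B2h (\<iota> (hat_interp h \<theta>s t - \<theta> t)))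
          + (LINT t|time_measure T. B2 (\<iota> (bar_interp h \<theta>s t - \<theta> t)) \<bullet> A1 (\<iota> (bar_interp h \<theta>s t - \<theta> t)))
        \<le> M * h powr (1/2)"
      if N: "0 < N" and h: "h = T / real N" and hle: "h \<in> {0<..<h00}"
        and disc: "discrete_solution \<eta> \<iota> L DA1 A1 DA2 A2 DB1 B1 B2 \<Phi> Lip \<theta>0 \<phi>0 v0 h N \<theta>s \<phi>s vs zs"
      for N h \<theta>s \<phi>s vs zs
    proof -
      have hpos: "0 < h" "h \<le> 1" "h \<le> h1" using hle h0 by (auto simp: h00_def)
      have E: "AE t in time_measure T. energy (hat_interp h vs t - v t) (hat_interp h \<phi>s t - \<phi> t)
          (hat_interp h \<theta>s t - \<theta> t) \<le> \<kappa> * h"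
        and D1: "integrable (time_measure T) (\<lambda>t. B1 (\<iota> (bar_interp h vs t - v t)) \<bullet> \<iota> (bar_interp h vs t - v t))"
        and D2: "L2_space T (\<lambda>t. bar_interp h \<theta>s t - \<theta> t)"
        and D3: "integrable (time_measure T)
          (\<lambda>t. B2 (\<iota> (bar_interp h \<theta>s t - \<theta> t)) \<bullet> A1 (\<iota> (bar_interp h \<theta>s t - \<theta> t)))"
        and le1: "(LINT t|time_measure T. B1 (\<iota> (bar_interp h vs t - v t)) \<bullet> \<iota> (bar_interp h vs t - v t)) \<le> \<kappa> * h"
        and le2: "(LINT t|time_measure T. (norm (bar_interp h \<theta>s t - \<theta> t))\<^sup>2) \<le> \<kappa> * h"
        and le3: "(LINT t|time_measure T. B2 (\<iota> (bar_interp h \<theta>s t - \<theta> t)) \<bullet> A1 (\<iota> (bar_interp h \<theta>s t - \<theta> t))) \<le> \<kappa> * h"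
        using est[OF N h hpos(3) disc] by blast+
      have index: "nat \<lfloor>t / h\<rfloor> < N" if "t \<in> {0<..<T}" for t
      proof -
        have "t / h < real N" "0 \<le> t / h" using that hpos N by (auto simp: h field_simps)
        then show ?thesis by linarith
      qed
      have hat_meas: "hat_interp h x \<in> borel_measurable (time_measure T)" for x :: "nat \<Rightarrow> 'v"
      proof -
        have [measurable]: "(\<lambda>t. x (nat \<lfloor>t / h\<rfloor>)) \<in> borel_measurable (time_measure T)"
          "(\<lambda>t. real (nat \<lfloor>t / h\<rfloor>)) \<in> borel_measurable (time_measure T)"
          "(\<lambda>t. diff_quot h x (nat \<lfloor>t / h\<rfloor>)) \<in> borel_measurable (time_measure T)"
          by (rule interp_measurable)+
        have [measurable]: "(\<lambda>t. t) \<in> borel_measurable (time_measure T)" by (rule time_measurable_id)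
        show ?thesis unfolding hat_interp_def[abs_def] Let_def by measurable
      qed
      have \<iota>_meas: "(\<lambda>t. \<iota> (f t)) \<in> borel_measurable (time_measure T)"
        if "f \<in> borel_measurable (time_measure T)" for f
        using that by (rule borel_measurable_continuous_on[rotated]) (intro continuous_intros)
      have [measurable]: "v \<in> borel_measurable (time_measure T)" "\<theta> \<in> borel_measurable (time_measure T)"
        "\<phi> \<in> borel_measurable (time_measure T)"
        using vint Linf by (auto simp: Linf_space_def)
      note [measurable] = hat_meas
      have m_v: "(\<lambda>t. \<iota> (hat_interp h vs t - v t)) \<in> borel_measurable (time_measure T)"
        by (rule \<iota>_meas) measurable
      have m_p: "(\<lambda>t. hat_interp h \<phi>s t - \<phi> t) \<in> borel_measurable (time_measure T)"
        by measurable
      have m_t: "(\<lambda>t. \<iota> (hat_interp h \<theta>s t - \<theta> t)) \<in> borel_measurable (time_measure T)"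
        by (rule \<iota>_meas) measurable
      have m_vb: "(\<lambda>t. \<iota> (bar_interp h vs t - v t)) \<in> borel_measurable (time_measure T)"
      proof (rule \<iota>_meas)
        have [measurable]: "(\<lambda>t. vs (Suc (nat \<lfloor>t / h\<rfloor>))) \<in> borel_measurable (time_measure T)"
          by (rule interp_measurable[where f = "\<lambda>n. vs (Suc n)"])
        show "(\<lambda>t. bar_interp h vs t - v t) \<in> borel_measurable (time_measure T)"
          unfolding bar_interp_def by measurable
      qed
      have sa: "selfadjoint_op DLh Lh" "selfadjoint_op DB1h B1h" "selfadjoint_op DB2h B2h"
        using sqrt_L sqrt_B1 sqrt_B2 by (auto simp: is_sqrt_op_def)
      have s: "sqrt (c * h) = sqrt c * h powr (1/2)" for c
        using hpos by (simp add: real_sqrt_mult powr_half_sqrt)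
      \<comment> \<open>\<open>L\<close> is defined on all of H, and the domain of an operator lies
        in that of its square root, so no domain condition arises here.\<close>
      have e_v_m: "(\<lambda>t. Lh (\<iota> (hat_interp h vs t - v t))) \<in> borel_measurable (time_measure T)"
        by (rule selfadjoint_op_measurable[OF sa(1) m_v]) (simp add: sqrt_op_dom[OF sqrt_L])
      have e_v_le: "AE t in time_measure T. norm (Lh (\<iota> (hat_interp h vs t - v t))) \<le> sqrt (\<kappa> * h)"
        using E
      proof eventually_elim
        case (elim t)
        have "(norm (Lh (\<iota> (hat_interp h vs t - v t))))\<^sup>2 = L (\<iota> (hat_interp h vs t - v t)) \<bullet> \<iota> (hat_interp h vs t - v t)"
          by (rule sqrt_op_norm[OF sqrt_L]) simp
        also have "\<dots> \<le> \<kappa> * h" using energy_bounds(1) elim by (rule order_trans)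
        finally show ?case by (rule real_le_rsqrt)
      qed
      have e_p_le: "AE t in time_measure T. norm (hat_interp h \<phi>s t - \<phi> t) \<le> sqrt (\<kappa> / \<omega> * h)"
        using E
      proof eventually_elim
        case (elim t)
        have "\<omega> * (norm (hat_interp h \<phi>s t - \<phi> t))\<^sup>2 \<le> \<kappa> * h"
          using \<omega>(2) order_trans[OF energy_bounds(2) elim] by (rule order_trans)
        then have "(norm (hat_interp h \<phi>s t - \<phi> t))\<^sup>2 \<le> \<kappa> / \<omega> * h" using \<omega>(1) by (simp add: field_simps)
        then show ?case by (rule real_le_rsqrt)
      qed
      have e_t_le: "AE t in time_measure T. norm (\<iota> (hat_interp h \<theta>s t - \<theta> t)) \<le> sqrt (\<kappa> * h)"
        using E
      proof eventually_elim
        case (elim t)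
        have "(norm (\<iota> (hat_interp h \<theta>s t - \<theta> t)))\<^sup>2 \<le> \<kappa> * h"
          using energy_bounds(3) elim by (rule order_trans)
        then show ?case by (rule real_le_rsqrt)
      qed
      \<comment> \<open>At each time the hatted interpolant is a linear combination of two nodes in
        \<open>DA1\<close>, the first of which may be the initial datum; \<open>DA1\<close> lies in
        \<open>DB2\<close>.\<close>
      have hat_dom: "AE t in time_measure T. \<iota> (hat_interp h \<theta>s t - \<theta> t) \<in> DB2"
        using dom(1) AE_time_measure_in
      proof eventually_elim
        case (elim t)
        then show ?case
          using hat_interp_domain[OF disc index[of t]] DA1_DB2
          by (auto simp: blinfun.diff_right intro!: linear_op_diff(1)[OF B2_op(1)])
      qed
      have e_tB_m: "(\<lambda>t. B2h (\<iota> (hat_interp h \<theta>s t - \<theta> t))) \<in> borel_measurable (time_measure T)"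
        by (rule selfadjoint_op_measurable[OF sa(3) m_t])
          (use hat_dom in eventually_elim, rule sqrt_op_dom[OF sqrt_B2])
      have e_tB_le: "AE t in time_measure T. norm (B2h (\<iota> (hat_interp h \<theta>s t - \<theta> t))) \<le> sqrt (\<eta> * \<kappa> * h)"
        using E hat_dom
      proof eventually_elim
        case (elim t)
        have "(norm (B2h (\<iota> (hat_interp h \<theta>s t - \<theta> t))))\<^sup>2 =
            B2s (hat_interp h \<theta>s t - \<theta> t) (hat_interp h \<theta>s t - \<theta> t)"
          using sqrt_op_norm[OF sqrt_B2 elim(2)] B2s_apply[OF elim(2)] by simp
        also have "\<dots> \<le> \<eta> * (\<kappa> * h)"
          using energy_bounds(4) mult_left_mono[OF elim(1), of \<eta>] \<eta>_pos by (meson less_imp_le order_trans)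
        finally show ?case by (intro real_le_rsqrt) (simp add: mult.assoc)
      qed
      have bar_dom: "AE t in time_measure T. \<iota> (bar_interp h vs t - v t) \<in> DB1"
        using dom(2) AE_time_measure_in
      proof eventually_elim
        case (elim t)
        then show ?case
          using discrete_velocity_domain[OF disc index[of t]]
          by (auto simp: bar_interp_def blinfun.diff_right intro!: linear_op_diff(1)[OF B1_op(1)])
      qed
      have e_vB_m: "(\<lambda>t. B1h (\<iota> (bar_interp h vs t - v t))) \<in> borel_measurable (time_measure T)"
        by (rule selfadjoint_op_measurable[OF sa(2) m_vb])
          (use bar_dom in eventually_elim, rule sqrt_op_dom[OF sqrt_B1])
      have sq: "AE t in time_measure T. B1 (\<iota> (bar_interp h vs t - v t)) \<bullet> \<iota> (bar_interp h vs t - v t)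
          = (norm (B1h (\<iota> (bar_interp h vs t - v t))))\<^sup>2"
        using bar_dom by eventually_elim (rule sqrt_op_norm[OF sqrt_B1, symmetric])
      have sq_m: "(\<lambda>t. (norm (B1h (\<iota> (bar_interp h vs t - v t))))\<^sup>2) \<in> borel_measurable (time_measure T)"
        using e_vB_m by measurable
      have e_vB: "L2_space T (\<lambda>t. B1h (\<iota> (bar_interp h vs t - v t)))"
        unfolding L2_space_def using e_vB_m integrable_cong_AE_imp[OF D1 sq_m sq] by simp
      have e_vB_le: "L2_nrm T (\<lambda>t. B1h (\<iota> (bar_interp h vs t - v t))) \<le> sqrt (\<kappa> * h)"
      proof (rule L2_nrm_le)
        show "(LINT t|time_measure T. (norm (B1h (\<iota> (bar_interp h vs t - v t))))\<^sup>2) \<le> (sqrt (\<kappa> * h))\<^sup>2"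
          using le1 integral_cong_AE[OF borel_measurable_integrable[OF D1] sq_m sq] \<kappa> hpos by simp
      qed (use \<kappa> hpos in simp)
      have e_tV_le: "L2_nrm T (\<lambda>t. bar_interp h \<theta>s t - \<theta> t) \<le> sqrt (\<kappa> * h)"
        by (rule L2_nrm_le) (use le2 \<kappa> hpos in auto)
      \<comment> \<open>The last integral is of order h rather than of order its square root; for
        \<open>h \<le> 1\<close> it fits the common rate.\<close>
      have "h = h powr (1/2) * h powr (1/2)" using hpos by (simp add: powr_half_sqrt)
      moreover have "h powr (1/2) \<le> 1" using hpos by (simp add: powr_half_sqrt)
      ultimately have "h \<le> h powr (1/2)"
        by (metis mult_left_le powr_ge_zero)
      then have "\<kappa> * h \<le> \<kappa> * h powr (1/2)" using \<kappa> by (intro mult_left_mono)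
      moreover have "0 \<le> h powr (1/2)" by simp
      moreover have "Linf_nrm T (\<lambda>t. Lh (\<iota> (hat_interp h vs t - v t))) \<le> sqrt (\<kappa> * h)"
        by (rule Linf_nrm_le[OF e_v_m e_v_le]) (use \<kappa> hpos in simp)
      moreover have "Linf_nrm T (\<lambda>t. hat_interp h \<phi>s t - \<phi> t) \<le> sqrt (\<kappa> / \<omega> * h)"
        by (rule Linf_nrm_le[OF m_p e_p_le]) (use \<kappa> hpos \<omega>(1) in simp)
      moreover have "Linf_nrm T (\<lambda>t. \<iota> (hat_interp h \<theta>s t - \<theta> t)) \<le> sqrt (\<kappa> * h)"
        by (rule Linf_nrm_le[OF m_t e_t_le]) (use \<kappa> hpos in simp)
      moreover have "Linf_nrm T (\<lambda>t. B2h (\<iota> (hat_interp h \<theta>s t - \<theta> t))) \<le> sqrt (\<eta> * \<kappa> * h)"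
        by (rule Linf_nrm_le[OF e_tB_m e_tB_le]) (use \<kappa> hpos \<eta>_pos in simp)
      ultimately have "Linf_nrm T (\<lambda>t. Lh (\<iota> (hat_interp h vs t - v t)))
          + L2_nrm T (\<lambda>t. B1h (\<iota> (bar_interp h vs t - v t)))
          + Linf_nrm T (\<lambda>t. hat_interp h \<phi>s t - \<phi> t) + Linf_nrm T (\<lambda>t. \<iota> (hat_interp h \<theta>s t - \<theta> t))
          + L2_nrm T (\<lambda>t. bar_interp h \<theta>s t - \<theta> t) + Linf_nrm T (\<lambda>t. B2h (\<iota> (hat_interp h \<theta>s t - \<theta> t)))
          + (LINT t|time_measure T. B2 (\<iota> (bar_interp h \<theta>s t - \<theta> t)) \<bullet> A1 (\<iota> (bar_interp h \<theta>s t - \<theta> t)))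
        \<le> M * h powr (1/2)"
        using e_vB_le e_tV_le le3 unfolding s M_def distrib_right by linarith
      then show ?thesis
        using Linf_spaceI[OF e_v_m e_v_le] e_vB Linf_spaceI[OF m_p e_p_le] Linf_spaceI[OF m_t e_t_le] D2
          Linf_spaceI[OF e_tB_m e_tB_le] D3 by blast
    qed
    ultimately show ?thesis unfolding Let_def by blast
  qed
qed

end
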